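(* Let $\Bbbk$ be an algebraically closed field of characteristic $0$, let $A$ be the incidence algebra over $\Bbbk$ of $\mathfrak{S}_n$ with respect to the Bruhat order, and for $w\in\mathfrak{S}_n$ let $L_w$ be the simple $A$-module indexed by $w$. Then $L_w$ is perfect if and only if $w$ is the longest element of some parabolic subgroup of $\mathfrak{S}_n$.
   Context: $\mathfrak{S}_n$ is the Coxeter group with simple reflections $\sigma_i=(i,i+1)$; a parabolic subgroup is a subgroup generated by a subset (possibly empty) of the simple reflections. The incidence algebra $A$ is the path algebra of the quiver with vertices $\mathfrak{S}_n$ and an arrow $p\to q$ whenever $p$ covers $q$ in the Bruhat order, modulo the relations that any two paths with the same endpoints coincide. $L_w$ is one-dimensional at $w$, zero elsewhere, with arrows acting by zero. Modules are finite-dimensional left modules. $\mathbf{grade}(M)=\min\{i:\mathrm{Ext}^i_A(M,A)\ne0\}$, and a module $M$ is perfect if $\mathbf{grade}(M)$ equals the projective dimension of $M$. *)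

theory Defs
  imports "HOL-Combinatorics.Permutations" "HOL-Combinatorics.Transposition"
    "HOL-Computational_Algebra.Polynomial" "HOL-Library.Extended_Nat"
    "Jordan_Normal_Form.Matrix"
begin

type_synonym perm = "nat \<Rightarrow> nat"

text \<open>S_n acts on {0,...,n-1}; the simple reflection sref i is the paper's
  sigma_(i+1) = (i+1, i+2) after the shift of labels by one.\<close>

definition Sym :: "nat \<Rightarrow> perm set" where
  "Sym n = {p. p permutes {..<n}}"

definition sref :: "nat \<Rightarrow> perm" where
  "sref i = Transposition.transpose i (Suc i)"

definition simple_idx :: "nat \<Rightarrow> nat set" where
  "simple_idx n = {i. Suc i < n}"

definition clen :: "nat \<Rightarrow> perm \<Rightarrow> nat" where
  "clen n w = (LEAST k. \<exists>is. length is = k \<and> set is \<subseteq> simple_idx n \<and>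
                 w = foldr (\<lambda>i f. sref i \<circ> f) is id)"

definition reflections :: "nat \<Rightarrow> perm set" where
  "reflections n = {x \<circ> sref i \<circ> inv_into UNIV x | x i. x \<in> Sym n \<and> i \<in> simple_idx n}"

definition bruhat_step :: "nat \<Rightarrow> perm \<Rightarrow> perm \<Rightarrow> bool" where
  "bruhat_step n u w \<longleftrightarrow> u \<in> Sym n \<and> (\<exists>t\<in>reflections n. w = u \<circ> t) \<and> clen n u < clen n w"

definition bruhat_le :: "nat \<Rightarrow> perm \<Rightarrow> perm \<Rightarrow> bool" where
  "bruhat_le n u w \<longleftrightarrow> u \<in> Sym n \<and> w \<in> Sym n \<and> (bruhat_step n)\<^sup>*\<^sup>* u w"

definition bruhat_less :: "nat \<Rightarrow> perm \<Rightarrow> perm \<Rightarrow> bool" where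
  "bruhat_less n u w \<longleftrightarrow> bruhat_le n u w \<and> u \<noteq> w"

text \<open>p covers q in the Bruhat order (this is an arrow p -> q of the quiver).\<close>
definition covers :: "nat \<Rightarrow> perm \<Rightarrow> perm \<Rightarrow> bool" where
  "covers n p q \<longleftrightarrow> bruhat_less n q p \<and> \<not> (\<exists>z. bruhat_less n q z \<and> bruhat_less n z p)"

inductive_set parabolic :: "nat \<Rightarrow> nat set \<Rightarrow> perm set" for n J where
  par_id: "id \<in> parabolic n J"
| par_gen: "i \<in> J \<Longrightarrow> sref i \<in> parabolic n J"
| par_mult: "x \<in> parabolic n J \<Longrightarrow> y \<in> parabolic n J \<Longrightarrow> x \<circ> y \<in> parabolic n J"
| par_inv: "x \<in> parabolic n J \<Longrightarrow> inv_into UNIV x \<in> parabolic n J"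

definition longest_of_parabolic :: "nat \<Rightarrow> perm \<Rightarrow> bool" where
  "longest_of_parabolic n w \<longleftrightarrow>
     (\<exists>J \<subseteq> simple_idx n. w \<in> parabolic n J \<and> (\<forall>v \<in> parabolic n J. clen n v \<le> clen n w))"

section \<open>Finite-dimensional left A-modules as representations of the bound quiver\<close>

text \<open>A module M: a space k^(rdim M p) at each vertex p, and for each arrow p -> q
  (p covers q) a matrix rmap M p q : k^(rdim M p) -> k^(rdim M q).\<close>
record 'k rep =
  rdim :: "perm \<Rightarrow> nat"
  rmap :: "perm \<Rightarrow> perm \<Rightarrow> 'k mat"

definition is_path :: "nat \<Rightarrow> perm list \<Rightarrow> bool" where
  "is_path n ps \<longleftrightarrow> ps \<noteq> [] \<and> set ps \<subseteq> Sym n \<and>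
     (\<forall>i. Suc i < length ps \<longrightarrow> covers n (ps ! i) (ps ! Suc i))"

fun path_map :: "('k::field) rep \<Rightarrow> perm list \<Rightarrow> 'k mat" where
  "path_map M [] = 0\<^sub>m 0 0"
| "path_map M [p] = 1\<^sub>m (rdim M p)"
| "path_map M (p # q # rest) = path_map M (q # rest) * rmap M p q"

definition is_module :: "nat \<Rightarrow> ('k::field) rep \<Rightarrow> bool" where
  "is_module n M \<longleftrightarrow>
     (\<forall>p q. covers n p q \<longrightarrow> rmap M p q \<in> carrier_mat (rdim M q) (rdim M p)) \<and>
     (\<forall>ps qs. is_path n ps \<longrightarrow> is_path n qs \<longrightarrow> hd ps = hd qs \<longrightarrow> last ps = last qs \<longrightarrow>
        path_map M ps = path_map M qs)"

definition is_hom :: "nat \<Rightarrow> ('k::field) rep \<Rightarrow> 'k rep \<Rightarrow> (perm \<Rightarrow> 'k mat) \<Rightarrow> bool" where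
  "is_hom n M N f \<longleftrightarrow>
     (\<forall>p \<in> Sym n. f p \<in> carrier_mat (rdim N p) (rdim M p)) \<and>
     (\<forall>p q. covers n p q \<longrightarrow> f q * rmap M p q = rmap N p q * f p)"

definition hom_surj :: "nat \<Rightarrow> ('k::field) rep \<Rightarrow> 'k rep \<Rightarrow> (perm \<Rightarrow> 'k mat) \<Rightarrow> bool" where
  "hom_surj n M N f \<longleftrightarrow>
     (\<forall>p \<in> Sym n. \<forall>v \<in> carrier_vec (rdim N p). \<exists>u \<in> carrier_vec (rdim M p). f p *\<^sub>v u = v)"

definition exact_at :: "nat \<Rightarrow> ('k::field) rep \<Rightarrow> 'k rep \<Rightarrow> 'k rep \<Rightarrow>
    (perm \<Rightarrow> 'k mat) \<Rightarrow> (perm \<Rightarrow> 'k mat) \<Rightarrow> bool" where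
  "exact_at n M N K f g \<longleftrightarrow>
     (\<forall>p \<in> Sym n. \<forall>v \<in> carrier_vec (rdim N p).
        g p *\<^sub>v v = 0\<^sub>v (rdim K p) \<longleftrightarrow> (\<exists>u \<in> carrier_vec (rdim M p). v = f p *\<^sub>v u))"

definition zero_module :: "nat \<Rightarrow> ('k::field) rep \<Rightarrow> bool" where
  "zero_module n M \<longleftrightarrow> (\<forall>p \<in> Sym n. rdim M p = 0)"

definition is_projective :: "nat \<Rightarrow> ('k::field) rep \<Rightarrow> bool" where
  "is_projective n P \<longleftrightarrow> is_module n P \<and>
     (\<forall>(M :: 'k rep) N g f. is_module n M \<longrightarrow> is_module n N \<longrightarrow> is_hom n M N g \<longrightarrow>
        hom_surj n M N g \<longrightarrow> is_hom n P N f \<longrightarrow>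
        (\<exists>h. is_hom n P M h \<and> (\<forall>p \<in> Sym n. g p * h p = f p)))"

definition proj_resolution :: "nat \<Rightarrow> ('k::field) rep \<Rightarrow> (nat \<Rightarrow> 'k rep) \<Rightarrow>
    (nat \<Rightarrow> perm \<Rightarrow> 'k mat) \<Rightarrow> bool" where
  "proj_resolution n M P d \<longleftrightarrow>
     (\<forall>i. is_projective n (P i)) \<and>
     is_hom n (P 0) M (d 0) \<and> hom_surj n (P 0) M (d 0) \<and>
     (\<forall>i. is_hom n (P (Suc i)) (P i) (d (Suc i))) \<and>
     (\<forall>i. exact_at n (P (Suc i)) (P i) (if i = 0 then M else P (i - 1)) (d (Suc i)) (d i))"

definition proj_dim :: "nat \<Rightarrow> ('k::field) rep \<Rightarrow> enat" where
  "proj_dim n M =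
     (if \<exists>m P d. proj_resolution n M P d \<and> (\<forall>i>m. zero_module n (P i))
      then enat (LEAST m. \<exists>P d. proj_resolution n M P d \<and> (\<forall>i>m. zero_module n (P i)))
      else \<infinity>)"

definition cohom_nonzero :: "nat \<Rightarrow> (nat \<Rightarrow> ('k::field) rep) \<Rightarrow> (nat \<Rightarrow> perm \<Rightarrow> 'k mat) \<Rightarrow>
    'k rep \<Rightarrow> nat \<Rightarrow> bool" where
  "cohom_nonzero n P d N i \<longleftrightarrow>
     (\<exists>f. is_hom n (P i) N f \<and>
        (\<forall>p \<in> Sym n. f p * d (Suc i) p = 0\<^sub>m (rdim N p) (rdim (P (Suc i)) p)) \<and>
        (case i of
           0 \<Rightarrow> \<not> (\<forall>p \<in> Sym n. f p = 0\<^sub>m (rdim N p) (rdim (P 0) p))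
         | Suc j \<Rightarrow> \<not> (\<exists>g. is_hom n (P j) N g \<and> (\<forall>p \<in> Sym n. f p = g p * d (Suc j) p))))"

definition ext_nonzero :: "nat \<Rightarrow> nat \<Rightarrow> ('k::field) rep \<Rightarrow> 'k rep \<Rightarrow> bool" where
  "ext_nonzero n i M N =
     (let Pd = (SOME Pd. proj_resolution n M (fst Pd) (snd Pd)) in
      cohom_nonzero n (fst Pd) (snd Pd) N i)"

definition Sym_enum :: "nat \<Rightarrow> perm list" where
  "Sym_enum n = (SOME xs. distinct xs \<and> set xs = Sym n)"

text \<open>e_y A has basis the (classes of) paths ending at y, i.e. their starting
  vertices x; the arrow p -> q sends the path x ~> p to x ~> p -> q.\<close>
definition reg_basis :: "nat \<Rightarrow> perm \<Rightarrow> perm list" where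
  "reg_basis n y = filter (\<lambda>x. (covers n)\<^sup>*\<^sup>* x y) (Sym_enum n)"

definition regular_module :: "nat \<Rightarrow> ('k::field) rep" where
  "regular_module n =
     \<lparr> rdim = (\<lambda>y. if y \<in> Sym n then length (reg_basis n y) else 0),
       rmap = (\<lambda>p q. mat (length (reg_basis n q)) (length (reg_basis n p))
                 (\<lambda>(i, j). if reg_basis n q ! i = reg_basis n p ! j then 1 else 0)) \<rparr>"

definition simple_module :: "nat \<Rightarrow> perm \<Rightarrow> ('k::field) rep" where
  "simple_module n w =
     \<lparr> rdim = (\<lambda>p. if p = w then 1 else 0),
       rmap = (\<lambda>p q. 0\<^sub>m (if q = w then 1 else 0) (if p = w then 1 else 0)) \<rparr>"

definition grade :: "nat \<Rightarrow> ('k::field) rep \<Rightarrow> enat" where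
  "grade n M =
     (if \<exists>i. ext_nonzero n i M (regular_module n)
      then enat (LEAST i. ext_nonzero n i M (regular_module n)) else \<infinity>)"

definition perfect :: "nat \<Rightarrow> ('k::field) rep \<Rightarrow> bool" where
  "perfect n M \<longleftrightarrow> grade n M = proj_dim n M"

end

theory Submission
  imports Defs
begin

text \<open>Fix a reduced word of \<open>w\<close>, of length \<open>l\<close>, and let \<open>dem I\<close> be the Demazure product of a subword
  \<open>I\<close>. Then \<open>L\<^sub>w\<close> has a projective resolution whose term in degree \<open>i\<close> is the direct sum of the
  \<open>A e\<^sub>y\<close> with \<open>y = dem I\<close>, over the subwords \<open>I\<close> with \<open>l - i\<close> letters, with the signs of a cube.
  Exactness at a vertex \<open>p\<close> follows by induction on the word: passing from \<open>v\<close> to \<open>w = v s > v\<close>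
  amounts to the cone of the inclusion of the complex of \<open>v\<close> at \<open>p\<close> into that at \<open>min (p, p s)\<close>,
  because \<open>p \<le> max (y, y s)\<close> iff \<open>min (p, p s) \<le> y\<close>.

  Consequently \<open>Ext\<^sup>i (L\<^sub>w, A e\<^sub>x)\<close> is the homology, at the subwords with \<open>l - i\<close> letters, of the
  augmented simplicial complex of all \<open>I\<close> with \<open>dem I \<le> x\<close>. For \<open>x = id\<close> only the empty subword
  is left, so \<open>L\<^sub>w\<close> has projective dimension \<open>l\<close>, and it is perfect iff none of these complexes has
  homology outside the empty subword. If \<open>w\<close> is longest in \<open>W\<^sub>J\<close>, then the elements of \<open>W\<^sub>J\<close> below
  \<open>x\<close> are just \<open>id\<close>, or they are stable under the Demazure action of some \<open>s \<in> J\<close>; in the second case a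
  reduced word of \<open>w\<close> ending in \<open>s\<close> makes the complex a cone. If \<open>w\<close> is not longest in its
  parabolic closure, an Euler characteristic shows that some complex has homology.\<close>

text \<open>Several subwords may share a Demazure product, so the resolution is in general not
  minimal, and its length alone only bounds the projective dimension from above. The nonzero Ext in
  degree l pins it down; after that, perfectness means that Ext into A vanishes in all degrees below
  l. The Demazure product replaces the ordinary product because selecting one more letter can only
  raise it. Hence the subwords with \<open>p \<le> dem I\<close> form an up-set of the cube, those
  with \<open>dem I \<le> x\<close> a down-set, and a single matrix of signs serves as the
  differential on both. Two obstacles shape the homological part. \<open>ext_nonzero\<close>
  evaluates an unspecified resolution, so independence of the resolution comes before any
  computation. And the word that turns the complex of x into a cone varies with x, while the
  complexes of two reduced words of w are not related directly; they are compared only through the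
  Ext groups that both compute.\<close>

lemma sref_apply: "sref i x = (if x = i then Suc i else if x = Suc i then i else x)"
  by (auto simp: sref_def transpose_def)

lemma sref_sref [simp]: "sref i (sref i x) = x"
  by (simp add: sref_def)

lemma sref_comp [simp]: "sref i \<circ> sref i = id"
  by (simp add: sref_def)

lemma comp_sref_sref [simp]: "w \<circ> sref i \<circ> sref i = w"
  by (simp add: comp_assoc)

lemma sref_Sym: "i \<in> simple_idx n \<Longrightarrow> sref i \<in> Sym n"
  by (auto simp: Sym_def sref_def simple_idx_def intro!: permutes_swap_id)

lemma id_Sym [simp]: "id \<in> Sym n"
  by (simp add: Sym_def permutes_id)

lemma comp_Sym: "u \<in> Sym n \<Longrightarrow> v \<in> Sym n \<Longrightarrow> u \<circ> v \<in> Sym n"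
  by (auto simp: Sym_def permutes_compose)

lemma finite_Sym [simp]: "finite (Sym n)"
  by (simp add: Sym_def finite_permutations)

lemma inj_Sym: "u \<in> Sym n \<Longrightarrow> inj u"
  by (auto simp: Sym_def permutes_inj)

lemma Sym_eq_iff: "u \<in> Sym n \<Longrightarrow> u a = u b \<longleftrightarrow> a = b"
  by (simp add: inj_Sym inj_eq)

section \<open>Length and inversions\<close>

definition inversions :: "nat \<Rightarrow> perm \<Rightarrow> (nat \<times> nat) set" where
  "inversions n w = {(a, b). a < b \<and> b < n \<and> w b < w a}"

lemma finite_inversions [simp]: "finite (inversions n w)"
  by (rule finite_subset[of _ "{..<n} \<times> {..<n}"]) (auto simp: inversions_def)

text \<open>The pair (i, Suc i) is the only one whose order \<open>sref i\<close> reverses. At an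
  ascent it is not an inversion of w, so \<open>sref i\<close> carries the inversions of w
  bijectively to the remaining inversions of the product.\<close>

lemma card_inversions_ascent:
  assumes i: "i \<in> simple_idx n" and a: "w i < w (Suc i)"
  shows "card (inversions n (w \<circ> sref i)) = Suc (card (inversions n w))"
proof -
  let ?s = "map_prod (sref i) (sref i)"
  have n: "Suc i < n" using i by (simp add: simple_idx_def)
  have eq: "inversions n (w \<circ> sref i) = insert (i, Suc i) (?s ` inversions n w)"
  proof (intro equalityI subsetI)
    fix z assume z: "z \<in> inversions n (w \<circ> sref i)"
    obtain x y where zz: "z = (x, y)" by force
    have "(x, y) = (i, Suc i) \<or> (sref i x, sref i y) \<in> inversions n w"
      using z a n by (auto simp: zz inversions_def sref_apply split: if_splits)
    moreover have "(x, y) = ?s (sref i x, sref i y)" by simp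
    ultimately show "z \<in> insert (i, Suc i) (?s ` inversions n w)"
      unfolding zz by (metis image_eqI insert_iff)
  next
    fix z assume "z \<in> insert (i, Suc i) (?s ` inversions n w)"
    then consider "z = (i, Suc i)" | x y where "z = (sref i x, sref i y)" "x < y" "y < n" "w y < w x"
      by (auto simp: inversions_def)
    then show "z \<in> inversions n (w \<circ> sref i)"
    proof cases
      case 2
      then have "sref i x < sref i y" "sref i y < n" using a n by (auto simp: sref_apply)
      then show ?thesis using 2 by (simp add: inversions_def)
    qed (use a n in \<open>simp add: inversions_def sref_apply\<close>)
  qed
  have "(i, Suc i) \<notin> ?s ` inversions n w"
  proof
    assume "(i, Suc i) \<in> ?s ` inversions n w"
    then obtain x y where xy: "x < y" "sref i x = i" "sref i y = Suc i"
      by (auto simp: inversions_def)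
    from xy(2,3) have "x = Suc i" "y = i" by (auto simp: sref_apply split: if_splits)
    with xy(1) show False by simp
  qed
  moreover have "inj_on ?s (inversions n w)"
    by (rule inj_on_inverseI[of _ ?s]) (auto simp: map_prod_def split: prod.splits)
  ultimately show ?thesis by (simp add: eq card_image)
qed

text \<open>Words are stored backwards: a new head multiplies on the right, the side on which a
  letter compares two neighbouring positions of w. \<open>foldr_sref\<close> translates to the order
  used by \<open>clen\<close>.\<close>

fun wprod :: "nat list \<Rightarrow> perm" where
  "wprod [] = id"
| "wprod (i # ws) = wprod ws \<circ> sref i"

lemma wprod_append: "wprod (xs @ ys) = wprod ys \<circ> wprod xs"
  by (induction xs) (auto simp: comp_assoc)

lemma wprod_Sym: "set ws \<subseteq> simple_idx n \<Longrightarrow> wprod ws \<in> Sym n"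
  by (induction ws) (auto simp: sref_Sym comp_Sym)

lemma foldr_sref: "foldr (\<lambda>i f. sref i \<circ> f) is id = wprod (rev is)"
  by (induction "is") (auto simp: wprod_append)

text \<open>The descent case is the ascent case for \<open>w \<circ> sref i\<close>. The second
  claim gives the truncated subtraction in the first its intended meaning.\<close>

lemma card_inversions_comp_sref:
  assumes w: "w \<in> Sym n" and i: "i \<in> simple_idx n"
  shows "card (inversions n (w \<circ> sref i)) =
    (if w i < w (Suc i) then Suc (card (inversions n w)) else card (inversions n w) - 1)"
    "\<not> w i < w (Suc i) \<Longrightarrow> card (inversions n w) > 0"
proof -
  { assume n: "\<not> w i < w (Suc i)"
    have "w i \<noteq> w (Suc i)" using Sym_eq_iff[OF w] by simp
    with n have "(w \<circ> sref i) i < (w \<circ> sref i) (Suc i)" by (simp add: sref_apply)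
    from card_inversions_ascent[of i n "w \<circ> sref i", OF i this]
    have "card (inversions n w) = Suc (card (inversions n (w \<circ> sref i)))" by simp }
  note * = this
  show "card (inversions n (w \<circ> sref i)) =
    (if w i < w (Suc i) then Suc (card (inversions n w)) else card (inversions n w) - 1)"
    using * card_inversions_ascent[OF i] by auto
  show "\<not> w i < w (Suc i) \<Longrightarrow> card (inversions n w) > 0" using * by auto
qed

lemma card_inversions_wprod:
  "set ws \<subseteq> simple_idx n \<Longrightarrow> card (inversions n (wprod ws)) \<le> length ws"
proof (induction ws)
  case Nil
  have "inversions n id = {}" by (auto simp: inversions_def)
  then show ?case by (simp only: wprod.simps card.empty le0)
next
  case (Cons i ws)
  then have "card (inversions n (wprod ws)) \<le> length ws" "wprod ws \<in> Sym n" "i \<in> simple_idx n"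
    by (auto simp: wprod_Sym)
  then show ?case using card_inversions_comp_sref[of "wprod ws" n i]
    by (auto simp del: o_apply)
qed

text \<open>An increasing map lies above the identity pointwise, and a permutation of an initial
  segment with this property is the identity.\<close>

lemma Sym_no_descent:
  assumes w: "w \<in> Sym n" and a: "\<And>i. i \<in> simple_idx n \<Longrightarrow> w i < w (Suc i)"
  shows "w = id"
proof -
  have "x < n \<longrightarrow> x \<le> w x" for x
  proof (induction x)
    case (Suc x)
    then show ?case using a[of x] by (force simp: simple_idx_def)
  qed simp
  then show ?thesis using w permutes_natset_ge[of w "{..<n}"] by (auto simp: Sym_def)
qed

lemma word_exists:
  "w \<in> Sym n \<Longrightarrow> \<exists>ws. set ws \<subseteq> simple_idx n \<and> wprod ws = w \<and> length ws = card (inversions n w)"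
proof (induction "card (inversions n w)" arbitrary: w rule: less_induct)
  case less
  show ?case
  proof (cases "\<forall>i\<in>simple_idx n. w i < w (Suc i)")
    case True
    then have "w = id" using Sym_no_descent less.prems by blast
    moreover have "inversions n id = {}" by (auto simp: inversions_def)
    ultimately show ?thesis by (intro exI[of _ "[]"]) (simp only: wprod.simps, simp)
  next
    case False
    then obtain i where i: "i \<in> simple_idx n" "\<not> w i < w (Suc i)" by auto
    note c = card_inversions_comp_sref[OF less.prems i(1)]
    have s: "w \<circ> sref i \<in> Sym n" using less.prems i sref_Sym comp_Sym by blast
    from less.hyps[OF _ s] c i obtain ws where
      "set ws \<subseteq> simple_idx n" "wprod ws = w \<circ> sref i" "length ws = card (inversions n (w \<circ> sref i))"
      by force
    then show ?thesis using c i by (intro exI[of _ "i # ws"]) auto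
  qed
qed

lemma clen_eq: assumes w: "w \<in> Sym n" shows "clen n w = card (inversions n w)"
proof -
  obtain ws where ws: "set ws \<subseteq> simple_idx n" "wprod ws = w" "length ws = card (inversions n w)"
    using word_exists[OF w] by blast
  show ?thesis unfolding clen_def
  proof (rule Least_equality)
    show "\<exists>is. length is = card (inversions n w) \<and> set is \<subseteq> simple_idx n \<and>
        w = foldr (\<lambda>i f. sref i \<circ> f) is id"
      using ws by (intro exI[of _ "rev ws"]) (auto simp: foldr_sref)
  next
    fix k assume "\<exists>is. length is = k \<and> set is \<subseteq> simple_idx n \<and> w = foldr (\<lambda>i f. sref i \<circ> f) is id"
    then show "card (inversions n w) \<le> k"
      using card_inversions_wprod[of "rev _" n] by (fastforce simp: foldr_sref)
  qed
qed

lemma clen_comp_sref: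
  assumes w: "w \<in> Sym n" and i: "i \<in> simple_idx n"
  shows "clen n (w \<circ> sref i) = (if w i < w (Suc i) then Suc (clen n w) else clen n w - 1)"
    "\<not> w i < w (Suc i) \<Longrightarrow> clen n w > 0"
  using card_inversions_comp_sref[OF w i] w i by (auto simp: clen_eq comp_Sym sref_Sym)

lemma clen_id [simp]: "clen n id = 0"
proof -
  have "inversions n id = {}" by (auto simp: inversions_def)
  then show ?thesis by (simp add: clen_eq)
qed

lemma clen_descent: 
  assumes w: "w \<in> Sym n" and i: "i \<in> simple_idx n"
  shows "clen n (w \<circ> sref i) < clen n w \<longleftrightarrow> w (Suc i) < w i"
    "clen n w < clen n (w \<circ> sref i) \<longleftrightarrow> w i < w (Suc i)"
    "\<not> clen n (w \<circ> sref i) < clen n w \<Longrightarrow> clen n (w \<circ> sref i) = Suc (clen n w)"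
    "clen n (w \<circ> sref i) < clen n w \<Longrightarrow> clen n w = Suc (clen n (w \<circ> sref i))"
proof -
  have "w i \<noteq> w (Suc i)" using Sym_eq_iff[OF w] by simp
  then show "clen n (w \<circ> sref i) < clen n w \<longleftrightarrow> w (Suc i) < w i"
    "clen n w < clen n (w \<circ> sref i) \<longleftrightarrow> w i < w (Suc i)"
    "\<not> clen n (w \<circ> sref i) < clen n w \<Longrightarrow> clen n (w \<circ> sref i) = Suc (clen n w)"
    "clen n (w \<circ> sref i) < clen n w \<Longrightarrow> clen n w = Suc (clen n (w \<circ> sref i))"
    using clen_comp_sref[OF w i] by (auto split: if_splits)
qed

section \<open>Reflections are transpositions, and how they change the length\<close>

lemma transpose_Sym: "a < n \<Longrightarrow> b < n \<Longrightarrow> Transposition.transpose a b \<in> Sym n"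
  by (auto simp: Sym_def intro!: permutes_swap_id)

text \<open>For b > a + 1 write (a b) = s (a+1 b) s with \<open>s = sref a\<close>. By induction the
  middle factor raises the length. The first s does so iff \<open>u a < u (Suc a)\<close>, the last
  iff \<open>u (Suc a) < u b\<close>; as \<open>u a < u b\<close>, at least one of them does, and
  the other lowers the length by at most 1.\<close>

lemma clen_comp_transpose:
  assumes "u \<in> Sym n" "a < b" "b < n" "u a < u b"
  shows "clen n u < clen n (u \<circ> Transposition.transpose a b)"
  using assms
proof (induction "b - a" arbitrary: a u)
  case (Suc d)
  have a: "a \<in> simple_idx n" using Suc.prems by (auto simp: simple_idx_def)
  show ?case
  proof (cases "b = Suc a")
    case True
    then show ?thesis using clen_descent(2)[of u n a] Suc.prems a by (simp add: sref_def)
  next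
    case False
    let ?t = "Transposition.transpose (Suc a) b"
    define u' where "u' = u \<circ> sref a"
    define v' where "v' = u' \<circ> ?t"
    have u'S: "u' \<in> Sym n" using a Suc.prems by (simp add: u'_def comp_Sym sref_Sym)
    have v'S: "v' \<in> Sym n" using u'S Suc.prems False by (simp add: v'_def comp_Sym transpose_Sym)
    have "clen n u' < clen n v'" unfolding v'_def
      using Suc.hyps(2) Suc.prems False
      by (intro Suc.hyps(1)) (auto simp: u'S, auto simp: u'_def sref_apply)
    moreover have eq: "u \<circ> Transposition.transpose a b = v' \<circ> sref a"
      using Suc.prems False by (auto simp: v'_def u'_def fun_eq_iff sref_def transpose_def)
    have val: "v' a = u (Suc a)" "v' (Suc a) = u b"
      using Suc.prems False by (auto simp: v'_def u'_def fun_eq_iff sref_def transpose_def)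
    have neq: "u (Suc a) \<noteq> u a" "u (Suc a) \<noteq> u b"
      using Sym_eq_iff[OF Suc.prems(1)] False by simp_all
    have l: "clen n u' = (if u a < u (Suc a) then Suc (clen n u) else clen n u - 1)"
        "\<not> u a < u (Suc a) \<Longrightarrow> clen n u > 0"
      using clen_comp_sref[OF Suc.prems(1) a] by (auto simp: u'_def)
    have r: "clen n (v' \<circ> sref a) = (if u (Suc a) < u b then Suc (clen n v') else clen n v' - 1)"
        "\<not> u (Suc a) < u b \<Longrightarrow> clen n v' > 0"
      using clen_comp_sref[OF v'S a] by (auto simp: val)
    ultimately show ?thesis unfolding eq using l r neq Suc.prems(4) by (auto split: if_splits)
  qed
qed simp

lemma reflectionsE:
  assumes "t \<in> reflections n"
  obtains a b where "a < b" "b < n" "t = Transposition.transpose a b"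
proof -
  obtain x i where x: "x \<in> Sym n" "i \<in> simple_idx n" "t = x \<circ> sref i \<circ> inv_into UNIV x"
    using assms by (auto simp: reflections_def)
  have p: "x permutes {..<n}" using x by (simp add: Sym_def)
  have "x \<circ> sref i = Transposition.transpose (x i) (x (Suc i)) \<circ> x"
    unfolding sref_def using transpose_comp_eq[of x "x i" "x (Suc i)"] p
    by (simp add: permutes_bij permutes_inverses(2))
  then have "t = Transposition.transpose (x i) (x (Suc i)) \<circ> (x \<circ> inv_into UNIV x)"
    using x by (simp add: comp_assoc)
  then have t: "t = Transposition.transpose (x i) (x (Suc i))"
    using permutes_inv_o[OF p] by simp
  have "x i < n" "x (Suc i) < n" "x i \<noteq> x (Suc i)"
    using permutes_in_image[OF p] x(2) Sym_eq_iff[OF x(1)] by (auto simp: simple_idx_def)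
  then show ?thesis using that[of "x i" "x (Suc i)"] that[of "x (Suc i)" "x i"] t
    by (metis linorder_neq_iff transpose_commute)
qed

lemma reflection_Sym: "t \<in> reflections n \<Longrightarrow> t \<in> Sym n"
  by (elim reflectionsE) (simp add: transpose_Sym)

lemma sref_reflection: "i \<in> simple_idx n \<Longrightarrow> sref i \<in> reflections n"
  unfolding reflections_def by (auto intro!: exI[of _ id])

lemma conj_reflection:
  assumes "t \<in> reflections n" "i \<in> simple_idx n"
  shows "sref i \<circ> t \<circ> sref i \<in> reflections n"
proof -
  obtain x j where x: "x \<in> Sym n" "j \<in> simple_idx n" "t = x \<circ> sref j \<circ> inv_into UNIV x"
    using assms by (auto simp: reflections_def)
  have "inv_into UNIV (sref i \<circ> x) = inv_into UNIV x \<circ> sref i"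
    using x(1) by (subst o_inv_distrib) (auto simp: Sym_def permutes_bij sref_def)
  then have "sref i \<circ> t \<circ> sref i = (sref i \<circ> x) \<circ> sref j \<circ> inv_into UNIV (sref i \<circ> x)"
    by (simp add: x comp_assoc)
  then show ?thesis unfolding reflections_def using x assms by (blast intro: comp_Sym sref_Sym)
qed

lemma clen_transpose_iff:
  assumes "u \<in> Sym n" "a < b" "b < n"
  shows "clen n u < clen n (u \<circ> Transposition.transpose a b) \<longleftrightarrow> u a < u b"
proof -
  let ?t = "Transposition.transpose a b"
  have "u a \<noteq> u b" using Sym_eq_iff[OF assms(1)] assms(2) by simp
  moreover have "clen n (u \<circ> ?t) < clen n u" if "u b < u a"
    using clen_comp_transpose[of "u \<circ> ?t" n a b] assms that by (auto simp: comp_Sym transpose_Sym comp_assoc)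
  ultimately show ?thesis using clen_comp_transpose[OF assms] by force
qed

text \<open>The order of the values of \<open>u\<close> at the two points moved by \<open>t\<close> is not affected by
  multiplication by a simple reflection other than \<open>t\<close>.\<close>

lemma bruhat_step_comp_sref:
  assumes s: "bruhat_step n u w" and i: "i \<in> simple_idx n" and ne: "w \<noteq> u \<circ> sref i"
  shows "bruhat_step n (u \<circ> sref i) (w \<circ> sref i)"
proof -
  obtain t where t: "t \<in> reflections n" "w = u \<circ> t" and u: "u \<in> Sym n" and l: "clen n u < clen n w"
    using s by (auto simp: bruhat_step_def)
  obtain a b where ab: "a < b" "b < n" "t = Transposition.transpose a b"
    using t(1) by (rule reflectionsE)
  have uab: "u a < u b" using l clen_transpose_iff[OF u ab(1,2)] t ab by simp
  let ?a = "sref i a" and ?b = "sref i b"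
  have conj: "sref i \<circ> t \<circ> sref i = Transposition.transpose ?a ?b"
  proof -
    have "sref i \<circ> t = Transposition.transpose ?a ?b \<circ> sref i"
      using transpose_comp_eq[of "sref i" ?a ?b] by (simp add: ab sref_def)
    then show ?thesis by simp
  qed
  have w: "w \<circ> sref i = (u \<circ> sref i) \<circ> Transposition.transpose ?a ?b"
  proof -
    have "(u \<circ> sref i) \<circ> (sref i \<circ> t \<circ> sref i) = w \<circ> sref i"
      using t(2) by (metis comp_assoc comp_sref_sref)
    then show ?thesis by (simp add: conj)
  qed
  \<comment> \<open>This is the only pair a < b whose order \<open>sref i\<close> would
    reverse.\<close>
  have "\<not> (a = i \<and> b = Suc i)" using ne t(2) ab(3) by (auto simp: sref_def)
  then have o: "?a < ?b" "?b < n" using ab i by (auto simp: sref_apply simple_idx_def)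
  have us: "u \<circ> sref i \<in> Sym n" using u i by (simp add: comp_Sym sref_Sym)
  have "clen n (u \<circ> sref i) < clen n (w \<circ> sref i)"
    unfolding w using clen_transpose_iff[OF us o] uab by simp
  then show ?thesis
    unfolding bruhat_step_def using us w conj conj_reflection[OF t(1) i] by auto
qed

section \<open>Basic properties of the Bruhat order\<close>

lemma bruhat_le_refl: "u \<in> Sym n \<Longrightarrow> bruhat_le n u u"
  by (simp add: bruhat_le_def)

lemma bruhat_le_trans: "bruhat_le n u v \<Longrightarrow> bruhat_le n v w \<Longrightarrow> bruhat_le n u w"
  by (auto simp: bruhat_le_def)

lemma bruhat_step_Sym: "bruhat_step n u w \<Longrightarrow> u \<in> Sym n \<and> w \<in> Sym n"
  by (auto simp: bruhat_step_def comp_Sym reflection_Sym)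

lemma bruhat_step_le: "bruhat_step n u w \<Longrightarrow> bruhat_le n u w"
  using bruhat_step_Sym by (auto simp: bruhat_le_def)

lemma bruhat_le_Sym: "bruhat_le n u w \<Longrightarrow> u \<in> Sym n \<and> w \<in> Sym n"
  by (simp add: bruhat_le_def)

lemma bruhat_le_clen: "bruhat_le n u w \<Longrightarrow> u = w \<or> clen n u < clen n w"
proof -
  assume "bruhat_le n u w"
  then have "(bruhat_step n)\<^sup>*\<^sup>* u w" by (simp add: bruhat_le_def)
  then show ?thesis
    by (induction rule: rtranclp_induct) (auto simp: bruhat_step_def)
qed

lemma bruhat_le_induct [consumes 1, case_names refl step]:
  assumes "bruhat_le n u w" and "u \<in> Sym n \<Longrightarrow> P u"
    and "\<And>v w. bruhat_le n u v \<Longrightarrow> bruhat_step n v w \<Longrightarrow> P v \<Longrightarrow> P w"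
  shows "P w"
proof -
  have u: "u \<in> Sym n" and r: "(bruhat_step n)\<^sup>*\<^sup>* u w" using assms(1) by (auto simp: bruhat_le_def)
  from r have "bruhat_le n u w \<and> P w"
  proof (induction rule: rtranclp_induct)
    case base
    then show ?case using u assms(2) bruhat_le_refl by blast
  next
    case (step v w)
    then show ?case using assms(3) bruhat_le_trans bruhat_step_le by blast
  qed
  then show ?thesis by simp
qed

section \<open>Demazure operators\<close>

definition up :: "nat \<Rightarrow> nat \<Rightarrow> perm \<Rightarrow> perm" where
  "up n i w = (if clen n w < clen n (w \<circ> sref i) then w \<circ> sref i else w)"

definition dn :: "nat \<Rightarrow> nat \<Rightarrow> perm \<Rightarrow> perm" where
  "dn n i w = (if clen n (w \<circ> sref i) < clen n w then w \<circ> sref i else w)"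

context
  fixes n i assumes i: "i \<in> simple_idx n"
begin

lemma step_sref: "w \<in> Sym n \<Longrightarrow> clen n w < clen n (w \<circ> sref i) \<Longrightarrow> bruhat_step n w (w \<circ> sref i)"
  using sref_reflection[OF i] by (auto simp: bruhat_step_def)

lemma comp_sref_Sym: "w \<in> Sym n \<Longrightarrow> w \<circ> sref i \<in> Sym n"
  by (simp add: comp_Sym sref_Sym i)

lemma up_Sym: "w \<in> Sym n \<Longrightarrow> up n i w \<in> Sym n"
  by (simp add: up_def comp_sref_Sym)

lemma dn_Sym: "w \<in> Sym n \<Longrightarrow> dn n i w \<in> Sym n"
  by (simp add: dn_def comp_sref_Sym)

lemma le_up: "w \<in> Sym n \<Longrightarrow> bruhat_le n w (up n i w)"
  by (simp add: up_def bruhat_le_refl bruhat_step_le step_sref)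

lemma dn_le: "w \<in> Sym n \<Longrightarrow> bruhat_le n (dn n i w) w"
  using bruhat_step_le[OF step_sref[of "w \<circ> sref i"]]
  by (auto simp: dn_def bruhat_le_refl comp_sref_Sym)

lemma up_dn [simp]: "w \<in> Sym n \<Longrightarrow> up n i (dn n i w) = up n i w"
  by (auto simp: dn_def up_def)

lemma dn_up [simp]: "w \<in> Sym n \<Longrightarrow> dn n i (up n i w) = dn n i w"
  by (auto simp: dn_def up_def)

lemma up_cases: "w \<in> Sym n \<Longrightarrow> (dn n i w = w \<and> up n i w = w \<circ> sref i) \<or> (dn n i w = w \<circ> sref i \<and> up n i w = w)"
  using clen_descent[of w n i, OF _ i] by (auto simp: dn_def up_def)

lemma comp_sref_le_up:
  assumes w: "w \<in> Sym n" shows "bruhat_le n (w \<circ> sref i) (up n i w)"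
proof (cases "clen n w < clen n (w \<circ> sref i)")
  case True
  then show ?thesis by (simp add: up_def bruhat_le_refl comp_sref_Sym w)
next
  case False
  then have "clen n (w \<circ> sref i) < clen n w" using clen_descent(3)[OF w i] by linarith
  then show ?thesis using False dn_le[OF w] by (simp add: up_def dn_def)
qed

lemma dn_le_comp_sref:
  assumes w: "w \<in> Sym n" shows "bruhat_le n (dn n i w) (w \<circ> sref i)"
proof (cases "clen n (w \<circ> sref i) < clen n w")
  case True
  then show ?thesis by (simp add: dn_def bruhat_le_refl comp_sref_Sym w)
next
  case False
  then have "clen n w < clen n (w \<circ> sref i)" using clen_descent(3)[OF w i] by linarith
  then show ?thesis using False le_up[OF w] by (simp add: up_def dn_def)
qed

text \<open>Either the step is the edge between u and u s, whose ends both operators identify, or it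
  yields a second relation \<open>u s \<le> w s\<close>. In the latter case it suffices that
  \<open>up w\<close> lies above both w and w s, and \<open>dn u\<close> below both u and u
  s.\<close>

lemma bruhat_step_up_dn:
  assumes "bruhat_step n u w"
  shows "bruhat_le n (up n i u) (up n i w) \<and> bruhat_le n (dn n i u) (dn n i w)"
proof (cases "w = u \<circ> sref i")
  case True
  have S: "u \<in> Sym n" "w \<in> Sym n" using bruhat_step_Sym assms by auto
  have "clen n (u \<circ> sref i) \<noteq> clen n u"
    using clen_descent(3)[OF S(1) i] by linarith
  then have "up n i u = up n i w" "dn n i u = dn n i w" by (auto simp: True up_def dn_def)
  then show ?thesis using up_Sym[OF S(1)] dn_Sym[OF S(1)] by (simp add: bruhat_le_refl)
next
  case False
  have S: "u \<in> Sym n" "w \<in> Sym n" using bruhat_step_Sym assms by auto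
  have 1: "bruhat_le n (u \<circ> sref i) (w \<circ> sref i)" "bruhat_le n u w"
    using bruhat_step_comp_sref[OF assms i False] bruhat_step_le assms by auto
  note 2 = le_up[OF S(2)] comp_sref_le_up[OF S(2)] dn_le[OF S(1)] dn_le_comp_sref[OF S(1)]
  show ?thesis
  proof
    show "bruhat_le n (up n i u) (up n i w)"
      using up_cases[OF S(1)] bruhat_le_trans[OF 1(1) 2(2)] bruhat_le_trans[OF 1(2) 2(1)] by auto
    show "bruhat_le n (dn n i u) (dn n i w)"
      using up_cases[OF S(2)] bruhat_le_trans[OF 2(4) 1(1)] bruhat_le_trans[OF 2(3) 1(2)] by auto
  qed
qed

lemma up_mono: "bruhat_le n u w \<Longrightarrow> bruhat_le n (up n i u) (up n i w)"
  by (induction rule: bruhat_le_induct)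
    (auto intro: bruhat_le_refl up_Sym bruhat_le_trans dest: bruhat_step_up_dn)

lemma dn_mono: "bruhat_le n u w \<Longrightarrow> bruhat_le n (dn n i u) (dn n i w)"
  by (induction rule: bruhat_le_induct)
    (auto intro: bruhat_le_refl dn_Sym bruhat_le_trans dest: bruhat_step_up_dn)

text \<open>\<open>dn\<close> is left adjoint to \<open>up\<close>: both are monotone,
  \<open>dn (up w) = dn w \<le> w\<close> and \<open>u \<le> up u = up (dn u)\<close>. This form of
  the lifting property drives the exactness of the cube, the computation of supports and the Euler
  sum.\<close>

lemma le_up_iff_dn_le:
  assumes "u \<in> Sym n" "w \<in> Sym n"
  shows "bruhat_le n u (up n i w) \<longleftrightarrow> bruhat_le n (dn n i u) w"
  using dn_mono[of u "up n i w"] up_mono[of "dn n i u" w] le_up[OF assms(1)] dn_le[OF assms(2)] assms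
  by (auto intro: bruhat_le_trans)

end

lemma id_bruhat_le: "w \<in> Sym n \<Longrightarrow> bruhat_le n id w"
proof (induction "clen n w" arbitrary: w rule: less_induct)
  case less
  show ?case
  proof (cases "\<exists>i\<in>simple_idx n. w (Suc i) < w i")
    case True
    then obtain i where i: "i \<in> simple_idx n" "clen n (w \<circ> sref i) < clen n w"
      using clen_descent less.prems by blast
    then have "bruhat_le n id (w \<circ> sref i)" using less comp_sref_Sym by blast
    moreover have "bruhat_le n (w \<circ> sref i) w" using dn_le[OF i(1) less.prems] i by (simp add: dn_def)
    ultimately show ?thesis by (rule bruhat_le_trans)
  next
    case False
    then have "w = id" using Sym_eq_iff[OF less.prems]
      by (intro Sym_no_descent[OF less.prems]) (metis linorder_neqE_nat n_not_Suc_n)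
    then show ?thesis by (simp add: bruhat_le_refl)
  qed
qed

section \<open>Reduced words and Demazure products\<close>

fun reduced :: "nat \<Rightarrow> nat list \<Rightarrow> bool" where
  "reduced n [] \<longleftrightarrow> True"
| "reduced n (i # ws) \<longleftrightarrow>
     i \<in> simple_idx n \<and> reduced n ws \<and> clen n (wprod ws) < clen n (wprod ws \<circ> sref i)"

lemma reduced_subset: "reduced n ws \<Longrightarrow> set ws \<subseteq> simple_idx n"
  by (induction ws) auto

lemma reduced_Sym: "reduced n ws \<Longrightarrow> wprod ws \<in> Sym n"
  using reduced_subset wprod_Sym by blast

lemma wprod_Cons_up:
  "reduced n (i # ws) \<Longrightarrow> wprod (i # ws) = up n i (wprod ws)"
  by (simp add: up_def)

lemma clen_reduced: "reduced n ws \<Longrightarrow> clen n (wprod ws) = length ws"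
proof (induction ws)
  case (Cons i ws)
  then have "wprod ws \<in> Sym n" "i \<in> simple_idx n" by (auto simp: reduced_Sym)
  from clen_descent(3)[OF this] Cons show ?case by (simp del: o_apply)
qed (simp only: wprod.simps clen_id list.size)

lemma reduced_word_ending:
  "w \<in> Sym n \<Longrightarrow> i \<in> simple_idx n \<Longrightarrow> clen n (w \<circ> sref i) < clen n w \<Longrightarrow>
    \<exists>ws. reduced n (i # ws) \<and> wprod (i # ws) = w"
proof (induction "clen n w" arbitrary: w i rule: less_induct)
  case less
  let ?v = "w \<circ> sref i"
  have v: "?v \<in> Sym n" using less.prems by (simp add: comp_sref_Sym)
  have "\<exists>ws. reduced n ws \<and> wprod ws = ?v"
  proof (cases "?v = id")
    case True
    then show ?thesis by (intro exI[of _ "[]"]) (simp only: wprod.simps reduced.simps)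
  next
    case False
    then obtain j where "j \<in> simple_idx n" "\<not> ?v j < ?v (Suc j)"
      using Sym_no_descent[OF v] by blast
    moreover have "?v j \<noteq> ?v (Suc j)" using Sym_eq_iff[OF v] by simp
    ultimately have "clen n (?v \<circ> sref j) < clen n ?v" "j \<in> simple_idx n"
      using clen_descent(1)[OF v, of j] by auto
    from less.hyps[OF less.prems(3) v this(2,1)] show ?thesis by blast
  qed
  then obtain ws where ws: "reduced n ws" "wprod ws = ?v" by blast
  then have "reduced n (i # ws) \<and> wprod (i # ws) = w"
    using less.prems by (simp only: reduced.simps wprod.simps comp_sref_sref simp_thms)
  then show ?case by blast
qed

lemma descent_exists:
  assumes "w \<in> Sym n" "w \<noteq> id"
  obtains i where "i \<in> simple_idx n" "clen n (w \<circ> sref i) < clen n w"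
proof -
  obtain j where "j \<in> simple_idx n" "\<not> w j < w (Suc j)"
    using Sym_no_descent[OF assms(1)] assms(2) by blast
  moreover have "w j \<noteq> w (Suc j)" using Sym_eq_iff[OF assms(1)] by simp
  ultimately show ?thesis using that clen_descent(1)[OF assms(1), of j] by auto
qed

lemma reduced_word:
  assumes "w \<in> Sym n"
  obtains ws where "reduced n ws" "wprod ws = w"
proof (cases "w = id")
  case True
  then show ?thesis using that[of "[]"] by (simp only: wprod.simps reduced.simps)
next
  case False
  then show ?thesis using that descent_exists[OF assms] reduced_word_ending[OF assms] by metis
qed

text \<open>The index \<open>I\<close> selects a subword of \<open>ws\<close>; the head of the list is the last letter.\<close>

primrec dem :: "nat \<Rightarrow> nat list \<Rightarrow> bool list \<Rightarrow> perm" where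
  "dem n [] I = id"
| "dem n (i # ws) I = (if hd I then up n i (dem n ws (tl I)) else dem n ws (tl I))"

lemma dem_Sym: "set ws \<subseteq> simple_idx n \<Longrightarrow> dem n ws I \<in> Sym n"
  by (induction ws arbitrary: I) (auto simp: up_Sym simp del: id_apply)

lemma clen_up: "i \<in> simple_idx n \<Longrightarrow> w \<in> Sym n \<Longrightarrow> clen n (up n i w) \<le> Suc (clen n w)"
  using clen_descent(3)[of w n i] by (auto simp: up_def)

abbreviation wt :: "bool list \<Rightarrow> nat" where "wt I \<equiv> count_list I True"

lemma clen_dem: "reduced n ws \<Longrightarrow> length I = length ws \<Longrightarrow> clen n (dem n ws I) \<le> wt I"
proof (induction ws arbitrary: I)
  case Nil
  then show ?case by (simp only: dem.simps clen_id le0)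
next
  case (Cons i ws)
  then have i: "i \<in> simple_idx n" and r: "reduced n ws" by auto
  obtain b J where I: "I = b # J" "length J = length ws" using Cons.prems(2) by (cases I) auto
  have "clen n (dem n ws J) \<le> wt J" using Cons.IH r I by blast
  with clen_up[OF i dem_Sym[OF reduced_subset[OF r]], of J] show ?case by (auto simp: I)
qed

lemma dem_replicate_True: "reduced n ws \<Longrightarrow> dem n ws (replicate (length ws) True) = wprod ws"
proof (induction ws)
  case (Cons i ws)
  then show ?case unfolding wprod_Cons_up[OF Cons.prems] by simp
qed (simp only: wprod.simps dem.simps)

lemma wt_le: "wt I \<le> length I"
  by (induction I) auto

lemma wt_eq_length: "wt I = length I \<longleftrightarrow> I = replicate (length I) True"
proof (induction I)
  case (Cons b I)
  show ?case using Cons wt_le[of I] by auto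
qed simp

text \<open>A Demazure product is no longer than the number of selected letters, so only the full
  subword reaches the length of w. At the vertex w the resolution is thereby reduced to degree
  0.\<close>

lemma wprod_le_dem_iff:
  assumes "reduced n ws" "length I = length ws"
  shows "bruhat_le n (wprod ws) (dem n ws I) \<longleftrightarrow> I = replicate (length ws) True"
proof
  assume "bruhat_le n (wprod ws) (dem n ws I)"
  then have "length ws \<le> wt I"
    using bruhat_le_clen[of n "wprod ws" "dem n ws I"] clen_reduced[OF assms(1)] clen_dem[OF assms] by force
  then show "I = replicate (length ws) True"
    using wt_le[of I] wt_eq_length[of I] assms(2) by simp
next
  assume "I = replicate (length ws) True"
  then show "bruhat_le n (wprod ws) (dem n ws I)"
    by (simp only: dem_replicate_True[OF assms(1)] bruhat_le_refl reduced_Sym[OF assms(1)])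
qed

section \<open>Supports and parabolic subgroups\<close>

text \<open>Phrased through the order, the set of letters of w is visibly independent of a reduced
  word and monotone in w. \<open>reduced_supp\<close> identifies it with the letters of any reduced
  word.\<close>

definition supp :: "nat \<Rightarrow> perm \<Rightarrow> nat set" where
  "supp n w = {i \<in> simple_idx n. bruhat_le n (sref i) w}"

lemma supp_mono: "bruhat_le n u w \<Longrightarrow> supp n u \<subseteq> supp n w"
  by (auto simp: supp_def intro: bruhat_le_trans)

lemma sref_neq_id: "sref i \<noteq> id"
  by (simp add: sref_def transpose_eq_id_iff)

lemma clen_sref: "i \<in> simple_idx n \<Longrightarrow> clen n (sref i) = 1"
  using clen_comp_sref(1)[of id n i] by (simp del: id_apply) (simp add: id_def)

lemma supp_id: "supp n id = {}"
proof -
  have False if "i \<in> simple_idx n" "bruhat_le n (sref i) id" for i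
    using bruhat_le_clen[OF that(2)] sref_neq_id by (simp only: clen_id) simp
  then show ?thesis by (auto simp: supp_def)
qed

text \<open>For i different from j, \<open>sref i\<close> has no descent at j, so
  \<open>dn n j\<close> fixes it and the adjunction removes \<open>up n j\<close> from the upper
  bound.\<close>

lemma supp_up:
  assumes j: "j \<in> simple_idx n" and w: "w \<in> Sym n"
  shows "supp n (up n j w) \<subseteq> insert j (supp n w)"
proof
  fix i assume "i \<in> supp n (up n j w)"
  then have i: "i \<in> simple_idx n" and le: "bruhat_le n (sref i) (up n j w)" by (auto simp: supp_def)
  show "i \<in> insert j (supp n w)"
  proof (cases "i = j")
    case False
    have "\<not> clen n (sref i \<circ> sref j) < clen n (sref i)"
      unfolding clen_descent(1)[OF sref_Sym[OF i] j] using False by (auto simp: sref_apply)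
    then have "dn n j (sref i) = sref i" by (simp add: dn_def)
    then show ?thesis using le le_up_iff_dn_le[OF j sref_Sym[OF i] w] i by (auto simp: supp_def)
  qed simp
qed

lemma supp_comp_sref:
  "j \<in> simple_idx n \<Longrightarrow> w \<in> Sym n \<Longrightarrow> supp n (w \<circ> sref j) \<subseteq> insert j (supp n w)"
  using supp_up supp_mono[OF comp_sref_le_up] by blast

lemma supp_wprod: "set ws \<subseteq> simple_idx n \<Longrightarrow> supp n (wprod ws) \<subseteq> set ws"
proof (induction ws)
  case Nil
  show ?case by (simp only: wprod.simps supp_id empty_subsetI)
next
  case (Cons i ws)
  then have "supp n (wprod ws \<circ> sref i) \<subseteq> insert i (supp n (wprod ws))" "set ws \<subseteq> simple_idx n"
    by (auto simp: wprod_Sym supp_comp_sref simp del: o_apply)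
  with Cons show ?case unfolding wprod.simps list.set by blast
qed

text \<open>At a descent \<open>up n i w = w\<close>, and monotonicity of \<open>up n i\<close>
  applied to \<open>id \<le> w\<close> gives \<open>sref i \<le> w\<close>.\<close>

lemma descent_supp:
  assumes w: "w \<in> Sym n" and i: "i \<in> simple_idx n" and "clen n (w \<circ> sref i) < clen n w"
  shows "i \<in> supp n w"
proof -
  have "up n i w = w" using assms(3) by (simp add: up_def)
  moreover have "up n i id = sref i" using clen_sref[OF i] by (simp add: up_def)
  ultimately show ?thesis using up_mono[OF i id_bruhat_le[OF w]] i by (simp add: supp_def)
qed

lemma reduced_supp: "reduced n ws \<Longrightarrow> supp n (wprod ws) = set ws"
proof (induction ws)
  case Nil
  show ?case by (simp only: wprod.simps supp_id list.set)
next
  case (Cons i ws)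
  then have i: "i \<in> simple_idx n" and r: "reduced n ws"
    and l: "clen n (wprod ws) < clen n (wprod ws \<circ> sref i)" by auto
  have "supp n (wprod ws) \<subseteq> supp n (wprod (i # ws))"
    unfolding wprod_Cons_up[OF Cons.prems] using supp_mono le_up[OF i reduced_Sym[OF r]] by blast
  moreover have "i \<in> supp n (wprod (i # ws))"
    using descent_supp[OF reduced_Sym[OF Cons.prems] i] l by (simp only: wprod.simps comp_sref_sref)
  ultimately show ?case using Cons.IH[OF r] supp_wprod[OF reduced_subset[OF Cons.prems]] unfolding list.set by blast
qed

lemma inv_wprod: "inv_into UNIV (wprod ws) = wprod (rev ws)"
proof (rule inv_unique_comp)
  show "wprod ws \<circ> wprod (rev ws) = id"
  proof (induction ws)
    case (Cons i ws)
    have "wprod (i # ws) \<circ> wprod (rev (i # ws)) = wprod ws \<circ> (sref i \<circ> sref i) \<circ> wprod (rev ws)"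
      by (simp only: rev.simps wprod_append wprod.simps comp_assoc id_comp)
    then show ?case using Cons by (simp only: sref_comp comp_id)
  qed (simp only: wprod.simps rev.simps comp_id)
  show "wprod (rev ws) \<circ> wprod ws = id"
  proof (induction ws rule: rev_induct)
    case (snoc i ws)
    have "wprod (rev (ws @ [i])) \<circ> wprod (ws @ [i])
        = wprod (rev ws) \<circ> (sref i \<circ> sref i) \<circ> wprod ws"
      by (simp only: rev_append rev.simps append.simps wprod_append wprod.simps comp_assoc id_comp)
    then show ?case using snoc by (simp only: sref_comp comp_id)
  qed (simp only: wprod.simps rev.simps comp_id)
qed

lemma parabolic_word: "w \<in> parabolic n J \<Longrightarrow> \<exists>ws. set ws \<subseteq> J \<and> wprod ws = w"
proof (induction rule: parabolic.induct)
  case par_id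
  show ?case by (intro exI[of _ "[]"]) (simp only: wprod.simps list.set empty_subsetI simp_thms)
next
  case (par_gen i)
  then show ?case
    by (intro exI[of _ "[i]"]) (simp only: wprod.simps list.set id_comp insert_subset empty_subsetI simp_thms)
next
  case (par_mult x y)
  then obtain xs ys where "set xs \<subseteq> J \<and> wprod xs = x" "set ys \<subseteq> J \<and> wprod ys = y" by blast
  then show ?case by (intro exI[of _ "ys @ xs"]) (auto simp: wprod_append)
next
  case (par_inv x)
  then obtain xs where "set xs \<subseteq> J \<and> wprod xs = x" by blast
  then show ?case by (intro exI[of _ "rev xs"]) (auto simp: inv_wprod)
qed

lemma wprod_parabolic: "set ws \<subseteq> J \<Longrightarrow> wprod ws \<in> parabolic n J"
proof (induction ws)
  case Nil
  show ?case unfolding wprod.simps by (rule par_id)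
next
  case (Cons i ws)
  then show ?case unfolding wprod.simps by (intro par_mult par_gen) auto
qed

lemma parabolic_iff:
  assumes J: "J \<subseteq> simple_idx n"
  shows "w \<in> parabolic n J \<longleftrightarrow> w \<in> Sym n \<and> supp n w \<subseteq> J"
proof
  assume "w \<in> parabolic n J"
  then obtain ws where "set ws \<subseteq> J" "wprod ws = w" using parabolic_word by blast
  then show "w \<in> Sym n \<and> supp n w \<subseteq> J" using J wprod_Sym supp_wprod by blast
next
  assume w: "w \<in> Sym n \<and> supp n w \<subseteq> J"
  obtain ws where "reduced n ws" "wprod ws = w" using reduced_word w by blast
  then show "w \<in> parabolic n J" using w reduced_supp wprod_parabolic by blast
qed

lemma supp_dem: "set ws \<subseteq> simple_idx n \<Longrightarrow> supp n (dem n ws I) \<subseteq> set ws"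
proof (induction ws arbitrary: I)
  case Nil
  show ?case by (simp only: dem.simps supp_id empty_subsetI)
next
  case (Cons i ws)
  then have "supp n (up n i (dem n ws (tl I))) \<subseteq> insert i (supp n (dem n ws (tl I)))"
    by (intro supp_up dem_Sym) auto
  moreover have "supp n (dem n ws (tl I)) \<subseteq> set ws" using Cons by simp
  ultimately have "supp n (up n i (dem n ws (tl I))) \<subseteq> insert i (set ws)"
    "supp n (dem n ws (tl I)) \<subseteq> insert i (set ws)" by blast+
  then show ?case by simp
qed

text \<open>The elements of \<open>W\<^sub>J\<close> below \<open>x\<close> have a maximum; all that matters here is that, unless
  trivial, they are stable under the Demazure action of some \<open>s \<in> J\<close>.\<close>

lemma parabolic_below_stable:
  assumes "x \<in> Sym n"
  shows "(\<forall>y. bruhat_le n y x \<longrightarrow> supp n y \<subseteq> J \<longrightarrow> y = id) \<or>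
    (\<exists>i\<in>J \<inter> simple_idx n. \<forall>y. bruhat_le n y x \<longrightarrow> supp n y \<subseteq> J \<longrightarrow> bruhat_le n (up n i y) x)"
  using assms
proof (induction "clen n x" arbitrary: x rule: less_induct)
  case less
  show ?case
  proof (cases "x = id")
    case True
    then show ?thesis using bruhat_le_clen by (metis clen_id not_less0)
  next
    case False
    then obtain t where t: "t \<in> simple_idx n" "clen n (x \<circ> sref t) < clen n x"
      using descent_exists less.prems by blast
    have ux: "up n t x = x" and dx: "dn n t x = x \<circ> sref t" using t by (auto simp: up_def dn_def)
    show ?thesis
    proof (cases "t \<in> J")
      case True
      have "\<forall>y. bruhat_le n y x \<longrightarrow> bruhat_le n (up n t y) x" using up_mono[OF t(1)] ux by metis
      then show ?thesis using True t(1) by blast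
    next
      case False
      \<comment> \<open>An element supported in J has no descent t outside J, so
        \<open>dn n t\<close> fixes it. Hence x and the shorter x t have the same elements of W_J
        below them.\<close>
      have le: "bruhat_le n y (x \<circ> sref t)" if "bruhat_le n y x" "supp n y \<subseteq> J" for y
      proof -
        have y: "y \<in> Sym n" using that bruhat_le_Sym by blast
        have "\<not> clen n (y \<circ> sref t) < clen n y" using descent_supp[OF y t(1)] that False by blast
        then show ?thesis using dn_mono[OF t(1) that(1)] dx by (simp add: dn_def)
      qed
      have x': "x \<circ> sref t \<in> Sym n" using less.prems t comp_sref_Sym by blast
      have ge: "bruhat_le n y x" if "bruhat_le n y (x \<circ> sref t)" for y
        using that dn_le[OF t(1) less.prems] dx bruhat_le_trans by metis
      show ?thesis using less.hyps[OF t(2) x'] le ge by meson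
    qed
  qed
qed

section \<open>The signed cube\<close>

definition cube :: "nat \<Rightarrow> bool list set" where
  "cube m = {I. length I = m}"

lemma cube_0: "cube 0 = {[]}"
  by (auto simp: cube_def)

lemma cube_Suc: "cube (Suc m) = Cons True ` cube m \<union> Cons False ` cube m"
  by (force simp: cube_def length_Suc_conv image_iff)

lemma finite_cube [simp]: "finite (cube m)"
  by (induction m) (auto simp: cube_0 cube_Suc)

lemma Cons_cube [simp]: "b # I \<in> cube (Suc m) \<longleftrightarrow> I \<in> cube m"
  by (simp add: cube_def)

lemma cube_SucE:
  assumes "I \<in> cube (Suc m)" obtains b J where "I = b # J" "J \<in> cube m"
  using assms by (auto simp: cube_Suc)

lemma sum_cube_Suc:
  "(\<Sum>I\<in>cube (Suc m). f I) = (\<Sum>I\<in>cube m. f (True # I)) + (\<Sum>I\<in>cube m. f (False # I))"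
  for f :: "bool list \<Rightarrow> 'b::comm_monoid_add"
  unfolding cube_Suc by (subst sum.union_disjoint) (auto simp: sum.reindex)

text \<open>The simplicial incidence number: nonzero iff K arises from I by selecting one more
  letter, with sign given by the parity of the selected letters in front of it. The recursion on the
  head displays the cube as a cone over a smaller cube.\<close>

fun cf :: "bool list \<Rightarrow> bool list \<Rightarrow> 'k::field" where
  "cf (b # K) (c # I) =
     (if b then (if c then - cf K I else (if K = I then 1 else 0)) else (if c then 0 else cf K I))"
| "cf _ _ = 0"

lemma cf_nonzero:
  "cf K I \<noteq> 0 \<Longrightarrow> length K = length I \<and> wt K = Suc (wt I)"
  by (induction K I rule: cf.induct) (auto split: if_splits)

text \<open>Selecting a further letter applies one more \<open>up\<close>, which is increasing, and
  the later letters act monotonically. For ordinary products this fails. It makes the differentials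
  of the resolution well defined and the subwords below x a simplicial complex.\<close>

lemma cf_dem:
  assumes "set ws \<subseteq> simple_idx n" "cf K I \<noteq> (0::'k::field)" "length I = length ws"
  shows "bruhat_le n (dem n ws I) (dem n ws K)"
  using assms
proof (induction ws arbitrary: K I)
  case (Cons i ws)
  obtain c I' where I: "I = c # I'" using Cons.prems(3) by (cases I) auto
  obtain b K' where K: "K = b # K'" using cf_nonzero[OF Cons.prems(2)] I by (cases K) auto
  have i: "i \<in> simple_idx n" "set ws \<subseteq> simple_idx n" using Cons.prems by auto
  show ?case
  proof (cases b)
    case True
    show ?thesis
    proof (cases c)
      case True
      then have "bruhat_le n (dem n ws I') (dem n ws K')"
        using Cons.IH[OF i(2)] Cons.prems(2,3) \<open>b\<close> by (auto simp: I K)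
      then show ?thesis using up_mono[OF i(1)] \<open>b\<close> \<open>c\<close> by (simp add: I K)
    next
      case False
      then have "K' = I'" using Cons.prems(2) \<open>b\<close> by (auto simp: I K split: if_splits)
      then show ?thesis using le_up[OF i(1) dem_Sym[OF i(2)]] \<open>b\<close> False by (simp add: I K)
    qed
  next
    case False
    then have "\<not> c" "cf K' I' \<noteq> (0::'k)" using Cons.prems(2) by (auto simp: I K split: if_splits)
    then show ?thesis using Cons.IH[OF i(2)] Cons.prems(3) False by (simp add: I K)
  qed
qed auto

text \<open>Both operators use the same signs. \<open>coboundary\<close> is the differential of the
  resolution at a vertex, acting on an up-set of the cube; \<open>boundary\<close> is its transpose,
  which arises on Hom into a module A e_x and acts on a down-set.\<close>

definition coboundary :: "nat \<Rightarrow> (bool list \<Rightarrow> 'k::field) \<Rightarrow> bool list \<Rightarrow> 'k" where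
  "coboundary m f K = (\<Sum>I\<in>cube m. cf K I * f I)"

definition boundary :: "nat \<Rightarrow> (bool list \<Rightarrow> 'k::field) \<Rightarrow> bool list \<Rightarrow> 'k" where
  "boundary m f I = (\<Sum>K\<in>cube m. cf K I * f K)"

lemma coboundary_Cons:
  assumes "K \<in> cube m"
  shows "coboundary (Suc m) f (False # K) = coboundary m (\<lambda>I. f (False # I)) K"
    "coboundary (Suc m) f (True # K) = f (False # K) - coboundary m (\<lambda>I. f (True # I)) K"
  using assms
  by (simp_all add: coboundary_def sum_cube_Suc sum_negf if_distrib[of "\<lambda>x. x * _"] sum.delta cong: if_cong)

lemma boundary_Cons:
  assumes "I \<in> cube m"
  shows "boundary (Suc m) f (False # I) = boundary m (\<lambda>I. f (False # I)) I + f (True # I)"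
    "boundary (Suc m) f (True # I) = - boundary m (\<lambda>I. f (True # I)) I"
  using assms
  by (simp_all add: boundary_def sum_cube_Suc sum_negf if_distrib[of "\<lambda>x. x * _"] sum.delta' cong: if_cong)

lemma cf_cf:
  "K \<in> cube m \<Longrightarrow> I \<in> cube m \<Longrightarrow> (\<Sum>J\<in>cube m. cf K J * cf J I) = (0::'k::field)"
proof (induction m arbitrary: K I)
  case 0
  then show ?case by (simp add: cube_0)
next
  case (Suc m)
  obtain b K' where K: "K = b # K'" "K' \<in> cube m" using Suc.prems(1) by (rule cube_SucE)
  obtain c I' where I: "I = c # I'" "I' \<in> cube m" using Suc.prems(2) by (rule cube_SucE)
  have 0: "(\<Sum>J\<in>cube m. cf K' J * cf J I') = (0::'k)" using Suc.IH K I by blast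
  show ?case using 0 K(2) I(2)
    by (cases b; cases c)
      (simp_all add: K(1) I(1) sum_cube_Suc sum_negf if_distrib[of "\<lambda>x. x * _"] if_distrib[of "\<lambda>x. _ * x"]
        sum.delta sum.delta' cong: if_cong)
qed

lemma coboundary_diff: "coboundary m (\<lambda>I. f I - g I) K = coboundary m f K - coboundary m g K"
  by (simp add: coboundary_def algebra_simps sum_subtractf)

lemma coboundary_minus: "coboundary m (\<lambda>I. - g I) K = - coboundary m g K"
  by (simp add: coboundary_def sum_negf)

lemma coboundary_0: "coboundary m (\<lambda>I. 0) K = 0"
  by (simp add: coboundary_def)

text \<open>The cube over the word \<open>v s\<close> is the cone of a map between the cubes over \<open>v\<close> that belong
  to the lower bounds \<open>p\<close> and \<open>dn p\<close>.\<close>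

lemma coboundary_exact:
  fixes f :: "bool list \<Rightarrow> 'k::field"
  assumes "reduced n ws" "p \<in> Sym n" "p \<noteq> wprod ws"
    and "\<And>K. K \<in> cube (length ws) \<Longrightarrow> f K \<noteq> 0 \<Longrightarrow> bruhat_le n p (dem n ws K)"
    and "\<And>K. K \<in> cube (length ws) \<Longrightarrow> coboundary (length ws) f K = 0"
  shows "\<exists>g. (\<forall>I\<in>cube (length ws). g I \<noteq> 0 \<longrightarrow> bruhat_le n p (dem n ws I)) \<and>
    (\<forall>K\<in>cube (length ws). coboundary (length ws) g K = f K)"
  using assms
proof (induction ws arbitrary: p f)
  case Nil
  have "p \<noteq> id" using Nil.prems(3) by (simp only: wprod.simps not_False_eq_True)
  then have "\<not> bruhat_le n p id" using bruhat_le_clen by (metis clen_id not_less0)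
  then have "f [] = 0" using Nil.prems(4)[of "[]"] by (auto simp: cube_0 simp del: id_apply)
  then show ?case by (intro exI[of _ "\<lambda>_. 0"]) (simp add: cube_0 coboundary_def)
next
  case (Cons i ws)
  define m where "m = length ws"
  have i: "i \<in> simple_idx n" and r: "reduced n ws"
    and l: "clen n (wprod ws) < clen n (wprod ws \<circ> sref i)" using Cons.prems by auto
  have ws: "set ws \<subseteq> simple_idx n" using reduced_subset[OF r] .
  define f0 where "f0 I = f (False # I)" for I
  define f1 where "f1 I = f (True # I)" for I
  have f01: "(\<lambda>I. f (False # I)) = f0" "(\<lambda>I. f (True # I)) = f1"
    by (simp_all add: f0_def f1_def fun_eq_iff)
  have p: "p \<in> Sym n" by fact
  have s0: "bruhat_le n p (dem n ws K)" if "K \<in> cube m" "f0 K \<noteq> 0" for K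
    using Cons.prems(4)[of "False # K"] that by (simp add: m_def f0_def)
  have s1: "bruhat_le n (dn n i p) (dem n ws K)" if "K \<in> cube m" "f1 K \<noteq> 0" for K
    using Cons.prems(4)[of "True # K"] that le_up_iff_dn_le[OF i p dem_Sym[OF ws]]
    by (simp add: m_def f1_def)
  have d0: "coboundary m f0 K = 0" if "K \<in> cube m" for K
    using Cons.prems(5)[of "False # K"] that coboundary_Cons(1)[of K m f] unfolding f01 by (simp add: m_def)
  have d1: "f0 K = coboundary m f1 K" if "K \<in> cube m" for K
    using Cons.prems(5)[of "True # K"] that coboundary_Cons(2)[of K m f] unfolding f01 f0_def[symmetric] by (simp add: m_def)
  have dn_le_p: "bruhat_le n (dn n i p) p" using dn_le[OF i p] .
  \<comment> \<open>Split by the first entry, the cocycle condition reads d f0 = 0 and f0 = d f1,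
    and a primitive is a pair with d g0 = f0 and g0 - d g1 = f1. By the adjunction the half with the
    letter selected has lower bound \<open>dn n i p\<close>. If i is no descent of p, the two bounds
    agree and (f1, 0) is a primitive.\<close>
  have "\<exists>g0 g1. (\<forall>K\<in>cube m. g0 K \<noteq> 0 \<longrightarrow> bruhat_le n p (dem n ws K)) \<and>
      (\<forall>K\<in>cube m. g1 K \<noteq> 0 \<longrightarrow> bruhat_le n (dn n i p) (dem n ws K)) \<and>
      (\<forall>K\<in>cube m. coboundary m g0 K = f0 K) \<and> (\<forall>K\<in>cube m. g0 K - coboundary m g1 K = f1 K)"
  proof (cases "clen n (p \<circ> sref i) < clen n p")
    case False
    then have "dn n i p = p" by (simp add: dn_def)
    then show ?thesis using s1 d1
      by (intro exI[of _ f1] exI[of _ "\<lambda>_. 0"]) (simp add: coboundary_0)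
  next
    case True
    \<comment> \<open>At a descent f1 need not respect the bound p, so the induction hypothesis is
      applied twice: at p to f0, and at p s to the cocycle f1 - g0. Neither vertex is the excluded
      one: i is an ascent of v, and p s = v would mean p = w.\<close>
    then have dp: "dn n i p = p \<circ> sref i" by (simp add: dn_def)
    have "p \<noteq> wprod ws" using True l by auto
    from Cons.IH[OF r p this, of f0] s0 d0 obtain g0 where
      g0: "\<And>K. K \<in> cube m \<Longrightarrow> g0 K \<noteq> 0 \<Longrightarrow> bruhat_le n p (dem n ws K)"
        "\<And>K. K \<in> cube m \<Longrightarrow> coboundary m g0 K = f0 K" unfolding m_def by blast
    have "p \<circ> sref i \<noteq> wprod ws"
    proof
      assume "p \<circ> sref i = wprod ws"
      then have "p = wprod ws \<circ> sref i" by (metis comp_sref_sref)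
      then show False using Cons.prems(3) by (simp only: wprod.simps)
    qed
    moreover have "p \<circ> sref i \<in> Sym n" using comp_sref_Sym[OF i p] .
    moreover have "bruhat_le n (p \<circ> sref i) (dem n ws K)" if "K \<in> cube m" "f1 K - g0 K \<noteq> 0" for K
      using that(2) s1[OF that(1)] bruhat_le_trans[OF dn_le_p g0(1)[OF that(1)]] unfolding dp by fastforce
    moreover have "coboundary m (\<lambda>I. f1 I - g0 I) K = 0" if "K \<in> cube m" for K
      using d1[OF that] g0(2)[OF that] by (simp add: coboundary_diff)
    ultimately obtain h where
      h: "\<And>K. K \<in> cube m \<Longrightarrow> h K \<noteq> 0 \<Longrightarrow> bruhat_le n (p \<circ> sref i) (dem n ws K)"
        "\<And>K. K \<in> cube m \<Longrightarrow> coboundary m h K = f1 K - g0 K"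
      using Cons.IH[OF r, of "p \<circ> sref i" "\<lambda>I. f1 I - g0 I"] unfolding m_def by blast
    show ?thesis using g0 h
      by (intro exI[of _ g0] exI[of _ "\<lambda>I. - h I"]) (simp add: dp coboundary_minus)
  qed
  then obtain g0 g1 where
    g: "\<And>K. K \<in> cube m \<Longrightarrow> g0 K \<noteq> 0 \<Longrightarrow> bruhat_le n p (dem n ws K)"
      "\<And>K. K \<in> cube m \<Longrightarrow> g1 K \<noteq> 0 \<Longrightarrow> bruhat_le n (dn n i p) (dem n ws K)"
      "\<And>K. K \<in> cube m \<Longrightarrow> coboundary m g0 K = f0 K"
      "\<And>K. K \<in> cube m \<Longrightarrow> g0 K - coboundary m g1 K = f1 K" by blast
  define g where "g I = (if hd I then g1 (tl I) else g0 (tl I))" for I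
  show ?case
  proof (intro exI[of _ g] conjI ballI impI)
    fix I assume I: "I \<in> cube (length (i # ws))" "g I \<noteq> 0"
    then obtain b J where J: "I = b # J" "J \<in> cube m" unfolding m_def by (auto elim: cube_SucE)
    show "bruhat_le n p (dem n (i # ws) I)"
      using I(2) g(1,2)[OF J(2)] le_up_iff_dn_le[OF i p dem_Sym[OF ws]] J(1)
      by (simp add: g_def split: if_splits)
  next
    fix K assume "K \<in> cube (length (i # ws))"
    then obtain b J where J: "K = b # J" "J \<in> cube m" unfolding m_def by (auto elim: cube_SucE)
    have [simp]: "(\<lambda>I. g (False # I)) = g0" "(\<lambda>I. g (True # I)) = g1" "g (False # J) = g0 J"
      by (auto simp: g_def)
    show "coboundary (length (i # ws)) g K = f K"
      using coboundary_Cons[OF J(2), of g] g(3,4)[OF J(2)]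
      by (cases b) (simp_all add: J(1) m_def[symmetric] f0_def f1_def)
  qed
qed

text \<open>\<open>cf\<close> raises the weight by exactly one, so cutting a primitive down to the
  weight below k leaves its coboundary in weight k unchanged.\<close>

lemma coboundary_exact_graded:
  fixes f :: "bool list \<Rightarrow> 'k::field"
  assumes "reduced n ws" "p \<in> Sym n" "p \<noteq> wprod ws"
    and "\<And>K. K \<in> cube (length ws) \<Longrightarrow> f K \<noteq> 0 \<Longrightarrow> bruhat_le n p (dem n ws K) \<and> wt K = k"
    and "\<And>K. K \<in> cube (length ws) \<Longrightarrow> coboundary (length ws) f K = 0"
  shows "\<exists>g. (\<forall>I. g I \<noteq> 0 \<longrightarrow> I \<in> cube (length ws) \<and> bruhat_le n p (dem n ws I) \<and> Suc (wt I) = k) \<and>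
    (\<forall>K\<in>cube (length ws). coboundary (length ws) g K = f K)"
proof -
  have "\<exists>g. (\<forall>I\<in>cube (length ws). g I \<noteq> 0 \<longrightarrow> bruhat_le n p (dem n ws I)) \<and>
    (\<forall>K\<in>cube (length ws). coboundary (length ws) g K = f K)"
    by (rule coboundary_exact[OF assms(1-3)]) (simp_all add: assms(4,5))
  then obtain g where g: "\<And>I. I \<in> cube (length ws) \<Longrightarrow> g I \<noteq> 0 \<Longrightarrow> bruhat_le n p (dem n ws I)"
    "\<And>K. K \<in> cube (length ws) \<Longrightarrow> coboundary (length ws) g K = f K" by auto
  define h where "h I = (if I \<in> cube (length ws) \<and> Suc (wt I) = k then g I else 0)" for I
  have "coboundary (length ws) h K = f K" if K: "K \<in> cube (length ws)" for K
  proof (cases "wt K = k")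
    case True
    have "coboundary (length ws) h K = coboundary (length ws) g K"
      unfolding coboundary_def
    proof (intro sum.cong refl)
      fix I assume I: "I \<in> cube (length ws)"
      show "cf K I * h I = cf K I * g I"
        using True I by (cases "cf K I = (0::'k)") (auto simp: h_def dest!: cf_nonzero)
    qed
    then show ?thesis using g(2)[OF K] by simp
  next
    case False
    have "coboundary (length ws) h K = 0"
      unfolding coboundary_def
    proof (intro sum.neutral ballI)
      fix I
      show "cf K I * h I = 0"
        using False by (cases "cf K I = (0::'k)") (auto simp: h_def dest!: cf_nonzero)
    qed
    then show ?thesis using assms(4)[OF K] False by auto
  qed
  then show ?thesis using g(1) by (intro exI[of _ h]) (auto simp: h_def split: if_splits)
qed

section \<open>Homology of down-sets of the cube\<close>

text \<open>A contracting homotopy \<open>h\<close> of an acyclic complex satisfies \<open>d h + h d = 1\<close>, and the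
  supertrace of the left-hand side vanishes.\<close>

lemma exact_imp_euler_zero:
  fixes S :: "bool list set"
  assumes S: "S \<subseteq> cube m" and closed: "\<And>K I. K \<in> S \<Longrightarrow> I \<in> cube m \<Longrightarrow> cf K I \<noteq> (0::'k::field) \<Longrightarrow> I \<in> S"
    and exact: "\<And>k (f::bool list \<Rightarrow> 'k). (\<forall>I. f I \<noteq> 0 \<longrightarrow> I \<in> S \<and> wt I = k) \<Longrightarrow>
      (\<forall>I\<in>cube m. boundary m f I = 0) \<Longrightarrow>
      \<exists>g. (\<forall>K. g K \<noteq> 0 \<longrightarrow> K \<in> S \<and> wt K = Suc k) \<and> (\<forall>I\<in>cube m. boundary m g I = f I)"
  shows "(\<Sum>I\<in>S. (- 1) ^ wt I) = (0::'k)"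
proof -
  have fS: "finite S" by (rule finite_subset[OF S finite_cube])
  have cc: "(\<Sum>J\<in>S. cf K J * cf J I) = (0::'k)" if "K \<in> S" "I \<in> cube m" for K I
  proof -
    have "(\<Sum>J\<in>S. cf K J * cf J I) = (\<Sum>J\<in>cube m. cf K J * cf J I :: 'k)"
      using S closed[OF that(1)] by (intro sum.mono_neutral_left) auto
    then show ?thesis using cf_cf that S by auto
  qed
  have bS: "boundary m f I = (\<Sum>K\<in>S. cf K I * f K)" if "\<And>K. f K \<noteq> 0 \<Longrightarrow> K \<in> S" for f :: "bool list \<Rightarrow> 'k" and I
    unfolding boundary_def using S that by (intro sum.mono_neutral_right) auto
  \<comment> \<open>\<open>h J K\<close> is the coefficient of J in h(K). The homotopy is built
    weight by weight; stage k establishes d h + h d = 1 on all K of weight below k.\<close>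
  have "\<exists>h :: bool list \<Rightarrow> bool list \<Rightarrow> 'k. (\<forall>J K. h J K \<noteq> 0 \<longrightarrow> J \<in> S \<and> wt J = Suc (wt K)) \<and>
      (\<forall>K\<in>S. wt K < k \<longrightarrow> (\<forall>I\<in>S. (\<Sum>J\<in>S. cf J I * h J K) + (\<Sum>J\<in>S. h I J * cf K J) = (if I = K then 1 else 0)))"
    for k
  proof (induction k)
    case 0
    show ?case by (intro exI[of _ "\<lambda>_ _. 0"]) auto
  next
    case (Suc k)
    then obtain h :: "bool list \<Rightarrow> bool list \<Rightarrow> 'k" where
      h1: "\<And>J K. h J K \<noteq> 0 \<Longrightarrow> J \<in> S \<and> wt J = Suc (wt K)" and
      h2: "\<And>K I. K \<in> S \<Longrightarrow> wt K < k \<Longrightarrow> I \<in> S \<Longrightarrow>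
        (\<Sum>J\<in>S. cf J I * h J K) + (\<Sum>J\<in>S. h I J * cf K J) = (if I = K then 1 else 0)" by blast
    \<comment> \<open>The chain K - h(dK) is a cycle, because d h = 1 - h d on the smaller weight of
      dK, and d d = 0. A chain bounded by it is a valid value of h at K.\<close>
    have "\<exists>g. (\<forall>J. g J \<noteq> 0 \<longrightarrow> J \<in> S \<and> wt J = Suc k) \<and>
        (\<forall>I\<in>cube m. boundary m g I = (if I = K then 1 else 0) - (\<Sum>J\<in>S. h I J * cf K J))"
      if K: "K \<in> S" "wt K = k" for K
    proof (rule exact)
      show "\<forall>I. (if I = K then 1 else 0) - (\<Sum>J\<in>S. h I J * cf K J) \<noteq> 0 \<longrightarrow> I \<in> S \<and> wt I = k"
      proof (intro allI impI)
        fix I assume nz: "(if I = K then 1 else 0) - (\<Sum>J\<in>S. h I J * cf K J) \<noteq> (0::'k)"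
        show "I \<in> S \<and> wt I = k"
        proof (cases "I = K")
          case False
          with nz have "(\<Sum>J\<in>S. h I J * cf K J) \<noteq> 0" by simp
          then obtain J where "h I J * cf K J \<noteq> 0" by (meson sum.neutral)
          then have "h I J \<noteq> 0" "cf K J \<noteq> (0::'k)" by auto
          then show ?thesis using h1[of I J] cf_nonzero[where ?'a = 'k, of K J] K by auto
        qed (use K in simp)
      qed
      show "\<forall>I\<in>cube m. boundary m (\<lambda>I. (if I = K then 1 else 0) - (\<Sum>J\<in>S. h I J * cf K J)) I = 0"
      proof
        fix I assume I: "I \<in> cube m"
        let ?z = "\<lambda>I. (if I = K then 1 else 0) - (\<Sum>J\<in>S. h I J * cf K J) :: 'k"
        have zS: "L \<in> S" if "?z L \<noteq> 0" for L
        proof (cases "L = K")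
          case False
          with that have "(\<Sum>J\<in>S. h L J * cf K J) \<noteq> 0" by simp
          then obtain J where "h L J * cf K J \<noteq> 0" by (meson sum.neutral)
          then show ?thesis using h1[of L J] by auto
        qed (use K in simp)
        have b: "boundary m ?z I = (\<Sum>L\<in>S. cf L I * ?z L)" by (rule bS) (rule zS)
        show "boundary m ?z I = 0"
        proof (cases "I \<in> S")
          case False
          then have "cf L I = (0::'k)" if "L \<in> S" for L using closed[OF that I] by blast
          then show ?thesis unfolding b by (intro sum.neutral) simp
        next
          case True
          have "(\<Sum>L\<in>S. cf L I * (\<Sum>J\<in>S. h L J * cf K J)) = (\<Sum>J\<in>S. (\<Sum>L\<in>S. cf L I * h L J) * cf K J)"
            unfolding sum_distrib_left sum_distrib_right by (subst sum.swap) (simp add: mult.assoc)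
          also have "\<dots> = (\<Sum>J\<in>S. ((if I = J then 1 else 0) - (\<Sum>L\<in>S. h I L * cf J L)) * cf K J)"
          proof (intro sum.cong refl)
            fix J assume J: "J \<in> S"
            show "(\<Sum>L\<in>S. cf L I * h L J) * cf K J =
                ((if I = J then 1 else 0) - (\<Sum>L\<in>S. h I L * cf J L)) * cf K J"
            proof (cases "cf K J = (0::'k)")
              case False
              then have "wt J < k" using cf_nonzero[where ?'a = 'k, of K J] K by auto
              from h2[OF J this True] have "(\<Sum>L\<in>S. cf L I * h L J) =
                  (if I = J then 1 else 0) - (\<Sum>L\<in>S. h I L * cf J L)" by (simp only: eq_diff_eq)
              then show ?thesis by (simp only:)
            qed simp
          qed
          also have "\<dots> = cf K I - (\<Sum>J\<in>S. (\<Sum>L\<in>S. h I L * cf J L) * cf K J)"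
            using True fS by (simp add: left_diff_distrib sum_subtractf if_distrib[of "\<lambda>x. x * _"] cong: if_cong)
          also have "(\<Sum>J\<in>S. (\<Sum>L\<in>S. h I L * cf J L) * cf K J) = (\<Sum>L\<in>S. h I L * (\<Sum>J\<in>S. cf K J * cf J L))"
            unfolding sum_distrib_left sum_distrib_right by (subst sum.swap) (simp add: mult_ac)
          also have "\<dots> = 0" using cc[OF K(1)] S by (intro sum.neutral) auto
          finally have "(\<Sum>L\<in>S. cf L I * (\<Sum>J\<in>S. h L J * cf K J)) = cf K I" by simp
          then show ?thesis unfolding b using K fS
            by (simp add: right_diff_distrib sum_subtractf if_distrib[of "\<lambda>x. _ * x"] cong: if_cong)
        qed
      qed
    qed
    then obtain g where g: "\<And>K J. K \<in> S \<Longrightarrow> wt K = k \<Longrightarrow> g K J \<noteq> 0 \<Longrightarrow> J \<in> S \<and> wt J = Suc k"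
      "\<And>K I. K \<in> S \<Longrightarrow> wt K = k \<Longrightarrow> I \<in> cube m \<Longrightarrow>
        boundary m (g K) I = (if I = K then 1 else 0) - (\<Sum>J\<in>S. h I J * cf K J)" by metis
    define h' where "h' J K = (if wt K = k \<and> K \<in> S then g K J else h J K)" for J K
    show ?case
    proof (intro exI[of _ h'] conjI allI impI ballI)
      fix J K assume "h' J K \<noteq> 0"
      then show "J \<in> S" "wt J = Suc (wt K)" using g(1)[of K J] h1[of J K]
        by (auto simp: h'_def split: if_splits)
    next
      fix K I assume K: "K \<in> S" "wt K < Suc k" and I: "I \<in> S"
      have 1: "(\<Sum>J\<in>S. h' I J * cf K J) = (\<Sum>J\<in>S. h I J * cf K J)"
      proof (intro sum.cong refl)
        fix J show "h' I J * cf K J = h I J * cf K J"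
          using K(2) by (cases "cf K J = (0::'k)") (auto simp: h'_def dest!: cf_nonzero)
      qed
      show "(\<Sum>J\<in>S. cf J I * h' J K) + (\<Sum>J\<in>S. h' I J * cf K J) = (if I = K then 1 else 0)"
      proof (cases "wt K = k")
        case True
        have "(\<Sum>J\<in>S. cf J I * h' J K) = boundary m (g K) I"
          using True K g(1)[OF K(1) True] by (simp add: bS h'_def)
        then show ?thesis using g(2)[OF K(1) True] I S 1 by auto
      next
        case False
        then have "(\<Sum>J\<in>S. cf J I * h' J K) = (\<Sum>J\<in>S. cf J I * h J K)" by (simp add: h'_def)
        then show ?thesis using h2[OF K(1) _ I] False K 1 by simp
      qed
    qed
  qed
  from this[of "Suc m"] obtain h :: "bool list \<Rightarrow> bool list \<Rightarrow> 'k" where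
    h: "\<And>K I. K \<in> S \<Longrightarrow> wt K < Suc m \<Longrightarrow> I \<in> S \<Longrightarrow>
        (\<Sum>J\<in>S. cf J I * h J K) + (\<Sum>J\<in>S. h I J * cf K J) = (if I = K then 1 else 0)" by blast
  have ct: "wt K < Suc m" if "K \<in> S" for K
    using that S wt_le[of K] by (auto simp: cube_def)
  have "(\<Sum>I\<in>S. (- 1) ^ wt I) =
      (\<Sum>I\<in>S. (- 1) ^ wt I * ((\<Sum>J\<in>S. cf J I * h J I) + (\<Sum>J\<in>S. h I J * cf I J)))"
    using h ct by (intro sum.cong refl) simp
  also have "\<dots> = (\<Sum>I\<in>S. \<Sum>J\<in>S. (- 1) ^ wt I * (cf J I * h J I)) + (\<Sum>I\<in>S. \<Sum>J\<in>S. (- 1) ^ wt I * (h I J * cf I J))"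
    by (simp add: distrib_left sum.distrib sum_distrib_left)
  also have "(\<Sum>I\<in>S. \<Sum>J\<in>S. (- 1) ^ wt I * (h I J * cf I J)) = (\<Sum>J\<in>S. \<Sum>I\<in>S. (- 1) ^ wt I * (h I J * cf I J))"
    by (rule sum.swap)
  \<comment> \<open>\<open>cf I J\<close> vanishes unless the two weights differ by one. So after
    exchanging I and J the second half of the supertrace is the negative of the first.\<close>
  also have "\<dots> = (\<Sum>J\<in>S. \<Sum>I\<in>S. - ((- 1) ^ wt J * (cf I J * h I J)))"
  proof (intro sum.cong refl)
    fix J I show "(- 1) ^ wt I * (h I J * cf I J) = - ((- 1) ^ wt J * (cf I J * h I J))"
      by (cases "cf I J = (0::'k)") (auto dest!: cf_nonzero)
  qed
  finally show ?thesis by (simp add: sum_negf)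
qed

text \<open>This is the identity \<open>(1 - T\<^sub>s\<^sub>1) \<cdots> (1 - T\<^sub>s\<^sub>m) = \<Sum>y\<le>w. (-1)\<^sup>l\<^sup>(\<^sup>y\<^sup>) T\<^sub>y\<close> in the
  0-Hecke algebra, for a reduced word of \<open>w\<close>.\<close>

lemma sum_dem:
  fixes \<phi> :: "perm \<Rightarrow> 'k::field"
  assumes "reduced n ws"
  shows "(\<Sum>I\<in>cube (length ws). (- 1) ^ wt I * \<phi> (dem n ws I)) =
    (\<Sum>y | bruhat_le n y (wprod ws). (- 1) ^ clen n y * \<phi> y)"
  using assms
proof (induction ws arbitrary: \<phi>)
  case Nil
  have "{y. bruhat_le n y id} = {id}"
    using bruhat_le_clen[of n _ id] bruhat_le_refl[OF id_Sym] by (auto simp only: clen_id not_less0)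
  then have "{y. bruhat_le n y (wprod [])} = {id}" by (simp only: wprod.simps)
  then show ?case by (simp only: dem.simps) (simp add: cube_0 del: id_apply)
next
  case (Cons i ws)
  have i: "i \<in> simple_idx n" and r: "reduced n ws" using Cons.prems by auto
  let ?v = "wprod ws" and ?D = "\<lambda>y. clen n (y \<circ> sref i) < clen n y"
  let ?B = "{y. bruhat_le n y (up n i ?v)}" and ?A = "{y. bruhat_le n y ?v}"
  let ?s = "\<lambda>y. (- 1) ^ clen n y :: 'k"
  have v: "?v \<in> Sym n" by (rule reduced_Sym[OF r])
  have fin: "finite {y. bruhat_le n y x}" for x
    by (rule finite_subset[OF _ finite_Sym[of n]]) (auto dest: bruhat_le_Sym)
  have B: "y \<in> ?B \<longleftrightarrow> dn n i y \<in> ?A" if "y \<in> Sym n" for y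
    using le_up_iff_dn_le[OF i that v] by simp
  have A: "?A \<subseteq> Sym n" "?B \<subseteq> Sym n" by (auto dest: bruhat_le_Sym)
  have "(\<Sum>I\<in>cube (length (i # ws)). (- 1) ^ wt I * \<phi> (dem n (i # ws) I)) =
      (\<Sum>I\<in>cube (length ws). (- 1) ^ wt I * (\<phi> (dem n ws I) - \<phi> (up n i (dem n ws I))))"
    by (simp add: sum_cube_Suc sum.distrib[symmetric] algebra_simps)
  also have "\<dots> = (\<Sum>y\<in>?A. ?s y * (\<phi> y - \<phi> (up n i y)))" by (rule Cons.IH[OF r])
  \<comment> \<open>An element with descent i is fixed by \<open>up n i\<close>, so its two terms
    cancel.\<close>
  also have "\<dots> = (\<Sum>y\<in>{y\<in>?A. \<not> ?D y}. ?s y * (\<phi> y - \<phi> (up n i y)))"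
  proof (rule sum.mono_neutral_right[OF fin])
    show "\<forall>y\<in>?A - {y \<in> ?A. \<not> ?D y}. ?s y * (\<phi> y - \<phi> (up n i y)) = 0"
      by (auto simp: up_def)
  qed auto
  also have "\<dots> = (\<Sum>y\<in>{y\<in>?A. \<not> ?D y}. ?s y * \<phi> y) + (\<Sum>y\<in>{y\<in>?A. \<not> ?D y}. - ?s y * \<phi> (up n i y))"
    by (simp add: algebra_simps sum_subtractf sum_negf)
  \<comment> \<open>An element without descent i is fixed by \<open>dn n i\<close>, hence lies below
    v iff it lies below \<open>up n i v\<close>. Right multiplication by s then pairs these elements
    with those below \<open>up n i v\<close> that have descent i, and reverses the sign.\<close>
  also have "{y\<in>?A. \<not> ?D y} = {y\<in>?B. \<not> ?D y}"
    using A B by (auto simp: dn_def)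
  also have "(\<Sum>y\<in>{y\<in>?B. \<not> ?D y}. - ?s y * \<phi> (up n i y)) = (\<Sum>y\<in>{y\<in>?B. ?D y}. ?s y * \<phi> y)"
  proof (rule sum.reindex_bij_witness[of _ "\<lambda>y. y \<circ> sref i" "\<lambda>y. y \<circ> sref i"])
    fix y assume y: "y \<in> {y\<in>?B. \<not> ?D y}"
    have yS: "y \<in> Sym n" using y A by blast
    have l: "clen n (y \<circ> sref i) = Suc (clen n y)" using clen_descent(3)[OF yS i] y by simp
    show "y \<circ> sref i \<circ> sref i = y" by simp
    have "dn n i (y \<circ> sref i) = dn n i y" using l by (simp add: dn_def)
    then show "y \<circ> sref i \<in> {y\<in>?B. ?D y}"
      using B[OF yS] B[OF comp_sref_Sym[OF i yS]] y l by auto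
    show "?s (y \<circ> sref i) * \<phi> (y \<circ> sref i) = - ?s y * \<phi> (up n i y)" using l by (simp add: up_def)
  next
    fix y assume y: "y \<in> {y\<in>?B. ?D y}"
    have yS: "y \<in> Sym n" using y A by blast
    show "y \<circ> sref i \<circ> sref i = y" by simp
    have "dn n i (y \<circ> sref i) = dn n i y" using y by (simp add: dn_def)
    then show "y \<circ> sref i \<in> {y\<in>?B. \<not> ?D y}"
      using B[OF yS] B[OF comp_sref_Sym[OF i yS]] y by auto
  qed
  also have "(\<Sum>y\<in>{y\<in>?B. \<not> ?D y}. ?s y * \<phi> y) + (\<Sum>y\<in>{y\<in>?B. ?D y}. ?s y * \<phi> y) = (\<Sum>y\<in>?B. ?s y * \<phi> y)"
    using sum.inter_filter[OF fin, of "\<lambda>y. ?s y * \<phi> y"]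
    by (subst sum.union_disjoint[symmetric]) (auto intro!: sum.cong simp: fin)
  finally show ?case unfolding wprod_Cons_up[OF Cons.prems] .
qed

text \<open>Apply \<open>sum_dem\<close> to the constant 1: the signed count of all subwords of a
  nonempty word is zero.\<close>

lemma sum_sign_bruhat_interval:
  assumes "z \<in> Sym n" "z \<noteq> id"
  shows "(\<Sum>y | bruhat_le n y z. (- 1) ^ clen n y) = (0::'k::field)"
proof -
  obtain ws where ws: "reduced n ws" "wprod ws = z" using reduced_word[OF assms(1)] .
  then obtain i vs where vs: "ws = i # vs" using assms(2)
    by (cases ws) (simp only: wprod.simps, blast)
  have "(\<Sum>y | bruhat_le n y z. (- 1) ^ clen n y) = (\<Sum>I\<in>cube (length ws). (- 1) ^ wt I :: 'k)"
    using sum_dem[OF ws(1), of "\<lambda>_. 1::'k"] unfolding ws(2) by simp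
  also have "\<dots> = 0" by (simp add: vs sum_cube_Suc sum_negf)
  finally show ?thesis .
qed

section \<open>Homology of the subwords with Demazure product below x\<close>

abbreviation chain :: "nat \<Rightarrow> nat list \<Rightarrow> perm \<Rightarrow> nat \<Rightarrow> (bool list \<Rightarrow> 'k::field) \<Rightarrow> bool" where
  "chain n ws x k a \<equiv>
     (\<forall>I. a I \<noteq> 0 \<longrightarrow> I \<in> cube (length ws) \<and> bruhat_le n (dem n ws I) x \<and> wt I = k)"

text \<open>The degree k counts selected letters, so the empty subword is the augmentation term, in
  degree 0. The \<open>itself\<close> argument records the coefficient field, which otherwise occurs
  only under the quantifiers.\<close>

definition homology_nonzero :: "'k::field itself \<Rightarrow> nat \<Rightarrow> nat list \<Rightarrow> perm \<Rightarrow> nat \<Rightarrow> bool" where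
  "homology_nonzero T n ws x k \<longleftrightarrow> (\<exists>a :: bool list \<Rightarrow> 'k.
     chain n ws x k a \<and>
     (\<forall>I\<in>cube (length ws). boundary (length ws) a I = 0) \<and>
     \<not> (\<exists>b. chain n ws x (Suc k) b \<and>
          (\<forall>I\<in>cube (length ws). boundary (length ws) b I = a I)))"

lemma homology_nonzeroI:
  fixes a :: "bool list \<Rightarrow> 'k::field"
  assumes "\<And>I. a I \<noteq> 0 \<Longrightarrow> I \<in> cube (length ws) \<and> bruhat_le n (dem n ws I) x \<and> wt I = k"
    and "\<And>I. I \<in> cube (length ws) \<Longrightarrow> boundary (length ws) a I = 0"
    and "\<And>b. (\<And>K. b K \<noteq> 0 \<Longrightarrow> K \<in> cube (length ws) \<and> bruhat_le n (dem n ws K) x \<and> wt K = Suc k) \<Longrightarrow>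
      (\<And>I. I \<in> cube (length ws) \<Longrightarrow> boundary (length ws) b I = a I) \<Longrightarrow> False"
  shows "homology_nonzero TYPE('k) n ws x k"
  unfolding homology_nonzero_def
proof (intro exI[of _ a] conjI notI allI impI ballI)
  assume "\<exists>b. chain n ws x (Suc k) b \<and>
    (\<forall>I\<in>cube (length ws). boundary (length ws) b I = a I)"
  then obtain b where "chain n ws x (Suc k) b"
    "\<forall>I\<in>cube (length ws). boundary (length ws) b I = a I" by (elim exE conjE)
  then show False by (intro assms(3)[of b]) simp_all
qed (simp_all add: assms(1,2))

lemma homology_nonzeroE:
  assumes "homology_nonzero TYPE('k::field) n ws x k"
  obtains a :: "bool list \<Rightarrow> 'k::field"
  where "chain n ws x k a"
    and "\<forall>I\<in>cube (length ws). boundary (length ws) a I = 0"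
    and "\<not> (\<exists>b. chain n ws x (Suc k) b \<and>
      (\<forall>I\<in>cube (length ws). boundary (length ws) b I = a I))"
proof -
  obtain a :: "bool list \<Rightarrow> 'k" where
    *: "chain n ws x k a \<and>
      (\<forall>I\<in>cube (length ws). boundary (length ws) a I = 0) \<and>
      \<not> (\<exists>b. chain n ws x (Suc k) b \<and>
      (\<forall>I\<in>cube (length ws). boundary (length ws) b I = a I))"
    using assms unfolding homology_nonzero_def by (rule exE)
  show ?thesis
    by (rule that[OF conjunct1[OF *] conjunct1[OF conjunct2[OF *]] conjunct2[OF conjunct2[OF *]]])
qed

text \<open>Letters never cancel in a Demazure product: once a letter i is selected, the product
  stays above \<open>sref i\<close>.\<close>

lemma dem_eq_id:
  assumes "set ws \<subseteq> simple_idx n" "length I = length ws" "dem n ws I = id"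
  shows "wt I = 0"
  using assms
proof (induction ws arbitrary: I)
  case (Cons i ws)
  obtain b J where I: "I = b # J" using Cons.prems(2) by (cases I) auto
  have i: "i \<in> simple_idx n" "dem n ws J \<in> Sym n" using Cons.prems(1) dem_Sym by auto
  show ?case
  proof (cases b)
    case True
    then have "up n i (dem n ws J) = id" using Cons.prems(3) by (simp only: I dem.simps list.sel if_True)
    then have "bruhat_le n (up n i id) id" using up_mono[OF i(1) id_bruhat_le[OF i(2)]] by simp
    moreover have "up n i id = sref i" using clen_sref[OF i(1)] by (simp add: up_def)
    ultimately have "i \<in> supp n id" using i by (simp only: supp_def mem_Collect_eq simp_thms)
    then show ?thesis unfolding supp_id by simp
  next
    case False
    then have "dem n ws J = id" using Cons.prems(3) by (simp only: I dem.simps list.sel if_False)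
    then show ?thesis using Cons.IH[of J] Cons.prems False by (simp add: I)
  qed
qed simp

lemma bruhat_le_id: "bruhat_le n y id \<longleftrightarrow> y = id"
  using bruhat_le_clen[of n y id] bruhat_le_refl[OF id_Sym] by (auto simp only: clen_id not_less0)

lemma wt_eq_0: "wt I = 0 \<longleftrightarrow> I = replicate (length I) False"
  by (induction I) auto

lemma dem_replicate_False: "dem n ws (replicate (length ws) False) = id"
  by (induction ws) (auto simp del: id_apply)

lemma wt_replicate_False: "wt (replicate m False) = 0"
  by (induction m) auto

lemma homology_nonzero_0:
  assumes "reduced n ws"
  shows "homology_nonzero TYPE('k::field) n ws id 0"
proof (rule homology_nonzeroI)
  let ?m = "length ws"
  let ?o = "replicate ?m False"
  let ?a = "\<lambda>I. if I = ?o then 1 else 0 :: 'k"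
  have o: "?o \<in> cube ?m" by (simp add: cube_def)
  show "I \<in> cube ?m \<and> bruhat_le n (dem n ws I) id \<and> wt I = 0" if "?a I \<noteq> 0" for I
  proof -
    have I: "I = ?o" using that by (auto split: if_splits)
    show ?thesis unfolding I dem_replicate_False using o bruhat_le_id wt_replicate_False by auto
  qed
  show "boundary ?m ?a I = 0" if "I \<in> cube ?m" for I
  proof -
    have "boundary ?m ?a I = cf ?o I" using o
      by (simp add: boundary_def if_distrib[of "\<lambda>x. _ * x"] cong: if_cong)
    also have "\<dots> = 0"
      using cf_nonzero[where ?'a = 'k, of ?o I] wt_replicate_False[of ?m] by (cases "cf ?o I = (0::'k)") auto
    finally show ?thesis .
  qed
  fix b :: "bool list \<Rightarrow> 'k"
  assume b: "\<And>K. b K \<noteq> 0 \<Longrightarrow> K \<in> cube ?m \<and> bruhat_le n (dem n ws K) id \<and> wt K = Suc 0"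
    and eq: "\<And>I. I \<in> cube ?m \<Longrightarrow> boundary ?m b I = ?a I"
  have "b K = 0" for K
  proof (rule ccontr)
    assume "b K \<noteq> 0"
    from b[OF this] have "length K = length ws" "dem n ws K = id" "wt K = Suc 0"
      by (simp_all only: bruhat_le_id cube_def mem_Collect_eq)
    then show False using dem_eq_id[OF reduced_subset[OF assms]] by simp
  qed
  then have "boundary ?m b ?o = 0" by (simp add: boundary_def)
  then show False using eq[OF o] by simp
qed

text \<open>The word is chosen after x. When some i in J stabilises the elements of W_J below x, the
  word has to end in i, which is possible because the longest element of W_J has every i in J as a
  descent. Selecting that letter never leaves the complex, so i is the apex of a cone. Otherwise
  only the empty subword lies below x, and positive degrees are empty.\<close>

lemma longest_of_parabolic_imp_exact:
  assumes w: "w \<in> Sym n" and long: "longest_of_parabolic n w" and x: "x \<in> Sym n"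
  shows "\<exists>ws. reduced n ws \<and> wprod ws = w \<and> (\<forall>k>0. \<not> homology_nonzero TYPE('k::field) n ws x k)"
proof -
  obtain J where J: "J \<subseteq> simple_idx n" "w \<in> parabolic n J" "\<And>v. v \<in> parabolic n J \<Longrightarrow> clen n v \<le> clen n w"
    using long by (auto simp: longest_of_parabolic_def)
  have sw: "supp n w \<subseteq> J" using J parabolic_iff by blast
  have supp: "supp n (dem n ws I) \<subseteq> J" if "reduced n ws" "wprod ws = w" for ws I
    using supp_dem[OF reduced_subset[OF that(1)]] reduced_supp[OF that(1)] that(2) sw by blast
  from parabolic_below_stable[OF x, of J] consider
      (trivial) "\<And>y. bruhat_le n y x \<Longrightarrow> supp n y \<subseteq> J \<Longrightarrow> y = id"
    | (stable) i where "i \<in> J" "i \<in> simple_idx n"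
        "\<And>y. bruhat_le n y x \<Longrightarrow> supp n y \<subseteq> J \<Longrightarrow> bruhat_le n (up n i y) x" by blast
  then show ?thesis
  proof cases
    case trivial
    obtain ws where ws: "reduced n ws" "wprod ws = w" using reduced_word[OF w] .
    have "\<not> homology_nonzero TYPE('k) n ws x k" if "k > 0" for k
    proof
      assume "homology_nonzero TYPE('k) n ws x k"
      then obtain a :: "bool list \<Rightarrow> 'k" where
        a: "chain n ws x k a"
        and cyc: "\<forall>I\<in>cube (length ws). boundary (length ws) a I = 0"
        and nb: "\<not> (\<exists>b. chain n ws x (Suc k) b \<and>
          (\<forall>I\<in>cube (length ws). boundary (length ws) b I = a I))"
        by (rule homology_nonzeroE)
      have "a I = 0" for I
      proof (rule ccontr)
        assume "a I \<noteq> 0"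
        then have I: "I \<in> cube (length ws)" "bruhat_le n (dem n ws I) x" "wt I = k"
          using a by auto
        have "dem n ws I = id" using trivial[OF I(2) supp[OF ws]] .
        then show False using dem_eq_id[OF reduced_subset[OF ws(1)], of I] I that by (simp add: cube_def)
      qed
      then show False using nb by (auto intro!: exI[of _ "\<lambda>_. 0"] simp: boundary_def)
    qed
    then show ?thesis using ws by blast
  next
    case stable
    have "w \<circ> sref i \<in> parabolic n J" using J(2) stable(1) by (intro par_mult par_gen)
    from J(3)[OF this] have "clen n (w \<circ> sref i) < clen n w"
      using clen_descent(3)[OF w stable(2)] by linarith
    then obtain vs where vs: "reduced n (i # vs)" "wprod (i # vs) = w"
      using reduced_word_ending[OF w stable(2)] by blast
    have "\<not> homology_nonzero TYPE('k) n (i # vs) x k" for k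
    proof
      let ?m = "length vs"
      assume "homology_nonzero TYPE('k) n (i # vs) x k"
      then obtain a :: "bool list \<Rightarrow> 'k" where
        a: "chain n (i # vs) x k a"
        and cyc: "\<forall>I\<in>cube (length (i # vs)). boundary (length (i # vs)) a I = 0"
        and nb: "\<not> (\<exists>b. chain n (i # vs) x (Suc k) b \<and>
          (\<forall>I\<in>cube (length (i # vs)). boundary (length (i # vs)) b I = a I))"
        by (rule homology_nonzeroE)
      have len: "length (i # vs) = Suc ?m" by simp
      note a = a[unfolded len, rule_format] and cyc = cyc[unfolded len, rule_format] and nb = nb[unfolded len]
      \<comment> \<open>The cone over the part of a without the apex. Its boundary is that part
        itself together with minus its boundary joined to the apex, and the cycle condition
        identifies the latter with the rest of a.\<close>
      define b where "b K = (if hd K \<and> K \<noteq> [] then a (False # tl K) else 0)" for K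
      have bF: "(\<lambda>I. b (False # I)) = (\<lambda>_. 0)" and bT: "(\<lambda>I. b (True # I)) = (\<lambda>I. a (False # I))"
        and bTF: "b (True # I) = a (False # I)" for I
        by (auto simp: b_def)
      show False
      proof (rule notE[OF nb], rule exI[of _ b], intro conjI allI impI ballI)
        fix K assume K: "b K \<noteq> 0"
        then obtain L where L: "K = True # L" "a (False # L) \<noteq> 0"
          by (cases K) (auto simp: b_def split: if_splits)
        have aL: "L \<in> cube ?m" "bruhat_le n (dem n vs L) x" "wt L = k"
          using a[OF L(2)] by auto
        have "supp n (dem n vs L) \<subseteq> J" using supp[OF vs, of "False # L"] by simp
        from stable(3)[OF aL(2) this] show "K \<in> cube (Suc ?m)" "bruhat_le n (dem n (i # vs) K) x"
          "wt K = Suc k"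
          using aL by (simp_all add: L)
      next
        fix I assume "I \<in> cube (Suc ?m)"
        then obtain c L where I: "I = c # L" "L \<in> cube ?m" by (rule cube_SucE)
        have "boundary (Suc ?m) a (False # L) = 0" using cyc I by simp
        then have "boundary ?m (\<lambda>I. a (False # I)) L + a (True # L) = 0"
          using boundary_Cons(1)[OF I(2)] by metis
        then have aT: "a (True # L) = - boundary ?m (\<lambda>I. a (False # I)) L" by (simp add: eq_neg_iff_add_eq_0 add.commute)
        show "boundary (Suc ?m) b I = a I"
        proof (cases c)
          case True
          then show ?thesis unfolding I using boundary_Cons(2)[OF I(2), of b] aT by (simp add: bT)
        next
          case False
          then show ?thesis unfolding I using boundary_Cons(1)[OF I(2), of b]
            by (simp add: bF bTF) (simp add: boundary_def)
        qed
      qed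
    qed
    then show ?thesis using vs by blast
  qed
qed

text \<open>Any one-letter subword in the complex bounds a nonzero multiple of the empty one, which
  removes the homology in degree 0.\<close>

lemma cf_singleton:
  "wt K = 1 \<Longrightarrow> cf K (replicate (length K) False) \<noteq> (0::'k::field)"
proof (induction K)
  case (Cons b K)
  show ?case
  proof (cases b)
    case True
    then have "K = replicate (length K) False" using Cons.prems wt_eq_0 by auto
    then show ?thesis using True by simp
  next
    case False
    then show ?thesis using Cons by simp
  qed
qed simp

lemma singleton_subword:
  "set ws \<subseteq> simple_idx n \<Longrightarrow> j \<in> set ws \<Longrightarrow>
    \<exists>K\<in>cube (length ws). wt K = 1 \<and> dem n ws K = sref j"
proof (induction ws)
  case (Cons i ws)
  show ?case
  proof (cases "j = i")
    case True
    have "up n i id = sref i" using clen_sref[of i n] Cons.prems by (simp add: up_def)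
    then have "dem n (i # ws) (True # replicate (length ws) False) = sref j"
      using True by (simp add: dem_replicate_False del: id_apply)
    moreover have "True # replicate (length ws) False \<in> cube (length (i # ws))" by (simp add: cube_def)
    ultimately show ?thesis
      by (intro bexI[of _ "True # replicate (length ws) False"]) (auto simp: wt_replicate_False)
  next
    case False
    then obtain K where "K \<in> cube (length ws)" "wt K = 1" "dem n ws K = sref j"
      using Cons by auto
    then show ?thesis by (intro bexI[of _ "False # K"]) auto
  qed
qed simp

text \<open>Choose \<open>z\<close> minimal among the elements whose support lies in that of \<open>w\<close> but which are
  not below \<open>w\<close>. All elements below \<open>z\<close> except \<open>z\<close> itself lie below \<open>w\<close>, so the Euler
  characteristic does not vanish; and the empty subword carries no homology, as \<open>z\<close> lies above
  a letter of the word.\<close>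

lemma not_longest_imp_homology:
  assumes ws: "reduced n ws" and long: "\<not> longest_of_parabolic n (wprod ws)"
  shows "\<exists>x\<in>Sym n. \<exists>k>0. homology_nonzero TYPE('k::field) n ws x k"
proof -
  let ?w = "wprod ws" and ?m = "length ws"
  let ?J = "supp n ?w"
  have w: "?w \<in> Sym n" by (rule reduced_Sym[OF ws])
  have J: "?J \<subseteq> simple_idx n" by (auto simp: supp_def)
  then have "?w \<in> parabolic n ?J" using parabolic_iff w by blast
  then obtain v where v: "v \<in> parabolic n ?J" "clen n ?w < clen n v"
    using long J unfolding longest_of_parabolic_def by (meson not_less)
  define P where "P z \<longleftrightarrow> z \<in> Sym n \<and> supp n z \<subseteq> ?J \<and> \<not> bruhat_le n z ?w" for z
  \<comment> \<open>An element longer than w cannot lie below w, so the set from which z is taken is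
    nonempty.\<close>
  have "P v" using v parabolic_iff[OF J] bruhat_le_clen[of n v ?w] unfolding P_def by force
  then obtain z where Pz: "P z" and zmin: "\<And>y. P y \<Longrightarrow> clen n z \<le> clen n y"
    using ex_has_least_nat[of P v "clen n"] by blast
  have z: "z \<in> Sym n" "supp n z \<subseteq> ?J" "\<not> bruhat_le n z ?w" using Pz by (auto simp: P_def)
  have below: "bruhat_le n y ?w" if "bruhat_le n y z" "y \<noteq> z" for y
  proof (rule ccontr)
    assume "\<not> bruhat_le n y ?w"
    then have "P y" using that supp_mono[OF that(1)] z bruhat_le_Sym unfolding P_def by blast
    then show False using zmin[of y] bruhat_le_clen[OF that(1)] that(2) by simp
  qed
  have zid: "z \<noteq> id" using z(3) id_bruhat_le[OF w] by blast
  obtain j where j: "j \<in> simple_idx n" "clen n (z \<circ> sref j) < clen n z" using descent_exists[OF z(1) zid] .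
  have jz: "j \<in> supp n z" by (rule descent_supp[OF z(1) j])
  then have "j \<in> set ws" using z(2) reduced_supp[OF ws] by blast
  then obtain K0 where K0: "K0 \<in> cube ?m" "wt K0 = 1" "dem n ws K0 = sref j"
    using singleton_subword[OF reduced_subset[OF ws]] by blast
  define S where "S = {I \<in> cube ?m. bruhat_le n (dem n ws I) z}"
  have K0S: "K0 \<in> S" using K0 jz by (simp add: S_def supp_def)
  have fin: "finite {y. bruhat_le n y x}" for x
    by (rule finite_subset[OF _ finite_Sym[of n]]) (auto dest: bruhat_le_Sym)
  have "(\<Sum>I\<in>S. (- 1) ^ wt I) =
      (\<Sum>I\<in>cube ?m. (- 1) ^ wt I * (if bruhat_le n (dem n ws I) z then 1 else 0) :: 'k)"
    unfolding S_def by (subst sum.inter_filter) (auto intro!: sum.cong)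
  also have "\<dots> = (\<Sum>y | bruhat_le n y ?w. (- 1) ^ clen n y * (if bruhat_le n y z then 1 else 0))"
    by (rule sum_dem[OF ws])
  also have "\<dots> = (\<Sum>y\<in>{y \<in> {y. bruhat_le n y ?w}. bruhat_le n y z}. (- 1) ^ clen n y)"
    by (subst sum.inter_filter[OF fin]) (auto intro!: sum.cong)
  also have "{y \<in> {y. bruhat_le n y ?w}. bruhat_le n y z} = {y. bruhat_le n y z} - {z}"
    using below z(3) by auto
  also have "(\<Sum>y\<in>{y. bruhat_le n y z} - {z}. (- 1) ^ clen n y) =
      (\<Sum>y | bruhat_le n y z. (- 1) ^ clen n y) - (- 1 :: 'k) ^ clen n z"
    using bruhat_le_refl[OF z(1)] sum.remove[OF fin, of z z "\<lambda>y. (- 1) ^ clen n y :: 'k"] by simp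
  also have "\<dots> \<noteq> (0::'k)" using sum_sign_bruhat_interval[OF z(1) zid, where ?'k = 'k] by simp
  finally have euler: "(\<Sum>I\<in>S. (- 1) ^ wt I) \<noteq> (0::'k)" .
  have "\<exists>k>0. homology_nonzero TYPE('k) n ws z k"
  proof (rule ccontr)
    assume none: "\<not> (\<exists>k>0. homology_nonzero TYPE('k) n ws z k)"
    have "(\<Sum>I\<in>S. (- 1) ^ wt I) = (0::'k)"
    proof (rule exact_imp_euler_zero[where m = ?m])
      show "S \<subseteq> cube ?m" by (auto simp: S_def)
      show "I \<in> S" if "K \<in> S" "I \<in> cube ?m" "cf K I \<noteq> (0::'k)" for K I
        using that cf_dem[OF reduced_subset[OF ws] that(3)] bruhat_le_trans by (auto simp: S_def cube_def)
      fix k and f :: "bool list \<Rightarrow> 'k"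
      assume f: "\<forall>I. f I \<noteq> 0 \<longrightarrow> I \<in> S \<and> wt I = k" and cyc: "\<forall>I\<in>cube ?m. boundary ?m f I = 0"
      show "\<exists>g. (\<forall>K. g K \<noteq> 0 \<longrightarrow> K \<in> S \<and> wt K = Suc k) \<and> (\<forall>I\<in>cube ?m. boundary ?m g I = f I)"
      proof (cases "k = 0")
        case False
        show ?thesis
        proof (rule ccontr)
          assume ng: "\<not> ?thesis"
          have "homology_nonzero TYPE('k) n ws z k"
          proof (rule homology_nonzeroI[of f])
            fix b :: "bool list \<Rightarrow> 'k"
            assume "\<And>K. b K \<noteq> 0 \<Longrightarrow> K \<in> cube ?m \<and> bruhat_le n (dem n ws K) z \<and> wt K = Suc k"
              "\<And>I. I \<in> cube ?m \<Longrightarrow> boundary ?m b I = f I"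
            then show False by (rule_tac ng[THEN notE], rule_tac exI[of _ b]) (simp add: S_def)
          qed (use f cyc in \<open>simp_all add: S_def\<close>)
          then show False using none False by blast
        qed
      next
        case True
        let ?o = "replicate ?m False"
        let ?c = "cf K0 ?o :: 'k"
        have lK: "length K0 = ?m" using K0 by (simp add: cube_def)
        have c: "?c \<noteq> 0" using cf_singleton[OF K0(2)] lK by simp
        define g where "g K = (if K = K0 then f ?o / ?c else 0)" for K
        have b: "boundary ?m g I = cf K0 I * (f ?o / ?c)" for I
          using K0(1) by (simp add: boundary_def g_def if_distrib[of "\<lambda>x. _ * x"] cong: if_cong)
        have "boundary ?m g I = f I" if I: "I \<in> cube ?m" for I
        proof (cases "I = ?o")
          case True
          then show ?thesis using c b by simp
        next
          case False
          then have nz: "wt I \<noteq> 0" using wt_eq_0[of I] I by (simp add: cube_def)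
          then have "f I = 0" using spec[OF f, of I] nz \<open>k = 0\<close> by auto
          moreover have "cf K0 I = (0::'k)"
            using cf_nonzero[where ?'a = 'k, of K0 I] K0(2) nz by auto
          ultimately show ?thesis using b by simp
        qed
        then show ?thesis using K0 K0S True by (intro exI[of _ g]) (auto simp: g_def split: if_splits)
      qed
    qed
    with euler show False by simp
  qed
  then show ?thesis using z(1) by blast
qed

section \<open>Matrices with labelled rows and columns\<close>

text \<open>Module maps are matrices with numeric indices, while the constructions are indexed by
  subwords and permutations. Reading entries through lists of labels turns matrix products into sums
  over sets of labels.\<close>

definition bmat :: "'a list \<Rightarrow> 'b list \<Rightarrow> ('a \<Rightarrow> 'b \<Rightarrow> 'k::field) \<Rightarrow> 'k mat" where
  "bmat A B c = mat (length A) (length B) (\<lambda>(i, j). c (A ! i) (B ! j))"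

abbreviation kron :: "'a \<Rightarrow> 'a \<Rightarrow> 'k::field" where "kron a b \<equiv> if a = b then 1 else 0"

definition bvec :: "'a list \<Rightarrow> ('a \<Rightarrow> 'k::field) \<Rightarrow> 'k vec" where
  "bvec A f = vec (length A) (\<lambda>i. f (A ! i))"

lemma bmat_carrier [simp]: "bmat A B c \<in> carrier_mat (length A) (length B)"
  by (simp add: bmat_def)

lemma bmat_dim [simp]: "dim_row (bmat A B c) = length A" "dim_col (bmat A B c) = length B"
  by (simp_all add: bmat_def)

lemma bvec_carrier [simp]: "bvec A f \<in> carrier_vec (length A)"
  by (simp add: bvec_def)

lemma sum_distinct_nth: "distinct B \<Longrightarrow> (\<Sum>i\<in>{0..<length B}. g (B ! i)) = (\<Sum>b\<in>set B. g b)"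
  by (rule sum.reindex_bij_betw) (simp add: bij_betw_nth atLeast0LessThan)

lemma bmat_mult:
  assumes "distinct B"
  shows "bmat A B c * bmat B C d = bmat A C (\<lambda>a e. \<Sum>b\<in>set B. c a b * d b e)"
proof (rule eq_matI)
  fix i j assume ij: "i < dim_row (bmat A C (\<lambda>a e. \<Sum>b\<in>set B. c a b * d b e))"
    "j < dim_col (bmat A C (\<lambda>a e. \<Sum>b\<in>set B. c a b * d b e))"
  then have "(bmat A B c * bmat B C d) $$ (i, j) = (\<Sum>k\<in>{0..<length B}. c (A ! i) (B ! k) * d (B ! k) (C ! j))"
    by (simp add: bmat_def scalar_prod_def)
  then show "(bmat A B c * bmat B C d) $$ (i, j) = bmat A C (\<lambda>a e. \<Sum>b\<in>set B. c a b * d b e) $$ (i, j)"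
    using ij sum_distinct_nth[OF assms, of "\<lambda>b. c (A ! i) b * d b (C ! j)"] by (simp add: bmat_def)
qed simp_all

lemma bmat_mult_vec:
  assumes "distinct B"
  shows "bmat A B c *\<^sub>v bvec B f = bvec A (\<lambda>a. \<Sum>b\<in>set B. c a b * f b)"
proof (rule eq_vecI)
  fix i assume i: "i < dim_vec (bvec A (\<lambda>a. \<Sum>b\<in>set B. c a b * f b))"
  then have "(bmat A B c *\<^sub>v bvec B f) $ i = (\<Sum>k\<in>{0..<length B}. c (A ! i) (B ! k) * f (B ! k))"
    by (simp add: bmat_def bvec_def scalar_prod_def)
  then show "(bmat A B c *\<^sub>v bvec B f) $ i = bvec A (\<lambda>a. \<Sum>b\<in>set B. c a b * f b) $ i"
    using i sum_distinct_nth[OF assms, of "\<lambda>b. c (A ! i) b * f b"] by (simp add: bvec_def)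
qed (simp add: bvec_def bmat_def)

lemma bmat_eq_iff: "bmat A B c = bmat A B d \<longleftrightarrow> (\<forall>a\<in>set A. \<forall>b\<in>set B. c a b = d a b)"
proof
  assume eq: "bmat A B c = bmat A B d"
  have "c (A ! i) (B ! j) = d (A ! i) (B ! j)" if "i < length A" "j < length B" for i j
    using arg_cong[OF eq, of "\<lambda>M. M $$ (i, j)"] that by (simp add: bmat_def)
  then show "\<forall>a\<in>set A. \<forall>b\<in>set B. c a b = d a b" by (metis in_set_conv_nth)
qed (auto simp: bmat_def intro!: eq_matI)

lemma bvec_eq_iff: "bvec A f = bvec A g \<longleftrightarrow> (\<forall>a\<in>set A. f a = g a)"
proof
  assume eq: "bvec A f = bvec A g"
  have "f (A ! i) = g (A ! i)" if "i < length A" for i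
    using arg_cong[OF eq, of "\<lambda>v. v $ i"] that by (simp add: bvec_def)
  then show "\<forall>a\<in>set A. f a = g a" by (metis in_set_conv_nth)
qed (auto simp: bvec_def intro!: eq_vecI)

lemma bvec_exhaust:
  assumes "distinct A" "v \<in> carrier_vec (length A)"
  obtains f where "v = bvec A f"
proof -
  have "v = bvec A (\<lambda>a. v $ (THE i. i < length A \<and> A ! i = a))"
  proof (rule eq_vecI)
    fix i assume "i < dim_vec (bvec A (\<lambda>a. v $ (THE i. i < length A \<and> A ! i = a)))"
    then have i: "i < length A" by (simp add: bvec_def)
    then have "(THE j. j < length A \<and> A ! j = A ! i) = i"
      using assms(1) by (intro the_equality) (auto simp: nth_eq_iff_index_eq)
    then show "v $ i = bvec A (\<lambda>a. v $ (THE i. i < length A \<and> A ! i = a)) $ i"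
      using i by (simp add: bvec_def)
  qed (use assms in \<open>simp add: bvec_def\<close>)
  then show ?thesis by (rule that)
qed

lemma bmat_zero: "0\<^sub>m (length A) (length B) = bmat A B (\<lambda>_ _. 0)"
  by (rule eq_matI) (auto simp: bmat_def)

lemma bvec_zero: "0\<^sub>v (length A) = bvec A (\<lambda>_. 0)"
  by (rule eq_vecI) (auto simp: bvec_def)

lemma bmat_one: "distinct A \<Longrightarrow> 1\<^sub>m (length A) = bmat A A kron"
  by (rule eq_matI) (auto simp: bmat_def nth_eq_iff_index_eq)

abbreviation sgl :: "'a list \<Rightarrow> 'a \<Rightarrow> 'k::field vec" where
  "sgl A a \<equiv> bvec A (\<lambda>b. if b = a then 1 else 0)"

lemma sgl_nth: "distinct A \<Longrightarrow> i < length A \<Longrightarrow> sgl A (A ! i) = unit_vec (length A) i"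
  by (rule eq_vecI) (auto simp: bvec_def nth_eq_iff_index_eq)

lemma mult_unit_vec:
  fixes M :: "'k::field mat"
  assumes "M \<in> carrier_mat r c" "j < c"
  shows "M *\<^sub>v unit_vec c j = col M j"
proof (rule eq_vecI)
  fix i assume "i < dim_vec (col M j)"
  then show "(M *\<^sub>v unit_vec c j) $ i = col M j $ i"
    using assms by (simp add: scalar_prod_def unit_vec_def if_distrib[of "\<lambda>x. _ * x"] cong: if_cong)
qed (use assms in auto)

lemma mat_eq_sglI:
  assumes M: "M \<in> carrier_mat r (length A)" and N: "N \<in> carrier_mat r (length A)" and d: "distinct A"
    and eq: "\<And>a. a \<in> set A \<Longrightarrow> M *\<^sub>v sgl A a = N *\<^sub>v sgl A a"
  shows "M = N"
proof (rule eq_matI)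
  fix i j assume ij: "i < dim_row N" "j < dim_col N"
  then have j: "j < length A" using N by simp
  have "col M j = col N j"
    using eq[of "A ! j"] j mult_unit_vec[OF M j] mult_unit_vec[OF N j] by (simp add: sgl_nth[OF d j])
  then have "col M j $ i = col N j $ i" by simp
  then show "M $$ (i, j) = N $$ (i, j)" using ij j M N by simp
qed (use M N in auto)

lemma mat_eq_vecI:
  fixes M N :: "'k::field mat"
  assumes M: "M \<in> carrier_mat r c" and N: "N \<in> carrier_mat r c"
    and eq: "\<And>v. v \<in> carrier_vec c \<Longrightarrow> M *\<^sub>v v = N *\<^sub>v v"
  shows "M = N"
  using mat_eq_sglI[of M r "[0..<c]" N] assms by (simp add: bvec_def)

lemma mat_of_sgl:
  fixes u :: "'a \<Rightarrow> 'k::field vec"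
  assumes d: "distinct A" and u: "\<And>a. a \<in> set A \<Longrightarrow> u a \<in> carrier_vec r"
  obtains M where "M \<in> carrier_mat r (length A)" "\<And>a. a \<in> set A \<Longrightarrow> M *\<^sub>v sgl A a = u a"
proof
  let ?M = "mat r (length A) (\<lambda>(i, j). u (A ! j) $ i)"
  show M: "?M \<in> carrier_mat r (length A)" by simp
  fix a assume "a \<in> set A"
  then obtain j where j: "j < length A" "a = A ! j" by (metis in_set_conv_nth)
  have "?M *\<^sub>v sgl A a = col ?M j" using mult_unit_vec[OF M j(1)] j(2) by (simp add: sgl_nth[OF d j(1)])
  also have "\<dots> = u a" using u[of a] j by (intro eq_vecI) auto
  finally show "?M *\<^sub>v sgl A a = u a" .
qed

section \<open>Paths\<close>

lemma covers_Sym: "covers n p q \<Longrightarrow> p \<in> Sym n \<and> q \<in> Sym n"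
  by (auto simp: covers_def bruhat_less_def bruhat_le_def)

lemma covers_le: "covers n p q \<Longrightarrow> bruhat_le n q p"
  by (auto simp: covers_def bruhat_less_def)

lemma covers_clen: "covers n p q \<Longrightarrow> clen n q < clen n p"
  using bruhat_le_clen by (auto simp: covers_def bruhat_less_def)

text \<open>Take q of maximal length among the elements above y and strictly below p.\<close>

lemma cover_exists:
  assumes "bruhat_le n y p" "y \<noteq> p"
  obtains q where "covers n p q" "bruhat_le n y q"
proof -
  let ?P = "\<lambda>q. bruhat_le n y q \<and> bruhat_less n q p"
  have "?P y" using assms bruhat_le_refl bruhat_le_Sym by (auto simp: bruhat_less_def)
  moreover have "\<forall>q. ?P q \<longrightarrow> clen n q < clen n p" using bruhat_le_clen by (auto simp: bruhat_less_def)
  ultimately obtain q where q: "?P q" "\<And>r. ?P r \<Longrightarrow> clen n r \<le> clen n q"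
    using ex_has_greatest_nat[of ?P y "clen n" "clen n p"] by auto
  have "\<not> (bruhat_less n q z \<and> bruhat_less n z p)" for z
  proof
    assume z: "bruhat_less n q z \<and> bruhat_less n z p"
    then have "?P z" using q(1) bruhat_le_trans by (auto simp: bruhat_less_def)
    then show False using q(2)[of z] z bruhat_le_clen by (force simp: bruhat_less_def)
  qed
  then show ?thesis using that q(1) by (auto simp: covers_def)
qed

lemma is_path_single [simp]: "is_path n [p] \<longleftrightarrow> p \<in> Sym n"
  by (simp add: is_path_def)

lemma is_path_Cons_Cons [simp]: "is_path n (p # q # r) \<longleftrightarrow> covers n p q \<and> is_path n (q # r)"
proof
  assume p: "is_path n (p # q # r)"
  then have "covers n ((p # q # r) ! i) ((p # q # r) ! Suc i)" if "Suc i < length (p # q # r)" for i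
    using that by (auto simp: is_path_def)
  from this[of 0] this[of "Suc _"] p show "covers n p q \<and> is_path n (q # r)"
    by (auto simp: is_path_def)
next
  assume "covers n p q \<and> is_path n (q # r)"
  then show "is_path n (p # q # r)"
    using covers_Sym by (auto simp: is_path_def nth_Cons split: nat.splits)
qed

lemma is_path_Nil [simp]: "\<not> is_path n []"
  by (simp add: is_path_def)

lemma path_exists:
  "bruhat_le n y p \<Longrightarrow> \<exists>ps. is_path n ps \<and> hd ps = p \<and> last ps = y"
proof (induction "clen n p" arbitrary: p rule: less_induct)
  case less
  show ?case
  proof (cases "y = p")
    case True
    then show ?thesis using bruhat_le_Sym[OF less.prems] by (intro exI[of _ "[p]"]) simp
  next
    case False
    obtain q where q: "covers n p q" "bruhat_le n y q" using cover_exists[OF less.prems False] .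
    then obtain ps where ps: "is_path n ps" "hd ps = q" "last ps = y" using less.hyps covers_clen by blast
    then obtain r where "ps = q # r" by (cases ps) auto
    then show ?thesis using ps q by (intro exI[of _ "p # ps"]) auto
  qed
qed

lemma path_le: "is_path n ps \<Longrightarrow> bruhat_le n (last ps) (hd ps)"
proof (induction ps rule: induct_list012)
  case (3 p q r)
  then show ?case using covers_le bruhat_le_trans by (auto split: if_splits)
qed (auto simp: bruhat_le_refl)

lemma covers_rtranclp: "x \<in> Sym n \<Longrightarrow> (covers n)\<^sup>*\<^sup>* x y \<longleftrightarrow> bruhat_le n y x"
proof
  show "(covers n)\<^sup>*\<^sup>* x y \<Longrightarrow> x \<in> Sym n \<Longrightarrow> bruhat_le n y x"
    by (induction rule: rtranclp_induct) (auto intro: bruhat_le_refl bruhat_le_trans covers_le)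
  assume "bruhat_le n y x"
  then obtain ps where "is_path n ps" "hd ps = x" "last ps = y" using path_exists by blast
  then show "(covers n)\<^sup>*\<^sup>* x y"
  proof (induction ps arbitrary: x rule: induct_list012)
    case (3 p q r)
    then show ?case using converse_rtranclp_into_rtranclp[of "covers n" p q y] by auto
  qed auto
qed

section \<open>Action of paths on a module\<close>

lemma rmap_carrier: "is_module n M \<Longrightarrow> covers n p q \<Longrightarrow> rmap M p q \<in> carrier_mat (rdim M q) (rdim M p)"
  by (simp add: is_module_def)

lemma path_map_carrier:
  "is_module n M \<Longrightarrow> is_path n ps \<Longrightarrow> path_map M ps \<in> carrier_mat (rdim M (last ps)) (rdim M (hd ps))"
proof (induction ps rule: induct_list012)
  case (3 p q r)
  then have "path_map M (q # r) \<in> carrier_mat (rdim M (last (q # r))) (rdim M q)"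
    "rmap M p q \<in> carrier_mat (rdim M q) (rdim M p)" using rmap_carrier by auto
  then show ?case by simp
qed auto

lemma path_map_snoc:
  "is_module n M \<Longrightarrow> is_path n ps \<Longrightarrow> covers n (last ps) y \<Longrightarrow>
    is_path n (ps @ [y]) \<and> path_map M (ps @ [y]) = rmap M (last ps) y * path_map M ps"
proof (induction ps rule: induct_list012)
  case (2 p)
  then have "rmap M p y \<in> carrier_mat (rdim M y) (rdim M p)" using rmap_carrier by auto
  then show ?case using 2 covers_Sym by auto
next
  case (3 p q r)
  then have IH: "is_path n (q # r)" "is_path n ((q # r) @ [y])"
    "path_map M ((q # r) @ [y]) = rmap M (last (q # r)) y * path_map M (q # r)" by auto
  have c: "rmap M (last (q # r)) y \<in> carrier_mat (rdim M y) (rdim M (last (q # r)))"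
    "path_map M (q # r) \<in> carrier_mat (rdim M (last (q # r))) (rdim M q)"
    "rmap M p q \<in> carrier_mat (rdim M q) (rdim M p)"
    using 3 rmap_carrier path_map_carrier[OF _ IH(1)] by auto
  have "path_map M ((p # q # r) @ [y]) = path_map M ((q # r) @ [y]) * rmap M p q" by simp
  also have "\<dots> = rmap M (last (q # r)) y * (path_map M (q # r) * rmap M p q)"
    unfolding IH(3) by (rule assoc_mult_mat[OF c])
  finally show ?case using 3 IH by simp
qed auto

text \<open>All paths from p to y act equally on a module, so any of them describes the action of
  the basis element of A from p to y. The choice is meaningful for y below p.\<close>

definition tr :: "nat \<Rightarrow> 'k::field rep \<Rightarrow> perm \<Rightarrow> perm \<Rightarrow> 'k mat" where
  "tr n M p y = path_map M (SOME ps. is_path n ps \<and> hd ps = p \<and> last ps = y)"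

lemma tr_eq: "is_module n M \<Longrightarrow> is_path n ps \<Longrightarrow> tr n M (hd ps) (last ps) = path_map M ps"
proof -
  assume M: "is_module n M" and ps: "is_path n ps"
  let ?qs = "SOME qs. is_path n qs \<and> hd qs = hd ps \<and> last qs = last ps"
  have "is_path n ?qs \<and> hd ?qs = hd ps \<and> last ?qs = last ps"
    by (rule someI[of _ ps]) (simp add: ps)
  then show ?thesis using M ps unfolding is_module_def tr_def by blast
qed

lemma tr_carrier: "is_module n M \<Longrightarrow> bruhat_le n y p \<Longrightarrow> tr n M p y \<in> carrier_mat (rdim M y) (rdim M p)"
  using path_exists[of n y p] tr_eq path_map_carrier by metis

lemma tr_refl: "is_module n M \<Longrightarrow> p \<in> Sym n \<Longrightarrow> tr n M p p = 1\<^sub>m (rdim M p)"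
  using tr_eq[of n M "[p]"] by simp

lemma tr_step:
  assumes M: "is_module n M" and "bruhat_le n y p" "covers n y z"
  shows "tr n M p z = rmap M y z * tr n M p y"
proof -
  obtain ps where ps: "is_path n ps" "hd ps = p" "last ps = y" using path_exists assms(2) by blast
  have "covers n (last ps) z" using ps assms(3) by simp
  from path_map_snoc[OF M ps(1) this] have "is_path n (ps @ [z])"
    "path_map M (ps @ [z]) = rmap M y z * path_map M ps" using ps by auto
  moreover have "hd (ps @ [z]) = p" using ps by (cases ps) auto
  ultimately show ?thesis using tr_eq[OF M, of "ps @ [z]"] tr_eq[OF M ps(1)] ps by simp
qed

lemma hom_carrier: "is_hom n M N f \<Longrightarrow> p \<in> Sym n \<Longrightarrow> f p \<in> carrier_mat (rdim N p) (rdim M p)"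
  by (simp add: is_hom_def)

lemma hom_comm: "is_hom n M N f \<Longrightarrow> covers n p q \<Longrightarrow> f q * rmap M p q = rmap N p q * f p"
  by (simp add: is_hom_def)

lemma tr_hom:
  assumes M: "is_module n M" and N: "is_module n N" and f: "is_hom n M N f"
  shows "bruhat_le n y p \<Longrightarrow> f y * tr n M p y = tr n N p y * f p"
proof (induction "clen n p - clen n y" arbitrary: y rule: less_induct)
  case less
  show ?case
  proof (cases "y = p")
    case True
    have "p \<in> Sym n" using less.prems bruhat_le_Sym by blast
    then show ?thesis using tr_refl[OF M, of p] tr_refl[OF N, of p] hom_carrier[OF f, of p] True by simp
  next
    case False
    obtain ps where ps: "is_path n ps" "hd ps = p" "last ps = y" using path_exists less.prems by blast
    obtain qs where qs: "ps = qs @ [y]" using ps by (metis append_butlast_last_id is_path_Nil)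
    have "qs \<noteq> []" using qs ps(2) False by auto
    then obtain rs z where rs: "qs = rs @ [z]" by (meson rev_exhaust)
    have p: "is_path n (rs @ [z])" "covers n z y"
    proof -
      have "is_path n (rs @ [z, y])" using ps(1) qs rs by simp
      then have "is_path n (rs @ [z]) \<and> covers n z y"
        by (induction rs rule: induct_list012) (auto dest: covers_Sym)
      then show "is_path n (rs @ [z])" "covers n z y" by auto
    qed
    have zp: "bruhat_le n z p" using path_le[OF p(1)] ps(2) qs rs by (cases rs) auto
    have lt: "clen n p - clen n z < clen n p - clen n y"
      using covers_clen[OF p(2)] bruhat_le_clen[OF zp] by auto
    have S: "y \<in> Sym n" "z \<in> Sym n" "p \<in> Sym n" using covers_Sym p(2) zp bruhat_le_Sym by auto
    note c = hom_carrier[OF f S(1)] hom_carrier[OF f S(2)] hom_carrier[OF f S(3)]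
      rmap_carrier[OF M p(2)] rmap_carrier[OF N p(2)] tr_carrier[OF M zp] tr_carrier[OF N zp]
    have "f y * tr n M p y = (f y * rmap M z y) * tr n M p z"
      unfolding tr_step[OF M zp p(2)] by (rule assoc_mult_mat[symmetric, OF c(1,4,6)])
    also have "\<dots> = rmap N z y * (f z * tr n M p z)"
      unfolding hom_comm[OF f p(2)] by (rule assoc_mult_mat[OF c(5,2,6)])
    also have "\<dots> = rmap N z y * (tr n N p z * f p)" using less.hyps[OF lt zp] by simp
    also have "\<dots> = tr n N p y * f p"
      unfolding tr_step[OF N zp p(2)] by (rule assoc_mult_mat[symmetric, OF c(5,7,3)])
    finally show ?thesis .
  qed
qed

section \<open>Free modules\<close>

text \<open>A e_x is one-dimensional at every vertex y with \<open>y \<le> x\<close> and zero at the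
  others, so the labels above y form a basis of the direct sum at y.\<close>

definition fb :: "nat \<Rightarrow> 'i list \<Rightarrow> ('i \<Rightarrow> perm) \<Rightarrow> perm \<Rightarrow> 'i list" where
  "fb n L \<pi> y = filter (\<lambda>I. bruhat_le n y (\<pi> I)) L"

text \<open>The direct sum of the modules \<open>A e\<^bsub>\<pi> I\<^esub>\<close> over the labels \<open>I\<close> in \<open>L\<close>.\<close>

definition free_rep :: "nat \<Rightarrow> 'i list \<Rightarrow> ('i \<Rightarrow> perm) \<Rightarrow> 'k::field rep" where
  "free_rep n L \<pi> = \<lparr> rdim = (\<lambda>y. length (fb n L \<pi> y)),
     rmap = (\<lambda>p q. bmat (fb n L \<pi> q) (fb n L \<pi> p) kron) \<rparr>"

lemma free_rep_simps [simp]: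
  "rdim (free_rep n L \<pi>) y = length (fb n L \<pi> y)"
  "rmap (free_rep n L \<pi>) p q = bmat (fb n L \<pi> q) (fb n L \<pi> p) kron"
  by (simp_all add: free_rep_def)

lemma set_fb [simp]: "I \<in> set (fb n L \<pi> y) \<longleftrightarrow> I \<in> set L \<and> bruhat_le n y (\<pi> I)"
  by (auto simp: fb_def)

lemma distinct_fb: "distinct L \<Longrightarrow> distinct (fb n L \<pi> y)"
  by (simp add: fb_def)

lemma path_map_free:
  assumes d: "distinct L"
  shows "is_path n ps \<Longrightarrow> path_map (free_rep n L \<pi> :: 'k::field rep) ps =
    bmat (fb n L \<pi> (last ps)) (fb n L \<pi> (hd ps)) kron"
proof (induction ps rule: induct_list012)
  case (2 p)
  then show ?case using bmat_one[OF distinct_fb[OF d]] by simp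
next
  case (3 p q r)
  then have "path_map (free_rep n L \<pi> :: 'k rep) (p # q # r) =
      bmat (fb n L \<pi> (last (q # r))) (fb n L \<pi> q) kron *
      bmat (fb n L \<pi> q) (fb n L \<pi> p) kron" by simp
  also have "\<dots> = bmat (fb n L \<pi> (last (q # r))) (fb n L \<pi> p) kron"
    unfolding bmat_mult[OF distinct_fb[OF d]] bmat_eq_iff
  proof (intro ballI)
    fix a b assume "a \<in> set (fb n L \<pi> (last (q # r)))" and b: "b \<in> set (fb n L \<pi> p)"
    have "bruhat_le n q p" using 3(3) covers_le by simp
    then have "b \<in> set (fb n L \<pi> q)" using b bruhat_le_trans[of n q p "\<pi> b"] by simp
    then show "(\<Sum>c\<in>set (fb n L \<pi> q). (if a = c then 1 else 0) * (if c = b then 1 else 0)) = (if a = b then 1 else (0::'k))"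
      by (simp add: if_distrib[of "\<lambda>x. _ * x"] cong: if_cong)
  qed
  finally show ?case by simp
qed simp

lemma free_module: "distinct L \<Longrightarrow> is_module n (free_rep n L \<pi> :: 'k::field rep)"
  unfolding is_module_def by (auto simp: path_map_free)

lemma tr_free:
  assumes "distinct L" "bruhat_le n y p"
  shows "tr n (free_rep n L \<pi> :: 'k::field rep) p y =
    bmat (fb n L \<pi> y) (fb n L \<pi> p) kron"
proof -
  obtain ps where ps: "is_path n ps" "hd ps = p" "last ps = y" using path_exists assms(2) by blast
  have "tr n (free_rep n L \<pi> :: 'k rep) (hd ps) (last ps) = path_map (free_rep n L \<pi>) ps"
    by (rule tr_eq[OF free_module[OF assms(1)] ps(1)])
  then show ?thesis unfolding path_map_free[OF assms(1) ps(1)] ps .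
qed

lemma tr_free_sgl:
  assumes d: "distinct L" and le: "bruhat_le n y p" and I: "I \<in> set L" "bruhat_le n p (\<pi> I)"
  shows "tr n (free_rep n L \<pi> :: 'k::field rep) p y *\<^sub>v sgl (fb n L \<pi> p) I = sgl (fb n L \<pi> y) I"
  unfolding tr_free[OF d le] bmat_mult_vec[OF distinct_fb[OF d]] bvec_eq_iff
  using I by (auto simp: if_distrib[of "\<lambda>x. _ * x"] cong: if_cong)

locale labels =
  fixes n :: nat and L :: "'i list" and \<pi> :: "'i \<Rightarrow> perm"
  assumes distinct_labels: "distinct L" and labels_Sym: "\<And>I. I \<in> set L \<Longrightarrow> \<pi> I \<in> Sym n"
begin

abbreviation F :: "'k::field rep" where "F \<equiv> free_rep n L \<pi>"
abbreviation gen :: "'i \<Rightarrow> 'k::field vec" where "gen I \<equiv> sgl (fb n L \<pi> (\<pi> I)) I"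

lemma F_module: "is_module n F"
  by (rule free_module[OF distinct_labels])

text \<open>One half of Yoneda: each basis vector is transported from the generator of its label, so
  a homomorphism is determined by its values on generators.\<close>

lemma F_hom_sgl:
  fixes f :: "perm \<Rightarrow> 'k::field mat"
  assumes N: "is_module n N" and f: "is_hom n F N f" and I: "I \<in> set L" "bruhat_le n y (\<pi> I)"
  shows "f y *\<^sub>v sgl (fb n L \<pi> y) I = tr n N (\<pi> I) y *\<^sub>v (f (\<pi> I) *\<^sub>v gen I)"
proof -
  have S: "\<pi> I \<in> Sym n" "y \<in> Sym n" using I bruhat_le_Sym by blast+
  have c: "gen I \<in> carrier_vec (rdim (F :: 'k rep) (\<pi> I))" by simp
  have "f y *\<^sub>v sgl (fb n L \<pi> y) I = f y *\<^sub>v (tr n F (\<pi> I) y *\<^sub>v gen I)"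
    by (simp only: tr_free_sgl[where p = "\<pi> I" and \<pi> = \<pi>, OF distinct_labels I(2,1) bruhat_le_refl[OF S(1)]])
  also have "\<dots> = (f y * tr n F (\<pi> I) y) *\<^sub>v gen I"
    by (rule assoc_mult_mat_vec[symmetric, OF hom_carrier[OF f S(2)] tr_carrier[OF F_module I(2)] c])
  also have "\<dots> = (tr n N (\<pi> I) y * f (\<pi> I)) *\<^sub>v gen I"
    by (simp only: tr_hom[OF F_module N f I(2)])
  also have "\<dots> = tr n N (\<pi> I) y *\<^sub>v (f (\<pi> I) *\<^sub>v gen I)"
    by (rule assoc_mult_mat_vec[OF tr_carrier[OF N I(2)] hom_carrier[OF f S(1)] c])
  finally show ?thesis .
qed

lemma F_hom_ext:
  fixes f g :: "perm \<Rightarrow> 'k::field mat"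
  assumes N: "is_module n N" and f: "is_hom n F N f" and g: "is_hom n F N g"
    and eq: "\<And>I. I \<in> set L \<Longrightarrow> f (\<pi> I) *\<^sub>v gen I = g (\<pi> I) *\<^sub>v gen I" and p: "p \<in> Sym n"
  shows "f p = g p"
proof (rule mat_eq_sglI)
  show "f p \<in> carrier_mat (rdim N p) (length (fb n L \<pi> p))"
    "g p \<in> carrier_mat (rdim N p) (length (fb n L \<pi> p))" using hom_carrier[OF f p] hom_carrier[OF g p] by auto
  show "distinct (fb n L \<pi> p)" by (rule distinct_fb[OF distinct_labels])
  fix I assume "I \<in> set (fb n L \<pi> p)"
  then have "I \<in> set L" "bruhat_le n p (\<pi> I)" by auto
  then show "f p *\<^sub>v sgl (fb n L \<pi> p) I = g p *\<^sub>v sgl (fb n L \<pi> p) I"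
    using F_hom_sgl[OF N f] F_hom_sgl[OF N g] eq by simp
qed

text \<open>The other half of Yoneda: prescribed images of the generators are extended by transport
  along paths, and compatibility with the arrows is \<open>tr_step\<close>.\<close>

lemma F_hom_exists:
  fixes u :: "'i \<Rightarrow> 'k::field vec"
  assumes M: "is_module n M" and u: "\<And>I. I \<in> set L \<Longrightarrow> u I \<in> carrier_vec (rdim M (\<pi> I))"
  obtains h where "is_hom n F M h" "\<And>I. I \<in> set L \<Longrightarrow> h (\<pi> I) *\<^sub>v gen I = u I"
proof -
  have "\<exists>h. h \<in> carrier_mat (rdim M y) (length (fb n L \<pi> y)) \<and>
      (\<forall>I\<in>set (fb n L \<pi> y). h *\<^sub>v sgl (fb n L \<pi> y) I = tr n M (\<pi> I) y *\<^sub>v u I)" for y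
  proof -
    have "tr n M (\<pi> I) y *\<^sub>v u I \<in> carrier_vec (rdim M y)" if "I \<in> set (fb n L \<pi> y)" for I
      using tr_carrier[OF M, of y "\<pi> I"] u[of I] that by auto
    then obtain h where "h \<in> carrier_mat (rdim M y) (length (fb n L \<pi> y))"
      "\<And>I. I \<in> set (fb n L \<pi> y) \<Longrightarrow> h *\<^sub>v sgl (fb n L \<pi> y) I = tr n M (\<pi> I) y *\<^sub>v u I"
      using mat_of_sgl[OF distinct_fb[OF distinct_labels], of n \<pi> y "\<lambda>I. tr n M (\<pi> I) y *\<^sub>v u I" "rdim M y"] by blast
    then show ?thesis by blast
  qed
  then obtain h where h1: "\<And>y. h y \<in> carrier_mat (rdim M y) (length (fb n L \<pi> y))" and
    h2: "\<And>y I. I \<in> set (fb n L \<pi> y) \<Longrightarrow> h y *\<^sub>v sgl (fb n L \<pi> y) I = tr n M (\<pi> I) y *\<^sub>v u I" by metis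
  have "is_hom n F M h"
    unfolding is_hom_def
  proof (intro conjI ballI allI impI)
    fix p q assume pq: "covers n p q"
    show "h q * rmap F p q = rmap M p q * h p"
    proof (rule mat_eq_sglI)
      have c: "rmap (F :: 'k rep) p q \<in> carrier_mat (length (fb n L \<pi> q)) (length (fb n L \<pi> p))"
        by simp
      have cM: "rmap M p q \<in> carrier_mat (rdim M q) (rdim M p)" by (rule rmap_carrier[OF M pq])
      show "h q * rmap F p q \<in> carrier_mat (rdim M q) (length (fb n L \<pi> p))" using h1[of q] c by simp
      show "rmap M p q * h p \<in> carrier_mat (rdim M q) (length (fb n L \<pi> p))" using h1[of p] cM by simp
      show "distinct (fb n L \<pi> p)" by (rule distinct_fb[OF distinct_labels])
      fix I assume I: "I \<in> set (fb n L \<pi> p)"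
      then have Iq: "I \<in> set (fb n L \<pi> q)" using covers_le[OF pq] bruhat_le_trans by auto
      have le: "bruhat_le n p (\<pi> I)" using I by simp
      have uI: "u I \<in> carrier_vec (rdim M (\<pi> I))" using u I by simp
      have "rmap (F :: 'k rep) p q *\<^sub>v sgl (fb n L \<pi> p) I = tr n F p q *\<^sub>v sgl (fb n L \<pi> p) I"
        by (simp only: tr_free[OF distinct_labels covers_le[OF pq]] free_rep_simps)
      also have "\<dots> = sgl (fb n L \<pi> q) I"
        by (rule tr_free_sgl[OF distinct_labels covers_le[OF pq]]) (use I in simp_all)
      finally have "rmap (F :: 'k rep) p q *\<^sub>v sgl (fb n L \<pi> p) I = sgl (fb n L \<pi> q) I" .
      then have "(h q * rmap F p q) *\<^sub>v sgl (fb n L \<pi> p) I = tr n M (\<pi> I) q *\<^sub>v u I"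
        using assoc_mult_mat_vec[OF h1[of q] c bvec_carrier] h2[OF Iq] by simp
      also have "\<dots> = rmap M p q *\<^sub>v (tr n M (\<pi> I) p *\<^sub>v u I)"
        unfolding tr_step[OF M le pq] by (rule assoc_mult_mat_vec[OF cM tr_carrier[OF M le] uI])
      also have "\<dots> = (rmap M p q * h p) *\<^sub>v sgl (fb n L \<pi> p) I"
        using assoc_mult_mat_vec[OF cM h1[of p] bvec_carrier] h2[OF I] by simp
      finally show "(h q * rmap F p q) *\<^sub>v sgl (fb n L \<pi> p) I = (rmap M p q * h p) *\<^sub>v sgl (fb n L \<pi> p) I" .
    qed
  qed (use h1 in simp)
  moreover have "h (\<pi> I) *\<^sub>v gen I = u I" if I: "I \<in> set L" for I
    using h2[of I "\<pi> I"] that labels_Sym[OF that] u[OF that] tr_refl[OF M] bruhat_le_refl by simp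
  ultimately show ?thesis by (rule that)
qed

end

section \<open>Operations on homomorphisms, projectivity and lifting\<close>

lemma hom_comp:
  assumes M: "is_module n L" "is_module n M" "is_module n N" and g: "is_hom n L M g" and f: "is_hom n M N f"
  shows "is_hom n L N (\<lambda>p. f p * g p)"
  unfolding is_hom_def
proof (intro conjI ballI allI impI)
  fix p assume "p \<in> Sym n"
  then show "f p * g p \<in> carrier_mat (rdim N p) (rdim L p)"
    using hom_carrier[OF f] hom_carrier[OF g] by (meson mult_carrier_mat)
next
  fix p q assume pq: "covers n p q"
  then have S: "p \<in> Sym n" "q \<in> Sym n" using covers_Sym by auto
  note c = hom_carrier[OF f] hom_carrier[OF g] rmap_carrier[OF M(1) pq] rmap_carrier[OF M(2) pq] rmap_carrier[OF M(3) pq]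
  have "f q * g q * rmap L p q = f q * (g q * rmap L p q)"
    by (rule assoc_mult_mat[OF c(1)[OF S(2)] c(2)[OF S(2)] c(3)])
  also have "\<dots> = f q * rmap M p q * g p"
    unfolding hom_comm[OF g pq] by (rule assoc_mult_mat[symmetric, OF c(1)[OF S(2)] c(4) c(2)[OF S(1)]])
  also have "\<dots> = rmap N p q * (f p * g p)"
    unfolding hom_comm[OF f pq] by (rule assoc_mult_mat[OF c(5) c(1)[OF S(1)] c(2)[OF S(1)]])
  finally show "f q * g q * rmap L p q = rmap N p q * (f p * g p)" .
qed

lemma hom_id: "is_module n M \<Longrightarrow> is_hom n M M (\<lambda>p. 1\<^sub>m (rdim M p))"
  unfolding is_hom_def using rmap_carrier by fastforce

lemma hom_minus:
  assumes M: "is_module n M" "is_module n N" and f: "is_hom n M N f" and g: "is_hom n M N g"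
  shows "is_hom n M N (\<lambda>p. f p - g p)"
  unfolding is_hom_def
proof (intro conjI ballI allI impI)
  fix p assume "p \<in> Sym n"
  then show "f p - g p \<in> carrier_mat (rdim N p) (rdim M p)"
    using hom_carrier[OF g] by (simp add: minus_carrier_mat)
next
  fix p q assume pq: "covers n p q"
  then have S: "p \<in> Sym n" "q \<in> Sym n" using covers_Sym by auto
  show "(f q - g q) * rmap M p q = rmap N p q * (f p - g p)"
    using minus_mult_distrib_mat[OF hom_carrier[OF f S(2)] hom_carrier[OF g S(2)] rmap_carrier[OF M(1) pq]]
      mult_minus_distrib_mat[OF rmap_carrier[OF M(2) pq] hom_carrier[OF f S(1)] hom_carrier[OF g S(1)]]
      hom_comm[OF f pq] hom_comm[OF g pq] by simp
qed

lemma hom_add: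
  assumes M: "is_module n M" "is_module n N" and f: "is_hom n M N f" and g: "is_hom n M N g"
  shows "is_hom n M N (\<lambda>p. f p + g p)"
  unfolding is_hom_def
proof (intro conjI ballI allI impI)
  fix p assume "p \<in> Sym n"
  then show "f p + g p \<in> carrier_mat (rdim N p) (rdim M p)"
    using hom_carrier[OF g] by simp
next
  fix p q assume pq: "covers n p q"
  then have S: "p \<in> Sym n" "q \<in> Sym n" using covers_Sym by auto
  show "(f q + g q) * rmap M p q = rmap N p q * (f p + g p)"
    using add_mult_distrib_mat[OF hom_carrier[OF f S(2)] hom_carrier[OF g S(2)] rmap_carrier[OF M(1) pq]]
      mult_add_distrib_mat[OF rmap_carrier[OF M(2) pq] hom_carrier[OF f S(1)] hom_carrier[OF g S(1)]]
      hom_comm[OF f pq] hom_comm[OF g pq] by simp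
qed

context labels
begin

text \<open>A lift is chosen on generators and extended. With liftability assumed there, the lemma
  serves surjections as well as lifts into the image of a differential.\<close>

lemma F_lift:
  fixes f :: "perm \<Rightarrow> 'k::field mat"
  assumes M: "is_module n M" "is_module n N" and g: "is_hom n M N g" and f: "is_hom n F N f"
    and ex: "\<And>I. I \<in> set L \<Longrightarrow> \<exists>u\<in>carrier_vec (rdim M (\<pi> I)). g (\<pi> I) *\<^sub>v u = f (\<pi> I) *\<^sub>v gen I"
  obtains h where "is_hom n F M h" "\<And>p. p \<in> Sym n \<Longrightarrow> g p * h p = f p"
proof -
  obtain u where u: "\<And>I. I \<in> set L \<Longrightarrow> u I \<in> carrier_vec (rdim M (\<pi> I))"
    "\<And>I. I \<in> set L \<Longrightarrow> g (\<pi> I) *\<^sub>v u I = f (\<pi> I) *\<^sub>v gen I" using ex by metis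
  obtain h where h: "is_hom n F M h" "\<And>I. I \<in> set L \<Longrightarrow> h (\<pi> I) *\<^sub>v gen I = u I"
    using F_hom_exists[OF M(1) u(1)] by blast
  have "g p * h p = f p" if p: "p \<in> Sym n" for p
  proof (rule F_hom_ext[OF M(2) hom_comp[OF F_module M h(1) g] f _ p])
    fix I assume I: "I \<in> set L"
    have "(g (\<pi> I) * h (\<pi> I)) *\<^sub>v gen I = g (\<pi> I) *\<^sub>v (h (\<pi> I) *\<^sub>v gen I)"
      using assoc_mult_mat_vec[OF hom_carrier[OF g labels_Sym[OF I]] hom_carrier[OF h(1) labels_Sym[OF I]]]
      by simp
    then show "(g (\<pi> I) * h (\<pi> I)) *\<^sub>v gen I = f (\<pi> I) *\<^sub>v gen I" using h(2)[OF I] u(2)[OF I] by simp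
  qed
  with h(1) show ?thesis by (rule that)
qed

lemma F_projective: "is_projective n (F :: 'k::field rep)"
  unfolding is_projective_def
proof (intro conjI allI impI)
  show "is_module n (F :: 'k rep)" by (rule F_module)
  fix M N :: "'k rep" and g f
  assume a: "is_module n M" "is_module n N" "is_hom n M N g" "hom_surj n M N g" "is_hom n F N f"
  have "\<exists>u\<in>carrier_vec (rdim M (\<pi> I)). g (\<pi> I) *\<^sub>v u = f (\<pi> I) *\<^sub>v gen I" if I: "I \<in> set L" for I
  proof -
    have "f (\<pi> I) *\<^sub>v gen I \<in> carrier_vec (rdim N (\<pi> I))"
      using hom_carrier[OF a(5) labels_Sym[OF I]] by (rule mult_mat_vec_carrier) simp
    then show ?thesis using a(4) labels_Sym[OF I] by (auto simp: hom_surj_def)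
  qed
  from F_lift[OF a(1-3,5) this] show "\<exists>h. is_hom n F M h \<and> (\<forall>p\<in>Sym n. g p * h p = f p)" by metis
qed

end

lemma Sym_enum: "distinct (Sym_enum n) \<and> set (Sym_enum n) = Sym n"
  unfolding Sym_enum_def by (rule someI_ex) (use finite_distinct_list[OF finite_Sym] in blast)

text \<open>There is one generator for every standard basis vector of M at every vertex. The cover
  splits when M is projective, which brings lifting problems back to free modules.\<close>

lemma free_cover:
  fixes M :: "'k::field rep"
  assumes M: "is_module n M"
  obtains L :: "(perm \<times> nat) list" and c
  where "labels n L fst" "is_hom n (free_rep n L fst) M c" "hom_surj n (free_rep n L fst) M c"
proof -
  have "finite (Sigma (Sym n) (\<lambda>p. {..<rdim M p}))" by simp
  then obtain L where L: "set L = Sigma (Sym n) (\<lambda>p. {..<rdim M p})" "distinct L"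
    using finite_distinct_list by blast
  have memL: "I \<in> set L \<longleftrightarrow> fst I \<in> Sym n \<and> snd I < rdim M (fst I)" for I
    unfolding L(1) by (cases I) simp
  interpret labels n L fst
  proof
    show "distinct L" by (rule L(2))
    show "fst I \<in> Sym n" if "I \<in> set L" for I using that memL by blast
  qed
  have "unit_vec (rdim M (fst I)) (snd I) \<in> carrier_vec (rdim M (fst I))" for I :: "perm \<times> nat" by simp
  then obtain c where c: "is_hom n F M c"
    "\<And>I. I \<in> set L \<Longrightarrow> c (fst I) *\<^sub>v gen I = unit_vec (rdim M (fst I)) (snd I)"
    using F_hom_exists[OF M, of "\<lambda>I. unit_vec (rdim M (fst I)) (snd I)"] by metis
  have "hom_surj n F M c"
    unfolding hom_surj_def
  proof (intro ballI)
    fix p and v :: "'k vec" assume p: "p \<in> Sym n" and v: "v \<in> carrier_vec (rdim M p)"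
    let ?B = "fb n L fst p"
    have cc: "c p \<in> carrier_mat (rdim M p) (length ?B)" using hom_carrier[OF c(1) p] by simp
    have dB: "distinct ?B" by (rule distinct_fb[OF L(2)])
    \<comment> \<open>A preimage is formed from the generators located at p itself; those of higher
      vertices get coefficient 0.\<close>
    define u where "u = bvec ?B (\<lambda>I. if fst I = p then v $ snd I else 0)"
    have "c p *\<^sub>v u = v"
    proof (rule eq_vecI)
      fix i assume "i < dim_vec v"
      then have i: "i < rdim M p" using v by simp
      have "(c p *\<^sub>v u) $ i = (\<Sum>k\<in>{0..<length ?B}. c p $$ (i, k) * (if fst (?B ! k) = p then v $ snd (?B ! k) else 0))"
        using cc i by (simp add: u_def bvec_def scalar_prod_def)
      also have "\<dots> = (\<Sum>k\<in>{0..<length ?B}. if ?B ! k = (p, i) then v $ i else 0)"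
      proof (intro sum.cong refl)
        fix k assume "k \<in> {0..<length ?B}"
        then have k: "k < length ?B" by simp
        show "c p $$ (i, k) * (if fst (?B ! k) = p then v $ snd (?B ! k) else 0) = (if ?B ! k = (p, i) then v $ i else 0)"
        proof (cases "fst (?B ! k) = p")
          case True
          then obtain j where j: "?B ! k = (p, j)" by (metis prod.collapse)
          have "(p, j) \<in> set ?B" using k j by (metis nth_mem)
          then have jL: "(p, j) \<in> set L" by simp
          then have jj: "j < rdim M p" using memL by simp
          have "col (c p) k = unit_vec (rdim M p) j"
            using c(2)[OF jL] mult_unit_vec[OF cc k] j by (simp add: sgl_nth[OF dB k, symmetric])
          then have "c p $$ (i, k) = unit_vec (rdim M p) j $ i"
            using cc i k by (metis carrier_matD index_col)
          then show ?thesis using i jj j by simp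
        qed auto
      qed
      also have "\<dots> = (\<Sum>b\<in>set ?B. if b = (p, i) then v $ i else 0)"
        by (rule sum_distinct_nth[OF dB])
      also have "\<dots> = v $ i" using i p memL bruhat_le_refl by simp
      finally show "(c p *\<^sub>v u) $ i = v $ i" .
    qed (use cc v in simp)
    moreover have "u \<in> carrier_vec (rdim (F :: 'k rep) p)" by (simp add: u_def)
    ultimately show "\<exists>u\<in>carrier_vec (rdim (F :: 'k rep) p). c p *\<^sub>v u = v" by blast
  qed
  with labels_axioms c(1) show ?thesis by (rule that)
qed

lemma zero_mat_mult_vec: "v \<in> carrier_vec c \<Longrightarrow> 0\<^sub>m r c *\<^sub>v v = (0\<^sub>v r :: 'k::field vec)"
  by (rule eq_vecI) (auto simp: scalar_prod_def)

lemma projectiveD: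
  fixes P M N :: "'k::field rep"
  assumes "is_projective n P" "is_module n M" "is_module n N" "is_hom n M N g" "hom_surj n M N g" "is_hom n P N f"
  obtains h where "is_hom n P M h" "\<And>p. p \<in> Sym n \<Longrightarrow> g p * h p = f p"
  using assms unfolding is_projective_def by metis

lemma projective_module: "is_projective n P \<Longrightarrow> is_module n P"
  by (simp add: is_projective_def)

lemma projective_lift_exact:
  fixes P M N K :: "'k::field rep"
  assumes P: "is_projective n P" and M: "is_module n M" "is_module n N"
    and u: "is_hom n M N u" and g: "is_hom n N K g" and ex: "exact_at n M N K u g"
    and f: "is_hom n P N f" and gf: "\<And>p. p \<in> Sym n \<Longrightarrow> g p * f p = 0\<^sub>m (rdim K p) (rdim P p)"
  obtains h where "is_hom n P M h" "\<And>p. p \<in> Sym n \<Longrightarrow> u p * h p = f p"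
proof -
  have mP: "is_module n P" by (rule projective_module[OF P])
  obtain L :: "(perm \<times> nat) list" and c
  where L: "labels n L fst" and c: "is_hom n (free_rep n L fst) P c" "hom_surj n (free_rep n L fst) P c"
    using free_cover[OF mP] by blast
  interpret labels n L fst by (rule L)
  obtain s where s: "is_hom n P F s" "\<And>p. p \<in> Sym n \<Longrightarrow> c p * s p = 1\<^sub>m (rdim P p)"
    using projectiveD[OF P F_module mP c hom_id[OF mP]] by metis
  have fc: "is_hom n F N (\<lambda>p. f p * c p)" by (rule hom_comp[OF F_module mP M(2) c(1) f])
  have "\<exists>x\<in>carrier_vec (rdim M (fst I)). u (fst I) *\<^sub>v x = (f (fst I) * c (fst I)) *\<^sub>v gen I"
    if I: "I \<in> set L" for I
  proof -
    let ?p = "fst I"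
    have p: "?p \<in> Sym n" using labels_Sym[OF I] .
    have cg: "gen I \<in> carrier_vec (rdim (F :: 'k rep) ?p)" by simp
    let ?v = "c ?p *\<^sub>v gen I"
    have v: "?v \<in> carrier_vec (rdim P ?p)" by (rule mult_mat_vec_carrier[OF hom_carrier[OF c(1) p] cg])
    have eq: "(f ?p * c ?p) *\<^sub>v gen I = f ?p *\<^sub>v ?v"
      by (rule assoc_mult_mat_vec[OF hom_carrier[OF f p] hom_carrier[OF c(1) p] cg])
    have fv: "f ?p *\<^sub>v ?v \<in> carrier_vec (rdim N ?p)" by (rule mult_mat_vec_carrier[OF hom_carrier[OF f p] v])
    have "g ?p *\<^sub>v (f ?p *\<^sub>v ?v) = (g ?p * f ?p) *\<^sub>v ?v"
      by (rule assoc_mult_mat_vec[symmetric, OF hom_carrier[OF g p] hom_carrier[OF f p] v])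
    also have "\<dots> = 0\<^sub>v (rdim K ?p)" unfolding gf[OF p] using v by (rule zero_mat_mult_vec)
    finally have "\<exists>x\<in>carrier_vec (rdim M ?p). f ?p *\<^sub>v ?v = u ?p *\<^sub>v x"
      using ex p fv unfolding exact_at_def by blast
    then show ?thesis unfolding eq by metis
  qed
  from F_lift[OF M u fc this] obtain h where h: "is_hom n F M h" "\<And>p. p \<in> Sym n \<Longrightarrow> u p * h p = f p * c p"
    by metis
  have "u p * (h p * s p) = f p" if p: "p \<in> Sym n" for p
  proof -
    have "u p * (h p * s p) = f p * c p * s p"
      using assoc_mult_mat[OF hom_carrier[OF u p] hom_carrier[OF h(1) p] hom_carrier[OF s(1) p]] h(2)[OF p] by simp
    also have "\<dots> = f p * (c p * s p)"
      by (rule assoc_mult_mat[OF hom_carrier[OF f p] hom_carrier[OF c(1) p] hom_carrier[OF s(1) p]])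
    finally show ?thesis using s(2)[OF p] hom_carrier[OF f p] by simp
  qed
  moreover have "is_hom n P M (\<lambda>p. h p * s p)" by (rule hom_comp[OF mP F_module M(1) s(1) h(1)])
  ultimately show ?thesis using that by blast
qed

section \<open>Comparison of projective resolutions\<close>

lemma exact_comp_zero:
  fixes M N K :: "'k::field rep"
  assumes ex: "exact_at n M N K f g" and f: "is_hom n M N f" and g: "is_hom n N K g" and p: "p \<in> Sym n"
  shows "g p * f p = 0\<^sub>m (rdim K p) (rdim M p)"
proof (rule mat_eq_vecI)
  show "g p * f p \<in> carrier_mat (rdim K p) (rdim M p)"
    using hom_carrier[OF f p] hom_carrier[OF g p] by simp
  fix v :: "'k vec" assume v: "v \<in> carrier_vec (rdim M p)"
  have fv: "f p *\<^sub>v v \<in> carrier_vec (rdim N p)" by (rule mult_mat_vec_carrier[OF hom_carrier[OF f p] v])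
  have "(g p * f p) *\<^sub>v v = g p *\<^sub>v (f p *\<^sub>v v)"
    by (rule assoc_mult_mat_vec[OF hom_carrier[OF g p] hom_carrier[OF f p] v])
  also have "\<dots> = 0\<^sub>v (rdim K p)" using ex p fv v unfolding exact_at_def by blast
  finally show "(g p * f p) *\<^sub>v v = 0\<^sub>m (rdim K p) (rdim M p) *\<^sub>v v"
    by (simp only: zero_mat_mult_vec[OF v])
qed simp

locale resolution =
  fixes n :: nat and M :: "'k::field rep" and P d
  assumes res: "proj_resolution n M P d" and mod_M: "is_module n M"
begin

text \<open>The target of \<open>d i\<close>: with M in the slot below \<open>P 0\<close>,
  statements about the differentials need no separate case at the augmentation.\<close>

definition aug :: "nat \<Rightarrow> 'k rep" where "aug i = (if i = 0 then M else P (i - 1))"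

lemma proj_P: "is_projective n (P i)"
  using res by (simp add: proj_resolution_def)

lemma mod_P: "is_module n (P i)"
  by (rule projective_module[OF proj_P])

lemma aug_Suc [simp]: "aug (Suc i) = P i"
  by (simp add: aug_def)

lemma d_hom: "is_hom n (P i) (aug i) (d i)"
  using res by (cases i) (auto simp: proj_resolution_def aug_def)

lemma d_hom_Suc: "is_hom n (P (Suc i)) (P i) (d (Suc i))"
  using d_hom[of "Suc i"] by simp

lemma d_exact: "exact_at n (P (Suc i)) (P i) (aug i) (d (Suc i)) (d i)"
  using res by (auto simp: proj_resolution_def aug_def)

lemma d_d: "p \<in> Sym n \<Longrightarrow> d i p * d (Suc i) p = 0\<^sub>m (rdim (aug i) p) (rdim (P (Suc i)) p)"
  by (rule exact_comp_zero[OF d_exact d_hom_Suc d_hom])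

lemma lift_to:
  assumes "is_projective n Q" "is_hom n Q (P i) f"
    and "\<And>p. p \<in> Sym n \<Longrightarrow> d i p * f p = 0\<^sub>m (rdim (aug i) p) (rdim Q p)"
  obtains h where "is_hom n Q (P (Suc i)) h" "\<And>p. p \<in> Sym n \<Longrightarrow> d (Suc i) p * h p = f p"
  using projective_lift_exact[OF assms(1) mod_P mod_P d_hom_Suc d_hom d_exact assms(2,3)] by blast

end

lemma chain_map_exists:
  fixes M :: "'k::field rep"
  assumes "resolution n M P d" "resolution n M Q e"
  obtains \<phi> where "\<And>i. is_hom n (P i) (Q i) (\<phi> i)" "\<And>p. p \<in> Sym n \<Longrightarrow> e 0 p * \<phi> 0 p = d 0 p"
    "\<And>i p. p \<in> Sym n \<Longrightarrow> e (Suc i) p * \<phi> (Suc i) p = \<phi> i p * d (Suc i) p"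
proof -
  interpret P: resolution n M P d by (rule assms(1))
  interpret Q: resolution n M Q e by (rule assms(2))
  \<comment> \<open>The clause on the triple composite travels with the map because it is exactly
    the condition under which the next lift exists.\<close>
  let ?C = "\<lambda>i f. is_hom n (P i) (Q i) f \<and>
    (\<forall>p\<in>Sym n. e i p * (f p * d (Suc i) p) = 0\<^sub>m (rdim (Q.aug i) p) (rdim (P (Suc i)) p)) \<and>
    (i = 0 \<longrightarrow> (\<forall>p\<in>Sym n. e 0 p * f p = d 0 p))"
  let ?R = "\<lambda>i f g. \<forall>p\<in>Sym n. e (Suc i) p * g p = f p * d (Suc i) p"
  have assoc: "e i p * (f p * d (Suc i) p) = (e i p * f p) * d (Suc i) p"
    if "is_hom n (P i) (Q i) f" "p \<in> Sym n" for i f p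
    by (rule assoc_mult_mat[symmetric, OF hom_carrier[OF Q.d_hom that(2)] hom_carrier[OF that] hom_carrier[OF P.d_hom_Suc that(2)]])
  have "\<exists>\<phi>. \<forall>i. ?C i (\<phi> i) \<and> ?R i (\<phi> i) (\<phi> (Suc i))"
  proof (rule dependent_nat_choice)
    have aug0: "P.aug 0 = M" "Q.aug 0 = M" by (simp_all add: P.aug_def Q.aug_def)
    have surj: "hom_surj n (Q 0) M (e 0)" using Q.res by (simp add: proj_resolution_def)
    obtain f where f: "is_hom n (P 0) (Q 0) f" "\<And>p. p \<in> Sym n \<Longrightarrow> e 0 p * f p = d 0 p"
      using projectiveD[OF P.proj_P Q.mod_P P.mod_M Q.d_hom[of 0, unfolded aug0] surj P.d_hom[of 0, unfolded aug0]] by blast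
    have "e 0 p * (f p * d (Suc 0) p) = 0\<^sub>m (rdim (Q.aug 0) p) (rdim (P (Suc 0)) p)" if p: "p \<in> Sym n" for p
      using assoc[OF f(1) p] f(2)[OF p] P.d_d[OF p, of 0] by (simp add: aug0)
    then show "\<exists>f. ?C 0 f" using f by blast
  next
    fix f i assume C: "?C i f"
    have fd: "is_hom n (P (Suc i)) (Q i) (\<lambda>p. f p * d (Suc i) p)"
      using C by (intro hom_comp[OF P.mod_P P.mod_P Q.mod_P P.d_hom_Suc]) blast
    obtain g where g: "is_hom n (P (Suc i)) (Q (Suc i)) g" "\<And>p. p \<in> Sym n \<Longrightarrow> e (Suc i) p * g p = f p * d (Suc i) p"
      using Q.lift_to[OF P.proj_P fd] C by blast
    have "e (Suc i) p * (g p * d (Suc (Suc i)) p) = 0\<^sub>m (rdim (Q.aug (Suc i)) p) (rdim (P (Suc (Suc i))) p)"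
      if p: "p \<in> Sym n" for p
    proof -
      have f: "f p \<in> carrier_mat (rdim (Q i) p) (rdim (P i) p)" using C hom_carrier p by blast
      have "e (Suc i) p * (g p * d (Suc (Suc i)) p) = (f p * d (Suc i) p) * d (Suc (Suc i)) p"
        using assoc[OF g(1) p] g(2)[OF p] by simp
      also have "\<dots> = f p * (d (Suc i) p * d (Suc (Suc i)) p)"
        by (rule assoc_mult_mat[OF f hom_carrier[OF P.d_hom_Suc p] hom_carrier[OF P.d_hom_Suc p]])
      finally show ?thesis using P.d_d[OF p, of "Suc i"] f by simp
    qed
    then show "\<exists>g. ?C (Suc i) g \<and> ?R i f g" using g by (intro exI[of _ g]) auto
  qed
  then obtain \<phi> where H: "\<forall>i. ?C i (\<phi> i) \<and> ?R i (\<phi> i) (\<phi> (Suc i))" by (rule exE)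
  note \<phi> = conjunct1[OF spec[OF H]] conjunct2[OF spec[OF H]]
  show ?thesis
  proof (rule that[of \<phi>])
    show "is_hom n (P i) (Q i) (\<phi> i)" for i using \<phi>(1)[of i] by blast
    show "e 0 p * \<phi> 0 p = d 0 p" if "p \<in> Sym n" for p using \<phi>(1)[of 0] that by blast
    show "e (Suc i) p * \<phi> (Suc i) p = \<phi> i p * d (Suc i) p" if "p \<in> Sym n" for i p using \<phi>(2)[of i] that by blast
  qed
qed

text \<open>The map 1 - \<theta> covers zero on M, so it is null-homotopic: at each stage the part
  not yet accounted for is killed by the differential and therefore lifts.\<close>

lemma (in resolution) homotopy_exists:
  assumes \<theta>: "\<And>i. is_hom n (P i) (P i) (\<theta> i)" and \<theta>0: "\<And>p. p \<in> Sym n \<Longrightarrow> d 0 p * \<theta> 0 p = d 0 p"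
    and \<theta>S: "\<And>i p. p \<in> Sym n \<Longrightarrow> d (Suc i) p * \<theta> (Suc i) p = \<theta> i p * d (Suc i) p"
  obtains h where "\<And>i. is_hom n (P i) (P (Suc i)) (h i)"
    "\<And>p. p \<in> Sym n \<Longrightarrow> d 1 p * h 0 p = 1\<^sub>m (rdim (P 0) p) - \<theta> 0 p"
    "\<And>i p. p \<in> Sym n \<Longrightarrow> d (Suc (Suc i)) p * h (Suc i) p =
        1\<^sub>m (rdim (P (Suc i)) p) - \<theta> (Suc i) p - h i p * d (Suc i) p"
proof -
  define \<delta> where "\<delta> i p = 1\<^sub>m (rdim (P i) p) - \<theta> i p" for i p
  have \<delta>: "is_hom n (P i) (P i) (\<delta> i)" for i
    unfolding \<delta>_def by (rule hom_minus[OF mod_P mod_P hom_id[OF mod_P] \<theta>])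
  have \<delta>0: "d 0 p * \<delta> 0 p = 0\<^sub>m (rdim (aug 0) p) (rdim (P 0) p)" if p: "p \<in> Sym n" for p
    unfolding \<delta>_def mult_minus_distrib_mat[OF hom_carrier[OF d_hom p] one_carrier_mat hom_carrier[OF \<theta> p]]
    using \<theta>0[OF p] hom_carrier[OF d_hom p, of 0] by simp
  have \<delta>S: "d (Suc i) p * \<delta> (Suc i) p = \<delta> i p * d (Suc i) p" if p: "p \<in> Sym n" for i p
    unfolding \<delta>_def mult_minus_distrib_mat[OF hom_carrier[OF d_hom_Suc p] one_carrier_mat hom_carrier[OF \<theta> p]]
      minus_mult_distrib_mat[OF one_carrier_mat hom_carrier[OF \<theta> p] hom_carrier[OF d_hom_Suc p]]
    using \<theta>S[OF p] hom_carrier[OF d_hom_Suc p, of i] by simp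
  \<comment> \<open>The remaining obstruction in degree \<open>Suc i\<close> once h is fixed in
    degree i; the next homotopy component is a lift of it.\<close>
  define r where "r i h p = \<delta> (Suc i) p - h p * d (Suc i) p" for i p and h :: "perm \<Rightarrow> 'k mat"
  let ?C = "\<lambda>i h. is_hom n (P i) (P (Suc i)) h \<and>
    (\<forall>p\<in>Sym n. d (Suc i) p * r i h p = 0\<^sub>m (rdim (aug (Suc i)) p) (rdim (P (Suc i)) p)) \<and>
    (i = 0 \<longrightarrow> (\<forall>p\<in>Sym n. d 1 p * h p = \<delta> 0 p))"
  let ?R = "\<lambda>i h g. \<forall>p\<in>Sym n. d (Suc (Suc i)) p * g p = r i h p"
  have r_hom: "is_hom n (P (Suc i)) (P (Suc i)) (r i h)" if "is_hom n (P i) (P (Suc i)) h" for i h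
    unfolding r_def by (rule hom_minus[OF mod_P mod_P \<delta> hom_comp[OF mod_P mod_P mod_P d_hom_Suc that]])
  have dr: "d (Suc i) p * r i h p = \<delta> i p * d (Suc i) p - (d (Suc i) p * h p) * d (Suc i) p"
    if h: "is_hom n (P i) (P (Suc i)) h" and p: "p \<in> Sym n" for i h p
  proof -
    have hd: "h p * d (Suc i) p \<in> carrier_mat (rdim (P (Suc i)) p) (rdim (P (Suc i)) p)"
      using hom_carrier[OF h p] hom_carrier[OF d_hom_Suc p] by (rule mult_carrier_mat)
    show ?thesis
      unfolding r_def mult_minus_distrib_mat[OF hom_carrier[OF d_hom_Suc p] hom_carrier[OF \<delta> p] hd] \<delta>S[OF p]
        assoc_mult_mat[OF hom_carrier[OF d_hom_Suc p] hom_carrier[OF h p] hom_carrier[OF d_hom_Suc p]] ..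
  qed
  have "\<exists>h. \<forall>i. ?C i (h i) \<and> ?R i (h i) (h (Suc i))"
  proof (rule dependent_nat_choice)
    obtain h where h: "is_hom n (P 0) (P (Suc 0)) h" "\<And>p. p \<in> Sym n \<Longrightarrow> d (Suc 0) p * h p = \<delta> 0 p"
      using lift_to[OF proj_P \<delta> \<delta>0] by blast
    have "d (Suc 0) p * r 0 h p = 0\<^sub>m (rdim (aug (Suc 0)) p) (rdim (P (Suc 0)) p)" if p: "p \<in> Sym n" for p
      unfolding dr[OF h(1) p] h(2)[OF p]
      using hom_carrier[OF \<delta> p, of 0] hom_carrier[OF d_hom_Suc p, of 0] by simp
    then show "\<exists>h. ?C 0 h" using h by auto
  next
    fix h i assume C: "?C i h"
    then have h: "is_hom n (P i) (P (Suc i)) h" by blast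
    obtain g where g: "is_hom n (P (Suc i)) (P (Suc (Suc i))) g" "\<And>p. p \<in> Sym n \<Longrightarrow> d (Suc (Suc i)) p * g p = r i h p"
      using lift_to[OF proj_P r_hom[OF h]] C by blast
    have "d (Suc (Suc i)) p * r (Suc i) g p = 0\<^sub>m (rdim (aug (Suc (Suc i))) p) (rdim (P (Suc (Suc i))) p)"
      if p: "p \<in> Sym n" for p
    proof -
      note c = hom_carrier[OF \<delta> p, of "Suc i"] hom_carrier[OF h p] hom_carrier[OF d_hom_Suc p, of i]
        hom_carrier[OF d_hom_Suc p, of "Suc i"]
      have "r i h p * d (Suc (Suc i)) p = \<delta> (Suc i) p * d (Suc (Suc i)) p - h p * d (Suc i) p * d (Suc (Suc i)) p"
        unfolding r_def using c by (intro minus_mult_distrib_mat) auto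
      also have "h p * d (Suc i) p * d (Suc (Suc i)) p = 0\<^sub>m (rdim (P (Suc i)) p) (rdim (P (Suc (Suc i))) p)"
        unfolding assoc_mult_mat[OF c(2,3,4)] d_d[OF p] aug_Suc by (rule right_mult_zero_mat[OF c(2)])
      finally have "r i h p * d (Suc (Suc i)) p = \<delta> (Suc i) p * d (Suc (Suc i)) p"
        using c by auto
      then show ?thesis unfolding dr[OF g(1) p] g(2)[OF p] using c by simp
    qed
    then show "\<exists>g. ?C (Suc i) g \<and> ?R i h g" using g by (intro exI[of _ g]) simp
  qed
  then obtain h where H: "\<forall>i. ?C i (h i) \<and> ?R i (h i) (h (Suc i))" by (rule exE)
  note h = conjunct1[OF spec[OF H]] conjunct2[OF spec[OF H]]
  show ?thesis
  proof (rule that[of h])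
    show "is_hom n (P i) (P (Suc i)) (h i)" for i using h(1)[of i] by blast
    show "d 1 p * h 0 p = 1\<^sub>m (rdim (P 0) p) - \<theta> 0 p" if "p \<in> Sym n" for p
      using h(1)[of 0] that by (simp add: \<delta>_def)
    show "d (Suc (Suc i)) p * h (Suc i) p = 1\<^sub>m (rdim (P (Suc i)) p) - \<theta> (Suc i) p - h i p * d (Suc i) p"
      if "p \<in> Sym n" for i p using h(2)[of i] that by (simp add: r_def \<delta>_def)
  qed
qed

text \<open>A cocycle f is transported to f \<psi>. Pulled back along \<phi> it becomes f \<theta>,
  which is cohomologous to f, so a nonzero class stays nonzero. Exchanging the resolutions gives the
  converse.\<close>

lemma cohom_nonzero_transfer:
  fixes M N :: "'k::field rep"
  assumes rP: "resolution n M P d" and rQ: "resolution n M Q e" and N: "is_module n N"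
    and nz: "cohom_nonzero n P d N i"
  shows "cohom_nonzero n Q e N i"
proof -
  interpret P: resolution n M P d by (rule rP)
  interpret Q: resolution n M Q e by (rule rQ)
  obtain \<phi> where \<phi>: "\<And>i. is_hom n (P i) (Q i) (\<phi> i)" "\<And>p. p \<in> Sym n \<Longrightarrow> e 0 p * \<phi> 0 p = d 0 p"
    "\<And>i p. p \<in> Sym n \<Longrightarrow> e (Suc i) p * \<phi> (Suc i) p = \<phi> i p * d (Suc i) p"
    using chain_map_exists[OF rP rQ] by blast
  obtain \<psi> where \<psi>: "\<And>i. is_hom n (Q i) (P i) (\<psi> i)" "\<And>p. p \<in> Sym n \<Longrightarrow> d 0 p * \<psi> 0 p = e 0 p"
    "\<And>i p. p \<in> Sym n \<Longrightarrow> d (Suc i) p * \<psi> (Suc i) p = \<psi> i p * e (Suc i) p"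
    using chain_map_exists[OF rQ rP] by blast
  define \<theta> where "\<theta> i p = \<psi> i p * \<phi> i p" for i p
  have \<theta>: "is_hom n (P i) (P i) (\<theta> i)" for i
    unfolding \<theta>_def by (rule hom_comp[OF P.mod_P Q.mod_P P.mod_P \<phi>(1) \<psi>(1)])
  have \<theta>0: "d 0 p * \<theta> 0 p = d 0 p" if p: "p \<in> Sym n" for p
    unfolding \<theta>_def using assoc_mult_mat[OF hom_carrier[OF P.d_hom p] hom_carrier[OF \<psi>(1) p] hom_carrier[OF \<phi>(1) p], of 0]
    by (simp add: \<psi>(2)[OF p] \<phi>(2)[OF p])
  have \<theta>S: "d (Suc i) p * \<theta> (Suc i) p = \<theta> i p * d (Suc i) p" if p: "p \<in> Sym n" for i p
  proof -
    have "d (Suc i) p * \<theta> (Suc i) p = \<psi> i p * e (Suc i) p * \<phi> (Suc i) p"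
      unfolding \<theta>_def using assoc_mult_mat[OF hom_carrier[OF P.d_hom_Suc p] hom_carrier[OF \<psi>(1) p] hom_carrier[OF \<phi>(1) p]]
      by (simp add: \<psi>(3)[OF p])
    also have "\<dots> = \<psi> i p * (\<phi> i p * d (Suc i) p)"
      using assoc_mult_mat[OF hom_carrier[OF \<psi>(1) p] hom_carrier[OF Q.d_hom_Suc p] hom_carrier[OF \<phi>(1) p]]
      by (simp add: \<phi>(3)[OF p])
    also have "\<dots> = \<theta> i p * d (Suc i) p"
      unfolding \<theta>_def by (rule assoc_mult_mat[symmetric, OF hom_carrier[OF \<psi>(1) p] hom_carrier[OF \<phi>(1) p] hom_carrier[OF P.d_hom_Suc p]])
    finally show ?thesis .
  qed
  obtain h where h: "\<And>i. is_hom n (P i) (P (Suc i)) (h i)"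
    "\<And>p. p \<in> Sym n \<Longrightarrow> d 1 p * h 0 p = 1\<^sub>m (rdim (P 0) p) - \<theta> 0 p"
    "\<And>i p. p \<in> Sym n \<Longrightarrow> d (Suc (Suc i)) p * h (Suc i) p =
        1\<^sub>m (rdim (P (Suc i)) p) - \<theta> (Suc i) p - h i p * d (Suc i) p"
    using P.homotopy_exists[OF \<theta> \<theta>0 \<theta>S] by blast
  obtain f where f: "is_hom n (P i) N f" and fd: "\<And>p. p \<in> Sym n \<Longrightarrow> f p * d (Suc i) p = 0\<^sub>m (rdim N p) (rdim (P (Suc i)) p)"
    and fnz: "case i of 0 \<Rightarrow> \<not> (\<forall>p \<in> Sym n. f p = 0\<^sub>m (rdim N p) (rdim (P 0) p))
      | Suc j \<Rightarrow> \<not> (\<exists>g. is_hom n (P j) N g \<and> (\<forall>p \<in> Sym n. f p = g p * d (Suc j) p))"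
    using nz unfolding cohom_nonzero_def by blast
  define f' where "f' p = f p * \<psi> i p" for p
  have f': "is_hom n (Q i) N f'" unfolding f'_def by (rule hom_comp[OF Q.mod_P P.mod_P N \<psi>(1) f])
  have f'e: "f' p * e (Suc i) p = 0\<^sub>m (rdim N p) (rdim (Q (Suc i)) p)" if p: "p \<in> Sym n" for p
  proof -
    note c = hom_carrier[OF f p] hom_carrier[OF \<psi>(1) p, of i] hom_carrier[OF Q.d_hom_Suc p, of i]
      hom_carrier[OF P.d_hom_Suc p, of i] hom_carrier[OF \<psi>(1) p, of "Suc i"]
    have "f' p * e (Suc i) p = f p * (d (Suc i) p * \<psi> (Suc i) p)"
      unfolding f'_def assoc_mult_mat[OF c(1,2,3)] \<psi>(3)[OF p] ..
    also have "\<dots> = 0\<^sub>m (rdim N p) (rdim (P (Suc i)) p) * \<psi> (Suc i) p"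
      unfolding fd[OF p, symmetric] by (rule assoc_mult_mat[symmetric, OF c(1,4,5)])
    finally show ?thesis using c by simp
  qed
  text \<open>The homotopy gives \<open>f = f \<theta> + f h d\<close> on cocycles.\<close>
  have f_dh: "f p * (d (Suc i) p * h i p) = 0\<^sub>m (rdim N p) (rdim (P i) p)" if p: "p \<in> Sym n" for p
  proof -
    note c = hom_carrier[OF f p] hom_carrier[OF P.d_hom_Suc p, of i] hom_carrier[OF h(1) p, of i]
    have "f p * (d (Suc i) p * h i p) = 0\<^sub>m (rdim N p) (rdim (P (Suc i)) p) * h i p"
      unfolding fd[OF p, symmetric] by (rule assoc_mult_mat[symmetric, OF c])
    then show ?thesis using c by simp
  qed
  have f\<theta>: "f p * \<theta> i p = f' p * \<phi> i p" if p: "p \<in> Sym n" for p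
    unfolding f'_def \<theta>_def
    by (rule assoc_mult_mat[symmetric, OF hom_carrier[OF f p] hom_carrier[OF \<psi>(1) p] hom_carrier[OF \<phi>(1) p]])
  have sub: "A = B" if "A - B = 0\<^sub>m r c" "A \<in> carrier_mat r c" "B \<in> carrier_mat r c" for A B :: "'k mat" and r c
  proof (rule eq_matI)
    fix k l assume kl: "k < dim_row B" "l < dim_col B"
    then have "(A - B) $$ (k, l) = 0" unfolding that(1) using that(3) by simp
    moreover have "(A - B) $$ (k, l) = A $$ (k, l) - B $$ (k, l)" using kl by simp
    ultimately show "A $$ (k, l) = B $$ (k, l)" using kl that by simp
  qed (use that in auto)
  show ?thesis
  proof (cases i)
    case 0
    have "\<not> (\<forall>p \<in> Sym n. f' p = 0\<^sub>m (rdim N p) (rdim (Q 0) p))"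
    proof
      assume z: "\<forall>p \<in> Sym n. f' p = 0\<^sub>m (rdim N p) (rdim (Q 0) p)"
      have "f p = 0\<^sub>m (rdim N p) (rdim (P 0) p)" if p: "p \<in> Sym n" for p
      proof -
        have c: "f p \<in> carrier_mat (rdim N p) (rdim (P 0) p)" "\<theta> 0 p \<in> carrier_mat (rdim (P 0) p) (rdim (P 0) p)"
          "\<phi> 0 p \<in> carrier_mat (rdim (Q 0) p) (rdim (P 0) p)"
          using hom_carrier[OF f p] hom_carrier[OF \<theta> p] hom_carrier[OF \<phi>(1) p] 0 by auto
        have "f p - f p * \<theta> 0 p = f p * (1\<^sub>m (rdim (P 0) p) - \<theta> 0 p)"
          using mult_minus_distrib_mat[OF c(1) one_carrier_mat c(2)] c(1) by simp
        also have "\<dots> = 0\<^sub>m (rdim N p) (rdim (P 0) p)" using f_dh[OF p] h(2)[OF p] 0 by simp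
        finally have *: "f p - f p * \<theta> 0 p = 0\<^sub>m (rdim N p) (rdim (P 0) p)" .
        have "f p * \<theta> 0 p = 0\<^sub>m (rdim N p) (rdim (P 0) p)" using f\<theta>[OF p] z p 0 c by simp
        then show ?thesis using sub[OF *] c by simp
      qed
      then show False using fnz 0 by simp
    qed
    then show ?thesis unfolding cohom_nonzero_def using f' f'e 0 by (intro exI[of _ f']) auto
  next
    case (Suc j)
    have "\<not> (\<exists>g. is_hom n (Q j) N g \<and> (\<forall>p \<in> Sym n. f' p = g p * e (Suc j) p))"
    proof
      assume "\<exists>g. is_hom n (Q j) N g \<and> (\<forall>p \<in> Sym n. f' p = g p * e (Suc j) p)"
      then obtain g where g: "is_hom n (Q j) N g" "\<And>p. p \<in> Sym n \<Longrightarrow> f' p = g p * e (Suc j) p" by blast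
      \<comment> \<open>If f \<psi> = g e, then f = f \<theta> + f h d = g e \<phi> + f h d = (g
        \<phi> + f h) d.\<close>
      define g' where "g' p = g p * \<phi> j p + f p * h j p" for p
      have fS: "is_hom n (P (Suc j)) N f" using f Suc by simp
      have "is_hom n (P j) N g'" unfolding g'_def
        by (rule hom_add[OF P.mod_P N hom_comp[OF P.mod_P Q.mod_P N \<phi>(1) g(1)] hom_comp[OF P.mod_P P.mod_P N h(1) fS]])
      moreover have "f p = g' p * d (Suc j) p" if p: "p \<in> Sym n" for p
      proof -
        note c = hom_carrier[OF fS p] hom_carrier[OF \<theta> p, of "Suc j"] hom_carrier[OF \<phi>(1) p, of j]
          hom_carrier[OF \<phi>(1) p, of "Suc j"] hom_carrier[OF h(1) p, of j] hom_carrier[OF P.d_hom_Suc p, of j]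
          hom_carrier[OF g(1) p] hom_carrier[OF Q.d_hom_Suc p, of j]
        have hd: "h j p * d (Suc j) p \<in> carrier_mat (rdim (P (Suc j)) p) (rdim (P (Suc j)) p)" using c by simp
        have one\<theta>: "1\<^sub>m (rdim (P (Suc j)) p) - \<theta> (Suc j) p \<in> carrier_mat (rdim (P (Suc j)) p) (rdim (P (Suc j)) p)"
          using c(2) by (rule minus_carrier_mat)
        have "f p - f p * \<theta> (Suc j) p - f p * (h j p * d (Suc j) p) = 
            f p * (1\<^sub>m (rdim (P (Suc j)) p) - \<theta> (Suc j) p - h j p * d (Suc j) p)"
          unfolding mult_minus_distrib_mat[OF c(1) one\<theta> hd] mult_minus_distrib_mat[OF c(1) one_carrier_mat c(2)]
          using c(1) by simp
        also have "\<dots> = 0\<^sub>m (rdim N p) (rdim (P (Suc j)) p)" using f_dh[OF p] h(3)[OF p, of j] Suc by simp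
        finally have *: "f p - f p * \<theta> (Suc j) p - f p * (h j p * d (Suc j) p) = 0\<^sub>m (rdim N p) (rdim (P (Suc j)) p)" .
        have "f p * \<theta> (Suc j) p = g p * (\<phi> j p * d (Suc j) p)"
          using f\<theta>[OF p] g(2)[OF p] Suc assoc_mult_mat[OF c(7,8,4)] \<phi>(3)[OF p, of j] by simp
        then have 1: "f p * \<theta> (Suc j) p = g p * \<phi> j p * d (Suc j) p" using assoc_mult_mat[OF c(7,3,6)] by simp
        have 2: "f p * (h j p * d (Suc j) p) = f p * h j p * d (Suc j) p" using assoc_mult_mat[OF c(1,5,6)] by simp
        have "f p - f p * \<theta> (Suc j) p = f p * h j p * d (Suc j) p"
          by (rule sub[OF *[unfolded 2]]) (use c in \<open>auto simp: minus_carrier_mat\<close>)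
        then have "f p - g p * \<phi> j p * d (Suc j) p = f p * h j p * d (Suc j) p" by (simp only: 1)
        then have "f p = g p * \<phi> j p * d (Suc j) p + f p * h j p * d (Suc j) p"
        proof -
          assume eq: "f p - g p * \<phi> j p * d (Suc j) p = f p * h j p * d (Suc j) p"
          have cc: "g p * \<phi> j p * d (Suc j) p \<in> carrier_mat (rdim N p) (rdim (P (Suc j)) p)"
            using c(7,3,6) by (meson mult_carrier_mat)
          show ?thesis unfolding eq[symmetric] by (rule eq_matI) (use cc c(1) in auto)
        qed
        then show ?thesis
          unfolding g'_def using add_mult_distrib_mat[OF mult_carrier_mat[OF c(7,3)] mult_carrier_mat[OF c(1,5)] c(6)] by simp
      qed
      ultimately show False using fnz Suc by auto
    qed
    then show ?thesis unfolding cohom_nonzero_def using f' f'e Suc by (intro exI[of _ f']) auto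
  qed
qed

section \<open>Homomorphisms between free modules\<close>

text \<open>Hom(A e_y, A e_z) is a line if \<open>y \<le> z\<close> and zero otherwise, so maps
  between free modules are matrices of scalars that are the same at every vertex.
  \<open>hom_bmat\<close> is the converse.\<close>

lemma bmat_hom:
  fixes c :: "'j \<Rightarrow> 'i \<Rightarrow> 'k::field"
  assumes L: "labels n L \<pi>" "labels n L' \<pi>'"
    and c: "\<And>a b. a \<in> set L' \<Longrightarrow> b \<in> set L \<Longrightarrow> c a b \<noteq> 0 \<Longrightarrow> bruhat_le n (\<pi> b) (\<pi>' a)"
  shows "is_hom n (free_rep n L \<pi>) (free_rep n L' \<pi>') (\<lambda>p. bmat (fb n L' \<pi>' p) (fb n L \<pi> p) c)"
  unfolding is_hom_def
proof (intro conjI ballI allI impI)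
  fix p q assume pq: "covers n p q"
  have d: "distinct (fb n L \<pi> y)" "distinct (fb n L' \<pi>' y)" for y
    using L by (simp_all add: distinct_fb labels_def)
  have "bmat (fb n L' \<pi>' q) (fb n L \<pi> q) c * bmat (fb n L \<pi> q) (fb n L \<pi> p) kron =
     bmat (fb n L' \<pi>' q) (fb n L \<pi> p) c"
    unfolding bmat_mult[OF d(1)] bmat_eq_iff
  proof (intro ballI)
    fix a e assume "e \<in> set (fb n L \<pi> p)"
    then have "e \<in> set (fb n L \<pi> q)" using covers_le[OF pq] bruhat_le_trans by auto
    then show "(\<Sum>b\<in>set (fb n L \<pi> q). c a b * (if b = e then 1 else 0)) = c a e"
      by (simp add: if_distrib[of "\<lambda>x. _ * x"] cong: if_cong)
  qed
  also have "\<dots> = bmat (fb n L' \<pi>' q) (fb n L' \<pi>' p) kron * bmat (fb n L' \<pi>' p) (fb n L \<pi> p) c"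
    unfolding bmat_mult[OF d(2)] bmat_eq_iff
  proof (intro ballI)
    fix a e assume a: "a \<in> set (fb n L' \<pi>' q)" and e: "e \<in> set (fb n L \<pi> p)"
    have "(\<Sum>b\<in>set (fb n L' \<pi>' p). (if a = b then 1 else 0) * c b e) = (if a \<in> set (fb n L' \<pi>' p) then c a e else 0)"
      by (simp add: if_distrib[of "\<lambda>x. x * _"] cong: if_cong)
    moreover have "c a e = 0" if "a \<notin> set (fb n L' \<pi>' p)"
      using c[of a e] a e that bruhat_le_trans by auto
    ultimately show "c a e = (\<Sum>b\<in>set (fb n L' \<pi>' p). (if a = b then 1 else 0) * c b e)" by auto
  qed
  finally show "bmat (fb n L' \<pi>' q) (fb n L \<pi> q) c * rmap (free_rep n L \<pi>) p q =
    rmap (free_rep n L' \<pi>') p q * bmat (fb n L' \<pi>' p) (fb n L \<pi> p) c" by simp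
qed simp

lemma hom_bmat:
  fixes f :: "perm \<Rightarrow> 'k::field mat" and L :: "'i list" and L' :: "'j list"
  assumes L: "labels n L \<pi>" "labels n L' \<pi>'" and f: "is_hom n (free_rep n L \<pi>) (free_rep n L' \<pi>') f"
  obtains c where "\<And>a b. c a b \<noteq> 0 \<Longrightarrow> a \<in> set L' \<and> b \<in> set L \<and> bruhat_le n (\<pi> b) (\<pi>' a)"
    "\<And>p. p \<in> Sym n \<Longrightarrow> f p = bmat (fb n L' \<pi>' p) (fb n L \<pi> p) c"
proof -
  interpret L: labels n L \<pi> by (rule L(1))
  interpret L': labels n L' \<pi>' by (rule L(2))
  have "\<exists>x. f (\<pi> b) *\<^sub>v L.gen b = bvec (fb n L' \<pi>' (\<pi> b)) x" if b: "b \<in> set L" for b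
  proof -
    have "f (\<pi> b) *\<^sub>v L.gen b \<in> carrier_vec (length (fb n L' \<pi>' (\<pi> b)))"
      using mult_mat_vec_carrier[OF hom_carrier[OF f L.labels_Sym[OF b]], of "L.gen b"] by simp
    then show ?thesis using bvec_exhaust[OF distinct_fb[OF L'.distinct_labels]] by metis
  qed
  then obtain x where x: "\<And>b. b \<in> set L \<Longrightarrow> f (\<pi> b) *\<^sub>v L.gen b = bvec (fb n L' \<pi>' (\<pi> b)) (x b)" by metis
  \<comment> \<open>Zero outside the admissible pairs: those entries are visible at no vertex, and
    the value 0 gives the support condition globally.\<close>
  define c where "c a b = (if a \<in> set L' \<and> b \<in> set L \<and> bruhat_le n (\<pi> b) (\<pi>' a) then x b a else 0)" for a b
  have c: "c a b \<noteq> 0 \<Longrightarrow> a \<in> set L' \<and> b \<in> set L \<and> bruhat_le n (\<pi> b) (\<pi>' a)" for a b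
    by (simp add: c_def split: if_splits)
  have g: "is_hom n (free_rep n L \<pi>) (free_rep n L' \<pi>') (\<lambda>p. bmat (fb n L' \<pi>' p) (fb n L \<pi> p) c)"
    by (rule bmat_hom[OF L]) (use c in blast)
  have "f p = bmat (fb n L' \<pi>' p) (fb n L \<pi> p) c" if p: "p \<in> Sym n" for p
  proof (rule L.F_hom_ext[OF L'.F_module f g _ p])
    fix b assume b: "b \<in> set L"
    have "bmat (fb n L' \<pi>' (\<pi> b)) (fb n L \<pi> (\<pi> b)) c *\<^sub>v L.gen b = bvec (fb n L' \<pi>' (\<pi> b)) (x b)"
      unfolding bmat_mult_vec[OF distinct_fb[OF L.distinct_labels]] bvec_eq_iff
    proof
      fix a assume "a \<in> set (fb n L' \<pi>' (\<pi> b))"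
      then show "(\<Sum>e\<in>set (fb n L \<pi> (\<pi> b)). c a e * (if e = b then 1 else 0)) = x b a"
        using b bruhat_le_refl[OF L.labels_Sym[OF b]]
        by (simp add: if_distrib[of "\<lambda>x. _ * x"] c_def cong: if_cong)
    qed
    then show "f (\<pi> b) *\<^sub>v L.gen b = bmat (fb n L' \<pi>' (\<pi> b)) (fb n L \<pi> (\<pi> b)) c *\<^sub>v L.gen b"
      using x[OF b] by simp
  qed
  with c show ?thesis by (rule that)
qed

section \<open>The resolution of a simple module attached to a reduced word\<close>

lemma mat_eq_empty: "A \<in> carrier_mat r c \<Longrightarrow> B \<in> carrier_mat r c \<Longrightarrow> r = 0 \<or> c = 0 \<Longrightarrow> A = B"
  by (rule eq_matI) auto

locale reduced_word =
  fixes n :: nat and ws :: "nat list"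
  assumes red: "reduced n ws"
begin

abbreviation "m \<equiv> length ws"

text \<open>Degree i omits i letters. With a sum in place of a truncated subtraction, degrees above
  the length of the word are empty.\<close>

definition idx :: "nat \<Rightarrow> bool list list" where
  "idx i = filter (\<lambda>I. wt I + i = m) (List.n_lists m [True, False])"

lemma set_idx: "I \<in> set (idx i) \<longleftrightarrow> I \<in> cube m \<and> wt I + i = m"
  by (auto simp: idx_def set_n_lists cube_def)

lemma labels_idx: "labels n (idx i) (dem n ws)"
proof
  show "distinct (idx i)" by (simp add: idx_def distinct_n_lists)
  show "dem n ws I \<in> Sym n" for I by (rule dem_Sym[OF reduced_subset[OF red]])
qed

abbreviation B :: "nat \<Rightarrow> perm \<Rightarrow> bool list list" where
  "B i p \<equiv> fb n (idx i) (dem n ws) p"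

definition R :: "nat \<Rightarrow> 'k::field rep" where
  "R i = free_rep n (idx i) (dem n ws)"

text \<open>\<open>B 0 p\<close> has at most one element, so the row of ones is the projection of A
  e_w onto L_w.\<close>

definition dR :: "nat \<Rightarrow> perm \<Rightarrow> 'k::field mat" where
  "dR i p = (case i of 0 \<Rightarrow> mat (if p = wprod ws then 1 else 0) (length (B 0 p)) (\<lambda>_. 1)
     | Suc j \<Rightarrow> bmat (B j p) (B (Suc j) p) cf)"

lemma distinct_B: "distinct (B i p)"
  using labels_idx by (intro distinct_fb) (simp add: labels_def)

lemma set_B: "I \<in> set (B i p) \<longleftrightarrow> I \<in> cube m \<and> wt I + i = m \<and> bruhat_le n p (dem n ws I)"
  by (auto simp: set_idx)

lemma B_0: "B 0 p = (if bruhat_le n p (wprod ws) then [replicate m True] else [])"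
proof -
  have 1: "I \<in> set (idx 0) \<longleftrightarrow> I = replicate m True" for I
    using wt_eq_length[of I] wt_eq_length[of "replicate m True"] by (auto simp: set_idx cube_def)
  then have s: "set (idx 0) = {replicate m True}" by auto
  have "distinct (idx 0)" using labels_idx by (simp add: labels_def)
  then have "idx 0 = [replicate m True]" using s
    by (metis (no_types, lifting) One_nat_def card.empty card.insert distinct_card empty_iff finite.emptyI length_0_conv
        length_Suc_conv list.set_intros(1) singletonD)
  then show ?thesis by (simp add: fb_def dem_replicate_True[OF red] del: replicate.simps)
qed

text \<open>At the vertex w only the full subword survives and is matched with L_w. This is the
  vertex which \<open>coboundary_exact\<close> leaves out.\<close>

lemma B_wprod: "i > 0 \<Longrightarrow> B i (wprod ws) = []"
proof -
  assume i: "i > 0"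
  have "I \<notin> set (B i (wprod ws))" for I
  proof
    assume "I \<in> set (B i (wprod ws))"
    then have I: "length I = m" "wt I + i = m" "bruhat_le n (wprod ws) (dem n ws I)"
      unfolding set_B by (auto simp: cube_def)
    then have "I = replicate m True" using wprod_le_dem_iff[OF red] by blast
    then show False using I i wt_eq_length[of I] by simp
  qed
  then show ?thesis by (metis list.set_intros(1) neq_Nil_conv)
qed

lemma R_projective: "is_projective n (R i :: 'k::field rep)"
  unfolding R_def by (rule labels.F_projective[OF labels_idx])

lemma R_rdim: "rdim (R i) p = length (B i p)"
  by (simp add: R_def)

lemma dR_hom: "is_hom n (R (Suc i)) (R i) (dR (Suc i) :: perm \<Rightarrow> 'k::field mat)"
  unfolding R_def dR_def nat.case
proof (rule bmat_hom[OF labels_idx labels_idx])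
  fix K I assume "I \<in> set (idx (Suc i))" "cf K I \<noteq> (0::'k)"
  then show "bruhat_le n (dem n ws I) (dem n ws K)"
    using cf_dem[OF reduced_subset[OF red]] by (auto simp: set_idx cube_def)
qed

lemma simple_module_simps [simp]:
  "rdim (simple_module n w) p = (if p = w then 1 else 0)"
  "rmap (simple_module n w) p q = 0\<^sub>m (if q = w then 1 else 0) (if p = w then 1 else 0)"
  by (simp_all add: simple_module_def)

lemma dR_0_hom: "is_hom n (R 0) (simple_module n (wprod ws)) (dR 0 :: perm \<Rightarrow> 'k::field mat)"
  unfolding is_hom_def
proof (intro conjI ballI allI impI)
  fix p show "(dR 0 p :: 'k mat) \<in> carrier_mat (rdim (simple_module n (wprod ws) :: 'k rep) p) (rdim (R 0 :: 'k rep) p)"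
    by (simp add: dR_def R_rdim)
next
  fix p q assume pq: "covers n p q"
  let ?S = "simple_module n (wprod ws) :: 'k rep"
  have 1: "(dR 0 q :: 'k mat) * rmap (R 0) p q \<in> carrier_mat (rdim ?S q) (length (B 0 p))"
    by (rule mult_carrier_mat[of _ _ "length (B 0 q)"]) (simp_all add: dR_def R_def)
  have 2: "rmap ?S p q * (dR 0 p :: 'k mat) \<in> carrier_mat (rdim ?S q) (length (B 0 p))"
    by (rule mult_carrier_mat[of _ _ "rdim ?S p"]) (simp_all add: dR_def)
  \<comment> \<open>L_w lives only at w, and A e_w vanishes at any p covering w, so both sides are
    matrices with an empty side.\<close>
  have "rdim ?S q = 0 \<or> length (B 0 p) = 0"
  proof (cases "q = wprod ws")
    case True
    then have "\<not> bruhat_le n p (wprod ws)"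
      using covers_le[OF pq] covers_clen[OF pq] bruhat_le_clen[of n p q] by auto
    then show ?thesis by (simp add: B_0)
  qed simp
  then show "(dR 0 q :: 'k mat) * rmap (R 0) p q = rmap ?S p q * dR 0 p"
    by (rule mat_eq_empty[OF 1 2])
qed

lemma dR_0_wprod: "dR 0 (wprod ws) = (1\<^sub>m 1 :: 'k::field mat)"
  using bruhat_le_refl[OF reduced_Sym[OF red]] by (intro eq_matI) (auto simp: dR_def B_0)

lemma dR_0_surj: "hom_surj n (R 0) (simple_module n (wprod ws)) (dR 0 :: perm \<Rightarrow> 'k::field mat)"
  unfolding hom_surj_def
proof (intro ballI)
  fix p and v :: "'k vec" assume p: "p \<in> Sym n" and v: "v \<in> carrier_vec (rdim (simple_module n (wprod ws) :: 'k rep) p)"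
  show "\<exists>u\<in>carrier_vec (rdim (R 0 :: 'k rep) p). dR 0 p *\<^sub>v u = v"
  proof (cases "p = wprod ws")
    case True
    then have "v \<in> carrier_vec 1" "rdim (R 0 :: 'k rep) p = 1"
      using v bruhat_le_refl[OF reduced_Sym[OF red]] by (auto simp: R_rdim B_0)
    then show ?thesis using True dR_0_wprod[where ?'k = 'k] by (intro bexI[of _ v]) auto
  next
    case False
    then have "dR 0 p *\<^sub>v 0\<^sub>v (rdim (R 0 :: 'k rep) p) = v" using v by (intro eq_vecI) (auto simp: dR_def)
    then show ?thesis by (intro bexI[of _ "0\<^sub>v (rdim (R 0 :: 'k rep) p)"]) auto
  qed
qed

lemma dR_mult_vec:
  fixes g :: "bool list \<Rightarrow> 'k::field"
  assumes "\<And>I. I \<in> cube m \<Longrightarrow> g I \<noteq> 0 \<Longrightarrow> I \<in> set (B (Suc i) p)"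
  shows "dR (Suc i) p *\<^sub>v bvec (B (Suc i) p) g = bvec (B i p) (coboundary m g)"
proof -
  have "(\<Sum>I\<in>set (B (Suc i) p). cf K I * g I) = coboundary m g K" for K
    unfolding coboundary_def using assms by (intro sum.mono_neutral_left) (auto simp: set_idx)
  then show ?thesis by (simp add: dR_def bmat_mult_vec[OF distinct_B])
qed

lemma dR_dR_vec:
  fixes g :: "bool list \<Rightarrow> 'k::field"
  shows "dR (Suc i) p *\<^sub>v (dR (Suc (Suc i)) p *\<^sub>v bvec (B (Suc (Suc i)) p) g) = 0\<^sub>v (length (B i p))"
proof -
  have "(\<Sum>J\<in>set (B (Suc i) p). cf K J * (\<Sum>I\<in>set (B (Suc (Suc i)) p). cf J I * g I)) = 0"
    if K: "K \<in> set (B i p)" for K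
  proof -
    have "(\<Sum>J\<in>set (B (Suc i) p). cf K J * (\<Sum>I\<in>set (B (Suc (Suc i)) p). cf J I * g I)) =
        (\<Sum>I\<in>set (B (Suc (Suc i)) p). (\<Sum>J\<in>set (B (Suc i) p). cf K J * cf J I) * g I)"
      unfolding sum_distrib_left sum_distrib_right by (subst sum.swap) (simp add: mult.assoc)
    also have "\<dots> = 0"
    proof (intro sum.neutral ballI)
      fix I assume I: "I \<in> set (B (Suc (Suc i)) p)"
      have "(\<Sum>J\<in>set (B (Suc i) p). cf K J * cf J I) = (\<Sum>J\<in>cube m. cf K J * cf J I :: 'k)"
      proof (rule sum.mono_neutral_left)
        show "\<forall>J\<in>cube m - set (B (Suc i) p). cf K J * cf J I = (0::'k)"
        proof
          fix J assume J: "J \<in> cube m - set (B (Suc i) p)"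
          have "J \<in> set (B (Suc i) p)" if nz: "cf J I \<noteq> (0::'k)"
          proof -
            have "wt J = Suc (wt I)" using cf_nonzero[OF nz] by simp
            moreover have "bruhat_le n (dem n ws I) (dem n ws J)"
              using cf_dem[OF reduced_subset[OF red] nz] I unfolding set_B by (simp add: cube_def)
            ultimately show ?thesis using I J bruhat_le_trans unfolding set_B by auto
          qed
          then show "cf K J * cf J I = (0::'k)" using J by auto
        qed
      qed (auto simp: set_idx)
      also have "\<dots> = 0" using K I cf_cf unfolding set_B by blast
      finally show "(\<Sum>J\<in>set (B (Suc i) p). cf K J * cf J I) * g I = 0" by simp
    qed
    finally show ?thesis .
  qed
  then have "bvec (B i p) (\<lambda>K. \<Sum>J\<in>set (B (Suc i) p). cf K J * (\<Sum>I\<in>set (B (Suc (Suc i)) p). cf J I * g I)) =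
      bvec (B i p) (\<lambda>_. 0)" unfolding bvec_eq_iff by blast
  then show ?thesis by (simp only: dR_def nat.case bmat_mult_vec[OF distinct_B] bvec_zero)
qed

lemma dR_exact:
  "exact_at n (R (Suc i)) (R i) (if i = 0 then simple_module n (wprod ws) else R (i - 1))
    (dR (Suc i)) (dR i :: perm \<Rightarrow> 'k::field mat)"
  unfolding exact_at_def
proof (intro ballI)
  let ?K = "if i = 0 then simple_module n (wprod ws) else R (i - 1) :: 'k rep"
  fix p and v :: "'k vec" assume p: "p \<in> Sym n" and v: "v \<in> carrier_vec (rdim (R i :: 'k rep) p)"
  have v': "v \<in> carrier_vec (length (B i p))" using v by (simp add: R_rdim)
  obtain f0 where f0: "v = bvec (B i p) f0" using bvec_exhaust[OF distinct_B v'] .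
  define f where "f I = (if I \<in> set (B i p) then f0 I else 0)" for I
  have vf: "v = bvec (B i p) f" unfolding f0 bvec_eq_iff by (simp add: f_def)
  have fB: "I \<in> set (B i p)" if "f I \<noteq> 0" for I using that by (auto simp: f_def split: if_splits)
  show "dR i p *\<^sub>v v = 0\<^sub>v (rdim ?K p) \<longleftrightarrow> (\<exists>u\<in>carrier_vec (rdim (R (Suc i) :: 'k rep) p). v = dR (Suc i) p *\<^sub>v u)"
  proof
    assume dv: "dR i p *\<^sub>v v = 0\<^sub>v (rdim ?K p)"
    have "\<exists>g. (\<forall>I\<in>cube m. g I \<noteq> 0 \<longrightarrow> I \<in> set (B (Suc i) p)) \<and> (\<forall>K\<in>set (B i p). coboundary m g K = f K)"
    proof (cases "p = wprod ws")
      case True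
      have "f K = 0" if "K \<in> set (B i p)" for K
      proof (cases i)
        case 0
        have "v \<in> carrier_vec 1" using v' True 0 bruhat_le_refl[OF p] by (simp add: B_0)
        then have "v = 0\<^sub>v 1" using dv True 0 dR_0_wprod[where ?'k = 'k] by simp
        then have "bvec (B i p) f = bvec (B i p) (\<lambda>_. 0)"
          using vf True 0 bruhat_le_refl[OF p] bvec_zero[where ?'a = 'k, of "B i p"] by (simp add: B_0)
        then show ?thesis using that unfolding bvec_eq_iff by blast
      next
        case (Suc j)
        then have "B i p = []" using True B_wprod[of i] by simp
        from that[unfolded this] show ?thesis by simp
      qed
      then show ?thesis by (intro exI[of _ "\<lambda>_. 0"]) (simp add: coboundary_0)
    next
      case False
      \<comment> \<open>The hypothesis on v concerns only labels of degree i - 1 above p. Any other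
        K has coboundary zero, since a subword contributing to it forces its weight and its position
        above p; for i = 0 that weight would exceed m.\<close>
      have cyc: "coboundary m f K = 0" if K: "K \<in> cube m" for K
      proof (rule ccontr)
        assume nz: "coboundary m f K \<noteq> 0"
        then obtain I where "I \<in> cube m" "cf K I * f I \<noteq> 0"
          unfolding coboundary_def by (meson sum.neutral)
        then have I: "cf K I \<noteq> (0::'k)" "I \<in> set (B i p)" using fB by auto
        then have ct: "wt K = Suc (wt I)" and le: "bruhat_le n (dem n ws I) (dem n ws K)"
          using cf_nonzero cf_dem[OF reduced_subset[OF red] I(1)] unfolding set_B by (auto simp: cube_def)
        show False
        proof (cases i)
          case 0
          then show ?thesis using ct I(2) K wt_le[of K] unfolding set_B by (simp add: cube_def)
        next
          case (Suc j)
          have KB: "K \<in> set (B j p)" using K ct le I(2) Suc bruhat_le_trans unfolding set_B by auto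
          have "bvec (B j p) (coboundary m f) = bvec (B j p) (\<lambda>_. 0)"
            using dv dR_mult_vec[of f j p] fB vf Suc by (simp add: R_rdim bvec_zero)
          then show ?thesis using KB nz unfolding bvec_eq_iff by blast
        qed
      qed
      have sp: "bruhat_le n p (dem n ws K) \<and> wt K = m - i" if "f K \<noteq> 0" for K
        using fB[OF that] unfolding set_B by auto
      have "\<exists>g. (\<forall>I. g I \<noteq> 0 \<longrightarrow> I \<in> cube m \<and> bruhat_le n p (dem n ws I) \<and> Suc (wt I) = m - i) \<and>
          (\<forall>K\<in>cube m. coboundary m g K = f K)"
        by (rule coboundary_exact_graded[OF red p False sp cyc])
      then obtain g where "(\<forall>I. g I \<noteq> 0 \<longrightarrow> I \<in> cube m \<and> bruhat_le n p (dem n ws I) \<and> Suc (wt I) = m - i) \<and>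
          (\<forall>K\<in>cube m. coboundary m g K = f K)" by (rule exE)
      note g = conjunct1[OF this] conjunct2[OF this]
      have "I \<in> set (B (Suc i) p)" if "g I \<noteq> 0" for I
        using g(1)[rule_format, OF that] unfolding set_B by auto
      moreover have "coboundary m g K = f K" if "K \<in> set (B i p)" for K
        using g(2) that unfolding set_B by simp
      ultimately show ?thesis by blast
    qed
    then obtain g where g: "\<And>I. I \<in> cube m \<Longrightarrow> g I \<noteq> 0 \<Longrightarrow> I \<in> set (B (Suc i) p)" "\<forall>K\<in>set (B i p). coboundary m g K = f K"
      by blast
    have "v = dR (Suc i) p *\<^sub>v bvec (B (Suc i) p) g"
    proof -
      have "dR (Suc i) p *\<^sub>v bvec (B (Suc i) p) g = bvec (B i p) (coboundary m g)"
        by (rule dR_mult_vec[OF g(1)])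
      also have "\<dots> = v" unfolding vf bvec_eq_iff by (rule g(2))
      finally show ?thesis by (rule sym)
    qed
    then show "\<exists>u\<in>carrier_vec (rdim (R (Suc i) :: 'k rep) p). v = dR (Suc i) p *\<^sub>v u"
      by (intro bexI[of _ "bvec (B (Suc i) p) g"]) (simp_all add: R_rdim)
  next
    assume "\<exists>u\<in>carrier_vec (rdim (R (Suc i) :: 'k rep) p). v = dR (Suc i) p *\<^sub>v u"
    then obtain u where u: "u \<in> carrier_vec (length (B (Suc i) p))" "v = dR (Suc i) p *\<^sub>v u" by (auto simp: R_rdim)
    obtain g where g: "u = bvec (B (Suc i) p) g" using bvec_exhaust[OF distinct_B u(1)] .
    show "dR i p *\<^sub>v v = 0\<^sub>v (rdim ?K p)"
    proof (cases i)
      case (Suc j)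
      then show ?thesis using dR_dR_vec[of j p g] u g by (simp add: R_rdim)
    next
      case 0
      show ?thesis
      proof (cases "p = wprod ws")
        case True
        have "v = bvec (B 0 p) (\<lambda>_. 0)"
          unfolding u g 0 using True B_wprod[of 1] by (simp add: dR_def bmat_mult_vec)
        then have "v = 0\<^sub>v 1" using bvec_zero[where ?'a = 'k, of "B 0 p"] True bruhat_le_refl[OF p] by (simp add: B_0)
        then show ?thesis using 0 True dR_0_wprod[where ?'k = 'k] by simp
      next
        case False
        then show ?thesis using 0 by (intro eq_vecI) (auto simp: dR_def)
      qed
    qed
  qed
qed

lemma R_resolution: "proj_resolution n (simple_module n (wprod ws)) (R :: nat \<Rightarrow> 'k::field rep) dR"
  unfolding proj_resolution_def using R_projective dR_0_hom dR_0_surj dR_hom dR_exact by blast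

lemma R_zero: "i > m \<Longrightarrow> zero_module n (R i)"
proof -
  assume "i > m"
  then have "B i p = []" for p using set_B[of _ i p] by (metis add_leD2 linorder_not_le list.set_intros(1) neq_Nil_conv nle_le)
  then show ?thesis by (simp add: zero_module_def R_rdim)
qed

end

text \<open>Arrows lower the length, so a path with equal ends is trivial. A path with distinct ends
  has one end different from w, and its matrix has an empty side.\<close>

lemma simple_module_module:
  assumes "w \<in> Sym n"
  shows "is_module n (simple_module n w :: 'k::field rep)"
proof -
  let ?S = "simple_module n w :: 'k rep"
  have S: "rdim ?S p = (if p = w then 1 else 0)"
    "rmap ?S p q = 0\<^sub>m (if q = w then 1 else 0) (if p = w then 1 else 0)" for p q
    by (simp_all add: simple_module_def)
  have c: "path_map ?S ps \<in> carrier_mat (rdim ?S (last ps)) (rdim ?S (hd ps))" if "is_path n ps" for ps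
    using that
  proof (induction ps rule: induct_list012)
    case (3 p q r)
    then have "path_map ?S (q # r) \<in> carrier_mat (rdim ?S (last (q # r))) (rdim ?S q)"
      "rmap ?S p q \<in> carrier_mat (rdim ?S q) (rdim ?S p)" by (auto simp: S)
    then show ?case by simp
  qed auto
  have triv: "ps = [p]" if P: "is_path n ps" "hd ps = p" "last ps = p" for ps p
  proof -
    obtain qs where ps: "ps = p # qs" using P by (cases ps) auto
    show ?thesis
    proof (cases qs)
      case (Cons q r)
      then have "bruhat_le n (last (q # r)) q" "clen n q < clen n p"
        using path_le[of n "q # r"] covers_clen P(1) ps by auto
      then show ?thesis using P(3) ps Cons bruhat_le_clen[of n p q] by auto
    qed (simp add: ps)
  qed
  have par: "path_map ?S ps = path_map ?S qs" if "is_path n ps" "is_path n qs" "hd ps = hd qs" "last ps = last qs" for ps qs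
  proof (cases "hd ps = last ps")
    case True
    define p where "p = hd ps"
    have "ps = [p]" by (rule triv[OF that(1)]) (simp_all add: p_def True)
    moreover have "qs = [p]" by (rule triv[OF that(2)]) (use that True in \<open>simp_all add: p_def\<close>)
    ultimately show ?thesis by (simp only:)
  next
    case False
    have "path_map ?S ps \<in> carrier_mat (rdim ?S (last ps)) (rdim ?S (hd ps))"
      "path_map ?S qs \<in> carrier_mat (rdim ?S (last ps)) (rdim ?S (hd ps))"
      using c[OF that(1)] c[OF that(2)] that by auto
    then show ?thesis by (rule mat_eq_empty) (use False in \<open>auto simp: S\<close>)
  qed
  show ?thesis
    unfolding is_module_def by (intro conjI allI impI par) (simp_all only: S zero_carrier_mat)
qed

section \<open>Ext into free modules as homology of subwords\<close>

context reduced_word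
begin

text \<open>Cochains are kept as coefficient families on the whole cube, one row per target label,
  so that sums over the bases at a vertex can be enlarged to sums over the cube.\<close>

definition supported :: "'j set \<Rightarrow> ('j \<Rightarrow> perm) \<Rightarrow> nat \<Rightarrow> ('j \<Rightarrow> bool list \<Rightarrow> 'k::field) \<Rightarrow> bool" where
  "supported A \<pi>' i c \<longleftrightarrow> (\<forall>a\<in>A. \<forall>I\<in>cube m. c a I \<noteq> 0 \<longrightarrow> I \<in> set (idx i) \<and> bruhat_le n (dem n ws I) (\<pi>' a))"

lemma supportedD: "supported A \<pi>' i c \<Longrightarrow> a \<in> A \<Longrightarrow> I \<in> cube m \<Longrightarrow> c a I \<noteq> 0 \<Longrightarrow> I \<in> set (idx i) \<and> bruhat_le n (dem n ws I) (\<pi>' a)"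
  by (simp add: supported_def)

lemma supported_boundary:
  fixes c :: "'j \<Rightarrow> bool list \<Rightarrow> 'k::field"
  assumes c: "supported A \<pi>' i c"
  shows "supported A \<pi>' (Suc i) (\<lambda>a. boundary m (c a))"
  unfolding supported_def
proof (intro ballI impI)
  fix a I assume a: "a \<in> A" and I: "I \<in> cube m" and nz: "boundary m (c a) I \<noteq> 0"
  from nz obtain K where K: "K \<in> cube m" "cf K I * c a K \<noteq> 0" unfolding boundary_def by (meson sum.neutral)
  then have nz: "cf K I \<noteq> (0::'k)" "c a K \<noteq> 0" by auto
  note s = supportedD[OF c a K(1) nz(2)]
  have "bruhat_le n (dem n ws I) (dem n ws K)"
    using cf_dem[OF reduced_subset[OF red] nz(1)] I by (simp add: cube_def)
  then show "I \<in> set (idx (Suc i)) \<and> bruhat_le n (dem n ws I) (\<pi>' a)"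
    using s cf_nonzero[OF nz(1)] I bruhat_le_trans unfolding set_idx by auto
qed

text \<open>Composing with the differential on the right transposes its matrix, so every row
  undergoes \<open>boundary\<close>. The support condition lets the sum run over the cube: a row
  entry above a basis element at p is itself a basis element at p.\<close>

lemma bmat_dR:
  fixes c :: "'j \<Rightarrow> bool list \<Rightarrow> 'k::field"
  assumes c: "supported (set L') \<pi>' i c"
  shows "bmat (fb n L' \<pi>' p) (B i p) c * dR (Suc i) p =
    bmat (fb n L' \<pi>' p) (B (Suc i) p) (\<lambda>a. boundary m (c a))"
  unfolding dR_def nat.case bmat_mult[OF distinct_B] bmat_eq_iff
proof (intro ballI)
  fix a e assume a: "a \<in> set (fb n L' \<pi>' p)" and e: "e \<in> set (B (Suc i) p)"
  have "(\<Sum>b\<in>set (B i p). c a b * cf b e) = (\<Sum>b\<in>cube m. c a b * cf b e)"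
  proof (rule sum.mono_neutral_left)
    show "\<forall>b\<in>cube m - set (B i p). c a b * cf b e = 0"
    proof
      fix b assume b: "b \<in> cube m - set (B i p)"
      have "b \<in> set (B i p)" if nz: "c a b \<noteq> 0" "cf b e \<noteq> (0::'k)"
      proof -
        have "bruhat_le n (dem n ws e) (dem n ws b)"
          using cf_dem[OF reduced_subset[OF red] nz(2)] e unfolding set_B by (simp add: cube_def)
        then show ?thesis using supportedD[OF c _ _ nz(1)] a b e bruhat_le_trans unfolding set_B set_idx by auto
      qed
      then show "c a b * cf b e = 0" using b by auto
    qed
  qed (auto simp: set_idx)
  then show "(\<Sum>b\<in>set (B i p). c a b * cf b e) = boundary m (c a) e"
    by (simp add: boundary_def mult.commute)
qed

text \<open>The coefficient of I in row a can be read off at the vertex \<open>dem n ws I\<close>,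
  where I is present and a is present whenever the coefficient is nonzero.\<close>

lemma supported_eqI:
  fixes u v :: "'j \<Rightarrow> bool list \<Rightarrow> 'k::field"
  assumes u: "supported (set L') \<pi>' k u" and v: "supported (set L') \<pi>' k v"
    and eq: "\<And>p. p \<in> Sym n \<Longrightarrow> bmat (fb n L' \<pi>' p) (B k p) u = bmat (fb n L' \<pi>' p) (B k p) v"
    and a: "a \<in> set L'" and I: "I \<in> cube m"
  shows "u a I = v a I"
proof (cases "u a I = 0 \<and> v a I = 0")
  case False
  then have s: "I \<in> set (idx k) \<and> bruhat_le n (dem n ws I) (\<pi>' a)"
    using supportedD[OF u a I] supportedD[OF v a I] by blast
  then have S: "dem n ws I \<in> Sym n" using bruhat_le_Sym by blast
  show ?thesis using eq[OF S] s a bruhat_le_refl[OF S] unfolding bmat_eq_iff by auto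
qed simp

text \<open>Rows of a cocycle are cycles, one for each target label. If each of them bounds, the
  bounding chains, chosen row by row, assemble to a cochain whose coboundary is the given
  one.\<close>

lemma cohom_imp_homology:
  assumes L': "labels n L' \<pi>'" and i: "i \<le> m"
    and nz: "cohom_nonzero n R dR (free_rep n L' \<pi>' :: 'k::field rep) i"
  shows "\<exists>x\<in>set L'. homology_nonzero TYPE('k) n ws (\<pi>' x) (m - i)"
proof (rule ccontr)
  assume none: "\<not> ?thesis"
  let ?N = "free_rep n L' \<pi>' :: 'k rep"
  obtain f where f: "is_hom n (R i) ?N f" and fd: "\<And>p. p \<in> Sym n \<Longrightarrow> f p * dR (Suc i) p = 0\<^sub>m (rdim ?N p) (rdim (R (Suc i) :: 'k rep) p)"
    and fnz: "case i of 0 \<Rightarrow> \<not> (\<forall>p \<in> Sym n. f p = 0\<^sub>m (rdim ?N p) (rdim (R 0 :: 'k rep) p))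
      | Suc j \<Rightarrow> \<not> (\<exists>g. is_hom n (R j) ?N g \<and> (\<forall>p \<in> Sym n. f p = g p * dR (Suc j) p))"
    using nz unfolding cohom_nonzero_def by blast
  obtain c where c: "\<And>a b. c a b \<noteq> 0 \<Longrightarrow> a \<in> set L' \<and> b \<in> set (idx i) \<and> bruhat_le n (dem n ws b) (\<pi>' a)"
    "\<And>p. p \<in> Sym n \<Longrightarrow> f p = bmat (fb n L' \<pi>' p) (B i p) c"
    using hom_bmat[OF labels_idx L' f[unfolded R_def]] by blast
  have cs: "supported (set L') \<pi>' i c" unfolding supported_def using c(1) by blast
  have cyc: "boundary m (c a) I = 0" if "a \<in> set L'" "I \<in> cube m" for a I
  proof (rule supported_eqI[OF supported_boundary[OF cs] _ _ that, of "\<lambda>_ _. 0"])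
    show "supported (set L') \<pi>' (Suc i) (\<lambda>_ _. 0::'k)" by (simp add: supported_def)
    fix p assume p: "p \<in> Sym n"
    show "bmat (fb n L' \<pi>' p) (B (Suc i) p) (\<lambda>a. boundary m (c a)) = bmat (fb n L' \<pi>' p) (B (Suc i) p) (\<lambda>_ _. 0)"
      using fd[OF p] unfolding c(2)[OF p] bmat_dR[OF cs] by (simp add: R_rdim bmat_zero)
  qed
  have "\<exists>b. chain n ws (\<pi>' a) (Suc (m - i)) b \<and>
      (\<forall>I\<in>cube m. boundary m b I = c a I)" if a: "a \<in> set L'" for a
  proof (rule ccontr)
    assume nb: "\<not> ?thesis"
    have "homology_nonzero TYPE('k) n ws (\<pi>' a) (m - i)"
      unfolding homology_nonzero_def
    proof (intro exI[of _ "c a"] conjI allI impI ballI)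
      fix I assume "c a I \<noteq> 0"
      note s = c(1)[OF this]
      show "I \<in> cube m" "bruhat_le n (dem n ws I) (\<pi>' a)" "wt I = m - i"
        using s unfolding set_idx by auto
    qed (use cyc[OF a] nb in auto)
    then show False using none a by blast
  qed
  then have "\<forall>a. \<exists>b. a \<in> set L' \<longrightarrow> chain n ws (\<pi>' a) (Suc (m - i)) b \<and>
      (\<forall>I\<in>cube m. boundary m b I = c a I)" by blast
  from choice[OF this] obtain b where b: "\<forall>a. a \<in> set L' \<longrightarrow> chain n ws (\<pi>' a) (Suc (m - i)) (b a) \<and>
      (\<forall>I\<in>cube m. boundary m (b a) I = c a I)" by (rule exE)
  have b1: "K \<in> cube m \<and> bruhat_le n (dem n ws K) (\<pi>' a) \<and> wt K = Suc (m - i)" if "a \<in> set L'" "b a K \<noteq> 0" for a K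
    using b that by simp
  have b2: "boundary m (b a) I = c a I" if "a \<in> set L'" "I \<in> cube m" for a I
    using b that by simp
  show False
  proof (cases i)
    case 0
    \<comment> \<open>In degree 0 a nonzero class is a nonzero map. A bounding chain would select m
      + 1 letters out of m, so it is zero and forces the cocycle to vanish.\<close>
    have "c a I = 0" if "a \<in> set L'" "I \<in> cube m" for a I
    proof -
      have "b a K = 0" for K
      proof (rule ccontr)
        assume "b a K \<noteq> 0"
        from b1[OF that(1) this] show False using 0 wt_le[of K] by (simp add: cube_def)
      qed
      then show ?thesis using b2[OF that] by (simp add: boundary_def)
    qed
    then have "f p = 0\<^sub>m (rdim ?N p) (rdim (R 0 :: 'k rep) p)" if "p \<in> Sym n" for p
      using that 0 by (simp add: c(2) R_rdim bmat_zero bmat_eq_iff set_idx)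
    then show False using fnz 0 by simp
  next
    case (Suc j)
    have bs: "supported (set L') \<pi>' j b"
      unfolding supported_def set_idx
    proof (intro ballI impI)
      fix a K assume "a \<in> set L'" "b a K \<noteq> 0"
      from b1[OF this] show "(K \<in> cube m \<and> wt K + j = m) \<and> bruhat_le n (dem n ws K) (\<pi>' a)"
        using Suc i by auto
    qed
    let ?g = "\<lambda>p. bmat (fb n L' \<pi>' p) (B j p) b"
    have "is_hom n (R j) ?N ?g" unfolding R_def
    proof (rule bmat_hom[OF labels_idx L'])
      fix a K assume "a \<in> set L'" "K \<in> set (idx j)" "b a K \<noteq> 0"
      then show "bruhat_le n (dem n ws K) (\<pi>' a)" using b1 by blast
    qed
    moreover have "f p = ?g p * dR (Suc j) p" if "p \<in> Sym n" for p
      unfolding c(2)[OF that] bmat_dR[OF bs] bmat_eq_iff Suc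
      using b2 by (simp add: set_idx)
    ultimately show False using fnz Suc by auto
  qed
qed

text \<open>The cycle is placed in the row of x, with zeros in all other rows; a primitive of this
  cochain would have a bounding chain as its row x.\<close>

lemma homology_imp_cohom:
  assumes L': "labels n L' \<pi>'" and i: "i \<le> m" and x: "x \<in> set L'"
    and nz: "homology_nonzero TYPE('k::field) n ws (\<pi>' x) (m - i)"
  shows "cohom_nonzero n R dR (free_rep n L' \<pi>' :: 'k rep) i"
proof -
  let ?N = "free_rep n L' \<pi>' :: 'k rep"
  obtain a :: "bool list \<Rightarrow> 'k" where
    a: "chain n ws (\<pi>' x) (m - i) a"
    and cyc: "\<forall>I\<in>cube m. boundary m a I = 0"
    and nb: "\<not> (\<exists>b. chain n ws (\<pi>' x) (Suc (m - i)) b \<and>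
      (\<forall>I\<in>cube m. boundary m b I = a I))"
    using nz by (rule homology_nonzeroE)
  define c where "c y I = (if y = x then a I else 0)" for y I
  have c: "c y I \<noteq> 0 \<Longrightarrow> I \<in> set (idx i) \<and> bruhat_le n (dem n ws I) (\<pi>' y)" for y I
    using a i by (auto simp: c_def set_idx split: if_splits)
  have cs: "supported (set L') \<pi>' i c" unfolding supported_def using c by blast
  let ?f = "\<lambda>p. bmat (fb n L' \<pi>' p) (B i p) c"
  have f: "is_hom n (R i) ?N ?f" unfolding R_def
    by (rule bmat_hom[OF labels_idx L']) (use c in blast)
  have fd: "?f p * dR (Suc i) p = 0\<^sub>m (rdim ?N p) (rdim (R (Suc i) :: 'k rep) p)" for p
  proof -
    have "boundary m (c y) I = 0" if "I \<in> cube m" for y I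
      using cyc that by (cases "y = x") (simp_all add: c_def boundary_def)
    then show ?thesis unfolding bmat_dR[OF cs] by (simp add: R_rdim bmat_zero bmat_eq_iff set_idx)
  qed
  have "case i of 0 \<Rightarrow> \<not> (\<forall>p \<in> Sym n. ?f p = 0\<^sub>m (rdim ?N p) (rdim (R 0 :: 'k rep) p))
      | Suc j \<Rightarrow> \<not> (\<exists>g. is_hom n (R j) ?N g \<and> (\<forall>p \<in> Sym n. ?f p = g p * dR (Suc j) p))"
  proof (cases i)
    case 0
    have "\<not> (\<forall>p \<in> Sym n. ?f p = 0\<^sub>m (rdim ?N p) (rdim (R 0 :: 'k rep) p))"
    proof
      assume z: "\<forall>p \<in> Sym n. ?f p = 0\<^sub>m (rdim ?N p) (rdim (R 0 :: 'k rep) p)"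
      have "a I = 0" if I: "I \<in> cube m" for I
      proof -
        have "c x I = (\<lambda>_ _. 0) x I"
        proof (rule supported_eqI[OF cs _ _ x I])
          show "supported (set L') \<pi>' i (\<lambda>_ _. 0::'k)" by (simp add: supported_def)
          fix p assume "p \<in> Sym n"
          then show "?f p = bmat (fb n L' \<pi>' p) (B i p) (\<lambda>_ _. 0)"
            using z 0 by (simp add: R_rdim bmat_zero)
        qed
        then show ?thesis by (simp add: c_def)
      qed
      then show False using nb by (auto intro!: exI[of _ "\<lambda>_. 0"] simp: boundary_def)
    qed
    then show ?thesis using 0 by simp
  next
    case (Suc j)
    have "\<not> (\<exists>g. is_hom n (R j) ?N g \<and> (\<forall>p \<in> Sym n. ?f p = g p * dR (Suc j) p))"
    proof
      assume "\<exists>g. is_hom n (R j) ?N g \<and> (\<forall>p \<in> Sym n. ?f p = g p * dR (Suc j) p)"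
      then obtain g where g: "is_hom n (R j) ?N g" "\<And>p. p \<in> Sym n \<Longrightarrow> ?f p = g p * dR (Suc j) p" by blast
      obtain c' where c': "\<And>a b. c' a b \<noteq> 0 \<Longrightarrow> a \<in> set L' \<and> b \<in> set (idx j) \<and> bruhat_le n (dem n ws b) (\<pi>' a)"
        "\<And>p. p \<in> Sym n \<Longrightarrow> g p = bmat (fb n L' \<pi>' p) (B j p) c'"
        using hom_bmat[OF labels_idx L' g(1)[unfolded R_def]] by blast
      have cs': "supported (set L') \<pi>' j c'" unfolding supported_def using c'(1) by blast
      have "boundary m (c' x) I = a I" if I: "I \<in> cube m" for I
      proof -
        have "c x I = (\<lambda>y. boundary m (c' y)) x I"
        proof (rule supported_eqI[OF cs _ _ x I])
          show "supported (set L') \<pi>' i (\<lambda>y. boundary m (c' y))"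
            using supported_boundary[OF cs'] Suc by simp
          fix p assume p: "p \<in> Sym n"
          show "?f p = bmat (fb n L' \<pi>' p) (B i p) (\<lambda>y. boundary m (c' y))"
            using g(2)[OF p] unfolding c'(2)[OF p] bmat_dR[OF cs'] Suc .
        qed
        then show ?thesis by (simp add: c_def)
      qed
      moreover have "K \<in> cube m \<and> bruhat_le n (dem n ws K) (\<pi>' x) \<and> wt K = Suc (m - i)" if "c' x K \<noteq> 0" for K
        using c'(1)[OF that] Suc i unfolding set_idx by auto
      ultimately show False using nb by blast
    qed
    then show ?thesis using Suc by simp
  qed
  then show ?thesis unfolding cohom_nonzero_def using f fd by (intro exI[of _ ?f]) blast
qed

lemma resolution_R: "resolution n (simple_module n (wprod ws)) (R :: nat \<Rightarrow> 'k::field rep) dR"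
  using R_resolution simple_module_module[OF reduced_Sym[OF red]] by unfold_locales

end

section \<open>Grade and projective dimension\<close>

lemma regular_module_free: "regular_module n = (free_rep n (Sym_enum n) (\<lambda>x. x) :: 'k::field rep)"
proof -
  have rb: "reg_basis n y = fb n (Sym_enum n) (\<lambda>x. x) y" for y
    unfolding reg_basis_def fb_def using Sym_enum[of n] covers_rtranclp by (intro filter_cong) auto
  have "fb n (Sym_enum n) (\<lambda>x. x) y = []" if "y \<notin> Sym n" for y
    using that by (auto simp: fb_def filter_empty_conv bruhat_le_def)
  then have "(\<lambda>y. if y \<in> Sym n then length (reg_basis n y) else 0) = (\<lambda>y. length (fb n (Sym_enum n) (\<lambda>x. x) y))"
    by (auto simp: rb)
  then show ?thesis unfolding regular_module_def free_rep_def rb bmat_def by simp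
qed

lemma labels_Sym_enum: "labels n (Sym_enum n) (\<lambda>x. x)"
  by unfold_locales (use Sym_enum[of n] in auto)

text \<open>This exchanges the resolution hidden in \<open>SOME\<close> for any convenient one, by
  transferring classes in both directions.\<close>

lemma ext_nonzero_iff:
  fixes M N :: "'k::field rep"
  assumes "resolution n M P d" "is_module n N"
  shows "ext_nonzero n i M N \<longleftrightarrow> cohom_nonzero n P d N i"
proof -
  let ?Pd = "SOME Pd. proj_resolution n M (fst Pd) (snd Pd)"
  have "proj_resolution n M (fst (P, d)) (snd (P, d))" using assms(1) by (simp add: resolution_def)
  then have "proj_resolution n M (fst ?Pd) (snd ?Pd)" by (rule someI)
  then have r: "resolution n M (fst ?Pd) (snd ?Pd)" using assms(1) by (simp add: resolution_def)
  show ?thesis unfolding ext_nonzero_def Let_def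
    using cohom_nonzero_transfer[OF r assms] cohom_nonzero_transfer[OF assms(1) r assms(2)] by blast
qed

lemma cohom_zero_module:
  fixes N :: "'k::field rep"
  assumes r: "resolution n M P d" and N: "is_module n N" and z: "zero_module n (P (Suc j))"
  shows "\<not> cohom_nonzero n P d N (Suc j)"
proof
  interpret resolution n M P d by (rule r)
  assume "cohom_nonzero n P d N (Suc j)"
  then obtain f where f: "is_hom n (P (Suc j)) N f"
    and nf: "\<not> (\<exists>g. is_hom n (P j) N g \<and> (\<forall>p \<in> Sym n. f p = g p * d (Suc j) p))"
    unfolding cohom_nonzero_def by auto
  let ?g = "\<lambda>p. 0\<^sub>m (rdim N p) (rdim (P j) p) :: 'k mat"
  have "is_hom n (P j) N ?g" unfolding is_hom_def
  proof (intro conjI ballI allI impI)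
    fix p q assume pq: "covers n p q"
    show "?g q * rmap (P j) p q = rmap N p q * ?g p"
      unfolding left_mult_zero_mat[OF rmap_carrier[OF mod_P pq]] right_mult_zero_mat[OF rmap_carrier[OF N pq]] ..
  qed simp
  moreover have "f p = ?g p * d (Suc j) p" if p: "p \<in> Sym n" for p
  proof (rule mat_eq_empty)
    show "f p \<in> carrier_mat (rdim N p) (rdim (P (Suc j)) p)" by (rule hom_carrier[OF f p])
    show "?g p * d (Suc j) p \<in> carrier_mat (rdim N p) (rdim (P (Suc j)) p)"
      by (rule mult_carrier_mat[OF zero_carrier_mat hom_carrier[OF d_hom_Suc p]])
    show "rdim N p = 0 \<or> rdim (P (Suc j)) p = 0" using z p by (simp add: zero_module_def)
  qed
  ultimately show False using nf by blast
qed

theorem theorem7p3: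
  fixes n :: nat and w :: "nat \<Rightarrow> nat"
  assumes "w \<in> Sym n"
  shows "perfect n (simple_module n w :: ('k :: {alg_closed_field, field_char_0}) rep)
           \<longleftrightarrow> longest_of_parabolic n w"
proof -
  let ?S = "simple_module n w :: 'k rep" and ?A = "regular_module n :: 'k rep"
  obtain ws where ws: "reduced n ws" "wprod ws = w" using reduced_word[OF assms] .
  interpret W: reduced_word n ws by unfold_locales (rule ws(1))
  let ?l = "length ws"
  have res: "resolution n ?S W.R W.dR" using W.resolution_R ws(2) by blast
  have A: "?A = free_rep n (Sym_enum n) (\<lambda>x. x)" by (rule regular_module_free)
  have mA: "is_module n ?A" unfolding A by (rule labels.F_module[OF labels_Sym_enum])
  have ext: "ext_nonzero n i ?S ?A \<longleftrightarrow> (\<exists>x\<in>Sym n. homology_nonzero TYPE('k) n ws x (?l - i))" if "i \<le> ?l" for i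
  proof -
    have "ext_nonzero n i ?S ?A \<longleftrightarrow> cohom_nonzero n W.R W.dR (free_rep n (Sym_enum n) (\<lambda>x. x) :: 'k rep) i"
      using ext_nonzero_iff[OF res mA, of i] unfolding A .
    also have "\<dots> \<longleftrightarrow> (\<exists>x\<in>set (Sym_enum n). homology_nonzero TYPE('k) n ws x (?l - i))"
    proof
      show "\<exists>x\<in>set (Sym_enum n). homology_nonzero TYPE('k) n ws x (?l - i)"
        if "cohom_nonzero n W.R W.dR (free_rep n (Sym_enum n) (\<lambda>x. x) :: 'k rep) i"
        by (rule W.cohom_imp_homology[OF labels_Sym_enum \<open>i \<le> ?l\<close> that])
      assume "\<exists>x\<in>set (Sym_enum n). homology_nonzero TYPE('k) n ws x (?l - i)"
      then obtain x where x: "x \<in> set (Sym_enum n)" "homology_nonzero TYPE('k) n ws x (?l - i)" by (rule bexE)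
      show "cohom_nonzero n W.R W.dR (free_rep n (Sym_enum n) (\<lambda>x. x) :: 'k rep) i"
        by (rule W.homology_imp_cohom[OF labels_Sym_enum \<open>i \<le> ?l\<close> x(1)]) (rule x(2))
    qed
    finally show ?thesis using Sym_enum[of n] by simp
  qed
  have top: "ext_nonzero n ?l ?S ?A"
    using ext[of ?l] homology_nonzero_0[OF ws(1)] id_Sym by auto
  have pd: "proj_dim n ?S = enat ?l"
  proof -
    let ?Q = "\<lambda>m. \<exists>P d. proj_resolution n ?S P d \<and> (\<forall>i>m. zero_module n (P i))"
    have Q: "?Q ?l" using W.R_zero res by (auto simp: resolution_def)
    \<comment> \<open>A resolution that stops before degree l would compute the nonzero Ext in
      degree l as zero.\<close>
    have "?l \<le> m" if Q_m: "?Q m" for m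
    proof (rule ccontr)
      assume lt: "\<not> ?l \<le> m"
      then obtain j where j: "?l = Suc j" by (cases ?l) auto
      obtain P d where P: "proj_resolution n ?S P d" "zero_module n (P ?l)" using Q_m lt by (metis not_le)
      have r: "resolution n ?S P d" using P(1) res by (simp add: resolution_def)
      have "cohom_nonzero n P d ?A (Suc j)" using top ext_nonzero_iff[OF r mA] j by simp
      then show False using cohom_zero_module[OF r mA] P(2) j by simp
    qed
    then have "(LEAST m. ?Q m) = ?l" using Q by (intro Least_equality) blast+
    then show ?thesis unfolding proj_dim_def using Q by auto
  qed
  have grade: "grade n ?S = enat (LEAST i. ext_nonzero n i ?S ?A)"
    unfolding grade_def using top by auto
  \<comment> \<open>The nonzero Ext in degree l bounds the grade by l, the projective dimension;
    equality means that no smaller degree contributes.\<close>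
  have perfect: "perfect n ?S \<longleftrightarrow> (\<forall>i<?l. \<not> ext_nonzero n i ?S ?A)"
    unfolding perfect_def grade pd enat.inject using top
    by (metis (mono_tags, lifting) LeastI Least_equality not_less not_less_Least)
  show ?thesis
  proof
    assume p: "perfect n ?S"
    show "longest_of_parabolic n w"
    proof (rule ccontr)
      assume "\<not> longest_of_parabolic n w"
      then obtain x k where x: "x \<in> Sym n" "k > 0" "homology_nonzero TYPE('k) n ws x k"
        using not_longest_imp_homology[OF ws(1)] ws(2) by blast
      \<comment> \<open>No subword selects more than l letters. The bound is what allows k to be
        written as l - (l - k) with truncated subtraction.\<close>
      have "k \<le> ?l"
      proof (rule ccontr)
        assume k: "\<not> k \<le> ?l"
        obtain a :: "bool list \<Rightarrow> 'k" where
          a: "chain n ws x k a"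
          and "\<forall>I\<in>cube ?l. boundary ?l a I = 0"
          and nb: "\<not> (\<exists>b. chain n ws x (Suc k) b \<and>
            (\<forall>I\<in>cube ?l. boundary ?l b I = a I))"
          using x(3) by (rule homology_nonzeroE)
        have "a I = 0" for I
          using spec[OF a, of I] wt_le[of I] k by (cases "a I = 0") (auto simp: cube_def)
        then show False using nb by (auto intro!: exI[of _ "\<lambda>_. 0"] simp: boundary_def)
      qed
      then have "ext_nonzero n (?l - k) ?S ?A" using ext[of "?l - k"] x by auto
      moreover have "?l - k < ?l" using x(2) \<open>k \<le> ?l\<close> by simp
      ultimately show False using p perfect by blast
    qed
  next
    assume long: "longest_of_parabolic n w"
    have "\<not> ext_nonzero n i ?S ?A" if i: "i < ?l" for i
    proof
      assume "ext_nonzero n i ?S ?A"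
      then obtain x where x: "x \<in> Sym n" "homology_nonzero TYPE('k) n ws x (?l - i)" using ext[of i] i by auto
      text \<open>The reduced word that makes the complex of \<open>x\<close> a cone depends on \<open>x\<close>; both words
        compute \<open>Ext (L\<^sub>w, A e\<^sub>x)\<close>.\<close>
      obtain vs where vs: "reduced n vs" "wprod vs = w" "\<forall>k>0. \<not> homology_nonzero TYPE('k) n vs x k"
        using longest_of_parabolic_imp_exact[OF assms long x(1)] by blast
      interpret V: reduced_word n vs by unfold_locales (rule vs(1))
      have len: "length vs = ?l" using clen_reduced[OF vs(1)] clen_reduced[OF ws(1)] vs(2) ws(2) by simp
      have lx: "labels n [x] (\<lambda>x. x)" by unfold_locales (use x in auto)
      have "cohom_nonzero n W.R W.dR (free_rep n [x] (\<lambda>x. x) :: 'k rep) i"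
        by (rule W.homology_imp_cohom[OF lx, of _ x]) (use i x(2) in simp_all)
      then have "cohom_nonzero n V.R V.dR (free_rep n [x] (\<lambda>x. x) :: 'k rep) i"
        by (rule cohom_nonzero_transfer[OF res V.resolution_R[unfolded vs(2)] labels.F_module[OF lx]])
      then have "homology_nonzero TYPE('k) n vs x (?l - i)"
        using V.cohom_imp_homology[OF lx, of i, where ?'k = 'k] i len by simp
      then show False using vs(3) i by simp
    qed
    then show "perfect n ?S" using perfect by blast
  qed
qed

end
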